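(* Let $\mathcal{E}$ be an exact category with enough projectives, and assume that $\mathcal{E}$ is weakly idempotent complete. Then the assignments $$\mathcal{T}\mapsto ({}^{\bot_1}\mathsf{Fac}\,\mathcal{T},\ \mathsf{Fac}\,\mathcal{T}),\qquad (\mathcal{C},\mathcal{D})\mapsto \mathcal{C}\cap\mathcal{D}$$ are mutually inverse bijections between the collection of support $\tau$-tilting subcategories $\mathcal{T}$ of $\mathcal{E}$ and the collection of $\tau$-cotorsion pairs $(\mathcal{C},\mathcal{D})$ in $\mathcal{E}$ such that $\mathcal{D}$ is a torsion class. Moreover, these bijections restrict to mutually inverse bijections between the collection of tilting subcategories of $\mathcal{E}$ and the collection of cotorsion pairs $(\mathcal{C},\mathcal{D})$ in $\mathcal{E}$ such that $\mathcal{D}$ is a torsion class.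
   Context: Subcategories are full and closed under isomorphisms. $\mathcal{E}=(\mathcal{A},\mathcal{S})$ is a (Quillen) exact category: $\mathcal{A}$ is additive and $\mathcal{S}$ is the class of conflations $X\rightarrowtail Y\twoheadrightarrow Z$, whose first morphism is called an inflation and whose second is called a deflation. An object $P$ is projective if $\mathrm{Hom}_{\mathcal{E}}(P,-)$ sends conflations to short exact sequences; $\mathcal{P}$ is the subcategory of projectives; $\mathcal{E}$ has enough projectives if every object $X$ admits a deflation $P\twoheadrightarrow X$ with $P\in\mathcal{P}$. Weakly idempotent complete means that every section has a cokernel. A morphism is admissible if it equals $i\circ d$ with $d$ a deflation and $i$ an inflation. A sequence of composable morphisms is exact if every morphism is admissible and $\mathrm{Im}=\mathrm{Ker}$ at every intermediate object; thus $P\xrightarrow{f}T^0\twoheadrightarrow T^1$ exact means that $f$ is admissible and that $\mathrm{Im} f$ is the kernel of the deflation $T^0\twoheadrightarrow T^1$. $\mathrm{Ext}^n_{\mathcal{E}}$ denotes the Yoneda extension groups, and ${}^{\bot_1}\mathcal{X}=\{Y\in\mathcal{E} : \mathrm{Ext}^1_{\mathcal{E}}(Y,X)=0\ \forall X\in\mathcal{X}\}$. A subcategory is additively closed if it is closed under direct summands of finite direct sums. $\mathsf{Fac}\,\mathcal{T}=\{X\in\mathcal{E} : \exists\text{ a deflation } T\twoheadrightarrow X,\ T\in\mathcal{T}\}$. A left $\mathcal{T}$-approximation of $X$ is a morphism $f:X\to T$ with $T\in\mathcal{T}$ such that every morphism $X\to T'$ with $T'\in\mathcal{T}$ factors through $f$.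 An additively closed subcategory $\mathcal{T}$ of $\mathcal{E}$ is support $\tau$-tilting if (1) $\mathrm{Ext}^1_{\mathcal{E}}(\mathcal{T},\mathsf{Fac}\,\mathcal{T})=0$; and (2) for every $P\in\mathcal{P}$ there is an exact sequence $P\xrightarrow{f}T^0\twoheadrightarrow T^1$ with $T^0,T^1\in\mathcal{T}$ and $f$ a left $\mathcal{T}$-approximation. Tilting means 1-tilting. As $\mathcal{E}$ has enough projectives, an additive subcategory $\mathcal{T}$ is tilting iff: it is closed under direct summands and $\mathrm{Ext}^i_{\mathcal{E}}(\mathcal{T},\mathcal{T})=0$ for all $i\ge 1$; $\mathrm{pd}_{\mathcal{E}}T\le 1$ for all $T\in\mathcal{T}$, i.e. $\mathrm{Ext}^2_{\mathcal{E}}(T,-)=0$; and every $P\in\mathcal{P}$ admits a conflation $P\rightarrowtail T^0\twoheadrightarrow T^1$ with $T^0,T^1\in\mathcal{T}$. A pair $(\mathcal{C},\mathcal{D})$ of subcategories is a $\tau$-cotorsion pair if (1) $\mathcal{C}={}^{\bot_1}\mathcal{D}$, and (2) for every $P\in\mathcal{P}$ there is an exact sequence $P\xrightarrow{f}D\twoheadrightarrow C$ with $D\in\mathcal{C}\cap\mathcal{D}$, $C\in\mathcal{C}$ and $f$ a left $\mathcal{D}$-approximation. A pair $(\mathcal{C},\mathcal{D})$ is a (complete) cotorsion pair if $\mathcal{C},\mathcal{D}$ are closed under direct summands, $\mathrm{Ext}^1_{\mathcal{E}}(\mathcal{C},\mathcal{D})=0$, and every $X\in\mathcal{E}$ admits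 conflations $D\rightarrowtail C\twoheadrightarrow X$ and $X\rightarrowtail D'\twoheadrightarrow C'$ with $C,C'\in\mathcal{C}$, $D,D'\in\mathcal{D}$. A subcategory $\mathcal{D}$ is a torsion class if it is factor closed ($\mathsf{Fac}\,\mathcal{D}\subseteq\mathcal{D}$) and closed under extensions. *)

theory Defs
  imports "HOL-Algebra.Exact_Sequence" "HOL-Algebra.FiniteProduct"
begin

section \<open>Exact categories\<close>

record ('o, 'm) category_data =
  obj :: "'o set"
  arr :: "'m set"
  src :: "'m \<Rightarrow> 'o"
  tgt :: "'m \<Rightarrow> 'o"
  idt :: "'o \<Rightarrow> 'm"
  cmp :: "'m \<Rightarrow> 'm \<Rightarrow> 'm"  (infixr "\<cdot>\<index>" 70)

definition Hom :: "('o, 'm, 'z) category_data_scheme \<Rightarrow> 'o \<Rightarrow> 'o \<Rightarrow> 'm set"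
  where "Hom E X Y = {f \<in> arr E. src E f = X \<and> tgt E f = Y}"

text \<open>\<open>g \<cdot> f\<close> is "first \<open>f\<close>, then \<open>g\<close>".\<close>

locale category =
  fixes E (structure)
  assumes src_in_obj: "f \<in> arr E \<Longrightarrow> src E f \<in> obj E"
    and tgt_in_obj: "f \<in> arr E \<Longrightarrow> tgt E f \<in> obj E"
    and idt_in_Hom: "X \<in> obj E \<Longrightarrow> idt E X \<in> Hom E X X"
    and cmp_in_Hom: "\<lbrakk>f \<in> Hom E X Y; g \<in> Hom E Y Z\<rbrakk> \<Longrightarrow> g \<cdot> f \<in> Hom E X Z"
    and cmp_idt_left: "f \<in> Hom E X Y \<Longrightarrow> idt E Y \<cdot> f = f"
    and cmp_idt_right: "f \<in> Hom E X Y \<Longrightarrow> f \<cdot> idt E X = f"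
    and cmp_assoc: "\<lbrakk>f \<in> Hom E W X; g \<in> Hom E X Y; h \<in> Hom E Y Z\<rbrakk>
                     \<Longrightarrow> (h \<cdot> g) \<cdot> f = h \<cdot> (g \<cdot> f)"

definition is_iso :: "('o, 'm, 'z) category_data_scheme \<Rightarrow> 'm \<Rightarrow> bool"
  where "is_iso E f \<longleftrightarrow> f \<in> arr E \<and>
    (\<exists>g \<in> Hom E (tgt E f) (src E f).
        g \<cdot>\<^bsub>E\<^esub> f = idt E (src E f) \<and> f \<cdot>\<^bsub>E\<^esub> g = idt E (tgt E f))"

text \<open>Commutative square \<open>f' \<cdot> i = i' \<cdot> f\<close> with \<open>i : X \<rightarrow> Y\<close>, \<open>f : X \<rightarrow> X'\<close>,
  \<open>f' : Y \<rightarrow> Y'\<close>, \<open>i' : X' \<rightarrow> Y'\<close>.\<close>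

definition is_pushout :: "('o, 'm, 'z) category_data_scheme \<Rightarrow> 'm \<Rightarrow> 'm \<Rightarrow> 'm \<Rightarrow> 'm \<Rightarrow> bool"
  where "is_pushout E i f f' i' \<longleftrightarrow>
    {i, f, f', i'} \<subseteq> arr E \<and> src E i = src E f \<and> tgt E i = src E f' \<and>
    tgt E f = src E i' \<and> tgt E f' = tgt E i' \<and>
    f' \<cdot>\<^bsub>E\<^esub> i = i' \<cdot>\<^bsub>E\<^esub> f \<and>
    (\<forall>W. \<forall>a \<in> Hom E (tgt E i) W. \<forall>b \<in> Hom E (tgt E f) W.
       a \<cdot>\<^bsub>E\<^esub> i = b \<cdot>\<^bsub>E\<^esub> f \<longrightarrow>
       (\<exists>!u. u \<in> Hom E (tgt E f') W \<and> u \<cdot>\<^bsub>E\<^esub> f' = a \<and> u \<cdot>\<^bsub>E\<^esub> i' = b))"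

text \<open>Commutative square \<open>p \<cdot> f' = f \<cdot> p'\<close> with \<open>p : Y \<rightarrow> Z\<close>, \<open>f : Z' \<rightarrow> Z\<close>,
  \<open>f' : Y' \<rightarrow> Y\<close>, \<open>p' : Y' \<rightarrow> Z'\<close>.\<close>

definition is_pullback :: "('o, 'm, 'z) category_data_scheme \<Rightarrow> 'm \<Rightarrow> 'm \<Rightarrow> 'm \<Rightarrow> 'm \<Rightarrow> bool"
  where "is_pullback E p f f' p' \<longleftrightarrow>
    {p, f, f', p'} \<subseteq> arr E \<and> tgt E p = tgt E f \<and> src E p = tgt E f' \<and>
    src E f = tgt E p' \<and> src E f' = src E p' \<and>
    p \<cdot>\<^bsub>E\<^esub> f' = f \<cdot>\<^bsub>E\<^esub> p' \<and>
    (\<forall>W. \<forall>a \<in> Hom E W (src E p). \<forall>b \<in> Hom E W (src E f).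
       p \<cdot>\<^bsub>E\<^esub> a = f \<cdot>\<^bsub>E\<^esub> b \<longrightarrow>
       (\<exists>!u. u \<in> Hom E W (src E f') \<and> f' \<cdot>\<^bsub>E\<^esub> u = a \<and> p' \<cdot>\<^bsub>E\<^esub> u = b))"

record ('o, 'm) preadditive_data = "('o, 'm) category_data" +
  hplus :: "'m \<Rightarrow> 'm \<Rightarrow> 'm"
  hzero :: "'o \<Rightarrow> 'o \<Rightarrow> 'm"

text \<open>The additive group \<open>Hom(X, Y)\<close>, written multiplicatively as in HOL-Algebra.\<close>

definition hom_group :: "('o, 'm, 'z) preadditive_data_scheme \<Rightarrow> 'o \<Rightarrow> 'o \<Rightarrow> 'm monoid"
  where "hom_group E X Y = \<lparr>carrier = Hom E X Y, mult = hplus E, one = hzero E X Y\<rparr>"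

locale preadditive_category = category +
  assumes hom_comm_group: "\<lbrakk>X \<in> obj E; Y \<in> obj E\<rbrakk> \<Longrightarrow> comm_group (hom_group E X Y)"
    and cmp_hplus_right: "\<lbrakk>f \<in> Hom E X Y; g \<in> Hom E X Y; h \<in> Hom E Y Z\<rbrakk>
                           \<Longrightarrow> h \<cdot> hplus E f g = hplus E (h \<cdot> f) (h \<cdot> g)"
    and cmp_hplus_left: "\<lbrakk>h \<in> Hom E X Y; f \<in> Hom E Y Z; g \<in> Hom E Y Z\<rbrakk>
                          \<Longrightarrow> hplus E f g \<cdot> h = hplus E (f \<cdot> h) (g \<cdot> h)"

text \<open>\<open>S\<close> is the direct sum (biproduct) of the finite list \<open>Xs\<close>, with injections \<open>i k\<close> and
  projections \<open>p k\<close>; the direct sum of the empty list is a zero object.\<close>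

definition direct_sum ::
  "('o, 'm, 'z) preadditive_data_scheme \<Rightarrow> 'o list \<Rightarrow> 'o \<Rightarrow> (nat \<Rightarrow> 'm) \<Rightarrow> (nat \<Rightarrow> 'm) \<Rightarrow> bool"
  where "direct_sum E Xs S i p \<longleftrightarrow>
    set Xs \<subseteq> obj E \<and> S \<in> obj E \<and>
    (\<forall>k < length Xs. i k \<in> Hom E (Xs ! k) S \<and> p k \<in> Hom E S (Xs ! k)) \<and>
    (\<forall>k < length Xs. \<forall>l < length Xs.
       p k \<cdot>\<^bsub>E\<^esub> i l = (if k = l then idt E (Xs ! k) else hzero E (Xs ! l) (Xs ! k))) \<and>
    (\<Otimes>\<^bsub>hom_group E S S\<^esub>k\<in>{..<length Xs}. i k \<cdot>\<^bsub>E\<^esub> p k) = idt E S"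

locale additive_category = preadditive_category +
  assumes ex_direct_sum: "set Xs \<subseteq> obj E \<Longrightarrow> \<exists>S i p. direct_sum E Xs S i p"

definition is_kernel :: "('o, 'm, 'z) preadditive_data_scheme \<Rightarrow> 'm \<Rightarrow> 'm \<Rightarrow> bool"
  where "is_kernel E g k \<longleftrightarrow>
    g \<in> arr E \<and> k \<in> arr E \<and> tgt E k = src E g \<and>
    g \<cdot>\<^bsub>E\<^esub> k = hzero E (src E k) (tgt E g) \<and>
    (\<forall>W. \<forall>h \<in> Hom E W (src E g). g \<cdot>\<^bsub>E\<^esub> h = hzero E W (tgt E g) \<longrightarrow>
       (\<exists>!u. u \<in> Hom E W (src E k) \<and> k \<cdot>\<^bsub>E\<^esub> u = h))"

definition is_cokernel :: "('o, 'm, 'z) preadditive_data_scheme \<Rightarrow> 'm \<Rightarrow> 'm \<Rightarrow> bool"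
  where "is_cokernel E f c \<longleftrightarrow>
    f \<in> arr E \<and> c \<in> arr E \<and> tgt E f = src E c \<and>
    c \<cdot>\<^bsub>E\<^esub> f = hzero E (src E f) (tgt E c) \<and>
    (\<forall>W. \<forall>h \<in> Hom E (tgt E f) W. h \<cdot>\<^bsub>E\<^esub> f = hzero E (src E f) W \<longrightarrow>
       (\<exists>!u. u \<in> Hom E (tgt E c) W \<and> u \<cdot>\<^bsub>E\<^esub> c = h))"

definition kernel_cokernel_pair :: "('o, 'm, 'z) preadditive_data_scheme \<Rightarrow> 'm \<Rightarrow> 'm \<Rightarrow> bool"
  where "kernel_cokernel_pair E i p \<longleftrightarrow> is_kernel E p i \<and> is_cokernel E i p"

record ('o, 'm) exact_data = "('o, 'm) preadditive_data" +
  conflations :: "('m \<times> 'm) set"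

definition inflation :: "('o, 'm, 'z) exact_data_scheme \<Rightarrow> 'm \<Rightarrow> bool"
  where "inflation E i \<longleftrightarrow> (\<exists>p. (i, p) \<in> conflations E)"

definition deflation :: "('o, 'm, 'z) exact_data_scheme \<Rightarrow> 'm \<Rightarrow> bool"
  where "deflation E p \<longleftrightarrow> (\<exists>i. (i, p) \<in> conflations E)"

text \<open>\<open>X \<rightarrowtail> Y \<twoheadrightarrow> Z\<close> is a conflation.\<close>

definition conflation_on ::
  "('o, 'm, 'z) exact_data_scheme \<Rightarrow> 'o \<Rightarrow> 'o \<Rightarrow> 'o \<Rightarrow> 'm \<Rightarrow> 'm \<Rightarrow> bool"
  where "conflation_on E X Y Z i p \<longleftrightarrow>
    (i, p) \<in> conflations E \<and> i \<in> Hom E X Y \<and> p \<in> Hom E Y Z"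

text \<open>Quillen's axioms in the form given by Buehler.\<close>

locale exact_category = additive_category +
  assumes conflation_kernel_cokernel:
      "(i, p) \<in> conflations E \<Longrightarrow> kernel_cokernel_pair E i p"
    and conflation_iso_closed:
      "\<lbrakk>(i, p) \<in> conflations E; i' \<in> Hom E X' Y'; p' \<in> Hom E Y' Z';
        is_iso E a; is_iso E b; is_iso E c;
        a \<in> Hom E (src E i) X'; b \<in> Hom E (src E p) Y'; c \<in> Hom E (tgt E p) Z';
        b \<cdot> i = i' \<cdot> a; c \<cdot> p = p' \<cdot> b\<rbrakk> \<Longrightarrow> (i', p') \<in> conflations E"
    and idt_inflation: "X \<in> obj E \<Longrightarrow> inflation E (idt E X)"
    and idt_deflation: "X \<in> obj E \<Longrightarrow> deflation E (idt E X)"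
    and inflation_cmp:
      "\<lbrakk>inflation E i; inflation E j; tgt E i = src E j\<rbrakk> \<Longrightarrow> inflation E (j \<cdot> i)"
    and deflation_cmp:
      "\<lbrakk>deflation E p; deflation E q; tgt E p = src E q\<rbrakk> \<Longrightarrow> deflation E (q \<cdot> p)"
    and inflation_pushout:
      "\<lbrakk>inflation E i; f \<in> arr E; src E f = src E i\<rbrakk>
       \<Longrightarrow> \<exists>f' i'. is_pushout E i f f' i' \<and> inflation E i'"
    and deflation_pullback:
      "\<lbrakk>deflation E p; f \<in> arr E; tgt E f = tgt E p\<rbrakk>
       \<Longrightarrow> \<exists>f' p'. is_pullback E p f f' p' \<and> deflation E p'"

definition weakly_idempotent_complete :: "('o, 'm, 'z) preadditive_data_scheme \<Rightarrow> bool"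
  where "weakly_idempotent_complete E \<longleftrightarrow>
    (\<forall>s \<in> arr E. (\<exists>r \<in> Hom E (tgt E s) (src E s). r \<cdot>\<^bsub>E\<^esub> s = idt E (src E s)) \<longrightarrow>
       (\<exists>c. is_cokernel E s c))"

definition projectives :: "('o, 'm, 'z) exact_data_scheme \<Rightarrow> 'o set"
  where "projectives E = {P \<in> obj E. \<forall>X Y Z i p. conflation_on E X Y Z i p \<longrightarrow>
    short_exact_sequence (hom_group E P Z) (hom_group E P Y) (hom_group E P X)
      (\<lambda>h. p \<cdot>\<^bsub>E\<^esub> h) (\<lambda>h. i \<cdot>\<^bsub>E\<^esub> h)}"

definition enough_projectives :: "('o, 'm, 'z) exact_data_scheme \<Rightarrow> bool"
  where "enough_projectives E \<longleftrightarrow>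
    (\<forall>X \<in> obj E. \<exists>P \<in> projectives E. \<exists>d \<in> Hom E P X. deflation E d)"


section \<open>Exact sequences and Yoneda extensions\<close>

definition admissible :: "('o, 'm, 'z) exact_data_scheme \<Rightarrow> 'm \<Rightarrow> bool"
  where "admissible E f \<longleftrightarrow>
    (\<exists>i d. deflation E d \<and> inflation E i \<and> tgt E d = src E i \<and> f = i \<cdot>\<^bsub>E\<^esub> d)"

text \<open>\<open>Im f = Ker g\<close>, where the image of an admissible \<open>f = i \<cdot> d\<close> is the (up to isomorphism
  unique) inflation \<open>i\<close>.\<close>

definition im_eq_ker :: "('o, 'm, 'z) exact_data_scheme \<Rightarrow> 'm \<Rightarrow> 'm \<Rightarrow> bool"
  where "im_eq_ker E f g \<longleftrightarrow>
    (\<exists>i d. deflation E d \<and> inflation E i \<and> tgt E d = src E i \<and> f = i \<cdot>\<^bsub>E\<^esub> d \<and> is_kernel E g i)"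

text \<open>A list \<open>[f0, f1, \<dots>]\<close> stands for the sequence that starts with \<open>f0\<close>.\<close>

definition exact_sequence :: "('o, 'm, 'z) exact_data_scheme \<Rightarrow> 'm list \<Rightarrow> bool"
  where "exact_sequence E fs \<longleftrightarrow>
    (\<forall>f \<in> set fs. admissible E f) \<and>
    (\<forall>k. Suc k < length fs \<longrightarrow>
       tgt E (fs ! k) = src E (fs ! Suc k) \<and> im_eq_ker E (fs ! k) (fs ! Suc k))"

text \<open>Exact sequences \<open>Y \<rightarrowtail> E\<^sub>n \<rightarrow> \<dots> \<rightarrow> E\<^sub>1 \<twoheadrightarrow> X\<close>, given by their \<open>n + 1\<close> morphisms (\<open>n \<ge> 1\<close>).\<close>

definition extensions :: "('o, 'm, 'z) exact_data_scheme \<Rightarrow> nat \<Rightarrow> 'o \<Rightarrow> 'o \<Rightarrow> 'm list set"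
  where "extensions E n X Y =
    {fs. length fs = Suc n \<and> exact_sequence E fs \<and>
         inflation E (hd fs) \<and> deflation E (last fs) \<and> src E (hd fs) = Y \<and> tgt E (last fs) = X}"

text \<open>There is a morphism of extensions that is the identity on both ends.\<close>

definition extension_morphism ::
  "('o, 'm, 'z) exact_data_scheme \<Rightarrow> nat \<Rightarrow> 'o \<Rightarrow> 'o \<Rightarrow> 'm list \<Rightarrow> 'm list \<Rightarrow> bool"
  where "extension_morphism E n X Y fs gs \<longleftrightarrow>
    fs \<in> extensions E n X Y \<and> gs \<in> extensions E n X Y \<and>
    (\<exists>h :: nat \<Rightarrow> 'm. h 0 = idt E Y \<and> h (Suc n) = idt E X \<and>
       (\<forall>k \<le> n. h k \<in> Hom E (src E (fs ! k)) (src E (gs ! k)) \<and>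
                h (Suc k) \<in> Hom E (tgt E (fs ! k)) (tgt E (gs ! k)) \<and>
                h (Suc k) \<cdot>\<^bsub>E\<^esub> (fs ! k) = (gs ! k) \<cdot>\<^bsub>E\<^esub> h k))"

definition Yoneda_Ext :: "('o, 'm, 'z) exact_data_scheme \<Rightarrow> nat \<Rightarrow> 'o \<Rightarrow> 'o \<Rightarrow> 'm list set set"
  where "Yoneda_Ext E n X Y =
    extensions E n X Y // {(fs, gs). equivclp (extension_morphism E n X Y) fs gs}"

text \<open>Only the vanishing of the group \<open>Ext\<^sup>n(X, Y)\<close>, \<open>n \<ge> 1\<close>, is ever used. A group is zero iff its
  underlying set has exactly one element, so the Baer sum need not be introduced.\<close>

definition Ext_zero :: "('o, 'm, 'z) exact_data_scheme \<Rightarrow> nat \<Rightarrow> 'o \<Rightarrow> 'o \<Rightarrow> bool"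
  where "Ext_zero E n X Y \<longleftrightarrow> is_singleton (Yoneda_Ext E n X Y)"


section \<open>Subcategories\<close>

text \<open>Full subcategories closed under isomorphisms, given by their sets of objects.\<close>

definition subcategory :: "('o, 'm, 'z) category_data_scheme \<Rightarrow> 'o set \<Rightarrow> bool"
  where "subcategory E \<X> \<longleftrightarrow> \<X> \<subseteq> obj E \<and>
    (\<forall>f. is_iso E f \<and> src E f \<in> \<X> \<longrightarrow> tgt E f \<in> \<X>)"

definition direct_summand :: "('o, 'm, 'z) preadditive_data_scheme \<Rightarrow> 'o \<Rightarrow> 'o \<Rightarrow> bool"
  where "direct_summand E X S \<longleftrightarrow> (\<exists>Y i p. direct_sum E [X, Y] S i p)"

definition summand_closed :: "('o, 'm, 'z) preadditive_data_scheme \<Rightarrow> 'o set \<Rightarrow> bool"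
  where "summand_closed E \<X> \<longleftrightarrow> (\<forall>S \<in> \<X>. \<forall>X. direct_summand E X S \<longrightarrow> X \<in> \<X>)"

definition sum_closed :: "('o, 'm, 'z) preadditive_data_scheme \<Rightarrow> 'o set \<Rightarrow> bool"
  where "sum_closed E \<X> \<longleftrightarrow>
    (\<forall>Xs S i p. set Xs \<subseteq> \<X> \<and> direct_sum E Xs S i p \<longrightarrow> S \<in> \<X>)"

definition additively_closed :: "('o, 'm, 'z) preadditive_data_scheme \<Rightarrow> 'o set \<Rightarrow> bool"
  where "additively_closed E \<X> \<longleftrightarrow>
    (\<forall>Xs S i p X. set Xs \<subseteq> \<X> \<and> direct_sum E Xs S i p \<and> direct_summand E X S \<longrightarrow> X \<in> \<X>)"

definition extension_closed :: "('o, 'm, 'z) exact_data_scheme \<Rightarrow> 'o set \<Rightarrow> bool"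
  where "extension_closed E \<X> \<longleftrightarrow>
    (\<forall>X Y Z i p. conflation_on E X Y Z i p \<and> X \<in> \<X> \<and> Z \<in> \<X> \<longrightarrow> Y \<in> \<X>)"

definition Fac :: "('o, 'm, 'z) exact_data_scheme \<Rightarrow> 'o set \<Rightarrow> 'o set"
  where "Fac E \<T> = {X \<in> obj E. \<exists>T \<in> \<T>. \<exists>d \<in> Hom E T X. deflation E d}"

definition left_perp1 :: "('o, 'm, 'z) exact_data_scheme \<Rightarrow> 'o set \<Rightarrow> 'o set"
  where "left_perp1 E \<X> = {Y \<in> obj E. \<forall>X \<in> \<X>. Ext_zero E 1 Y X}"

definition left_approximation :: "('o, 'm, 'z) category_data_scheme \<Rightarrow> 'o set \<Rightarrow> 'm \<Rightarrow> bool"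
  where "left_approximation E \<T> f \<longleftrightarrow> f \<in> arr E \<and> tgt E f \<in> \<T> \<and>
    (\<forall>T' \<in> \<T>. \<forall>g \<in> Hom E (src E f) T'. \<exists>h \<in> Hom E (tgt E f) T'. g = h \<cdot>\<^bsub>E\<^esub> f)"

definition torsion_class :: "('o, 'm, 'z) exact_data_scheme \<Rightarrow> 'o set \<Rightarrow> bool"
  where "torsion_class E \<D> \<longleftrightarrow> subcategory E \<D> \<and> Fac E \<D> \<subseteq> \<D> \<and> extension_closed E \<D>"

definition support_tau_tilting :: "('o, 'm, 'z) exact_data_scheme \<Rightarrow> 'o set \<Rightarrow> bool"
  where "support_tau_tilting E \<T> \<longleftrightarrow>
    subcategory E \<T> \<and> additively_closed E \<T> \<and>
    (\<forall>T \<in> \<T>. \<forall>X \<in> Fac E \<T>. Ext_zero E 1 T X) \<and>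
    (\<forall>P \<in> projectives E. \<exists>T0 \<in> \<T>. \<exists>T1 \<in> \<T>. \<exists>f \<in> Hom E P T0. \<exists>g \<in> Hom E T0 T1.
       exact_sequence E [f, g] \<and> deflation E g \<and> left_approximation E \<T> f)"

definition tilting :: "('o, 'm, 'z) exact_data_scheme \<Rightarrow> 'o set \<Rightarrow> bool"
  where "tilting E \<T> \<longleftrightarrow>
    subcategory E \<T> \<and> sum_closed E \<T> \<and> summand_closed E \<T> \<and>
    (\<forall>n \<ge> 1. \<forall>T \<in> \<T>. \<forall>T' \<in> \<T>. Ext_zero E n T T') \<and>
    (\<forall>T \<in> \<T>. \<forall>X \<in> obj E. Ext_zero E 2 T X) \<and>
    (\<forall>P \<in> projectives E. \<exists>T0 \<in> \<T>. \<exists>T1 \<in> \<T>. \<exists>i p. conflation_on E P T0 T1 i p)"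

definition tau_cotorsion_pair :: "('o, 'm, 'z) exact_data_scheme \<Rightarrow> 'o set \<Rightarrow> 'o set \<Rightarrow> bool"
  where "tau_cotorsion_pair E \<C> \<D> \<longleftrightarrow>
    subcategory E \<C> \<and> subcategory E \<D> \<and>
    \<C> = left_perp1 E \<D> \<and>
    (\<forall>P \<in> projectives E. \<exists>D \<in> \<C> \<inter> \<D>. \<exists>C \<in> \<C>. \<exists>f \<in> Hom E P D. \<exists>g \<in> Hom E D C.
       exact_sequence E [f, g] \<and> deflation E g \<and> left_approximation E \<D> f)"

definition cotorsion_pair :: "('o, 'm, 'z) exact_data_scheme \<Rightarrow> 'o set \<Rightarrow> 'o set \<Rightarrow> bool"
  where "cotorsion_pair E \<C> \<D> \<longleftrightarrow>
    subcategory E \<C> \<and> subcategory E \<D> \<and>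
    summand_closed E \<C> \<and> summand_closed E \<D> \<and>
    (\<forall>C \<in> \<C>. \<forall>D \<in> \<D>. Ext_zero E 1 C D) \<and>
    (\<forall>X \<in> obj E.
       (\<exists>D \<in> \<D>. \<exists>C \<in> \<C>. \<exists>i p. conflation_on E D C X i p) \<and>
       (\<exists>D' \<in> \<D>. \<exists>C' \<in> \<C>. \<exists>i p. conflation_on E X D' C' i p))"

definition mutually_inverse_bijections :: "('a \<Rightarrow> 'b) \<Rightarrow> ('b \<Rightarrow> 'a) \<Rightarrow> 'a set \<Rightarrow> 'b set \<Rightarrow> bool"
  where "mutually_inverse_bijections F G A B \<longleftrightarrow>
    bij_betw F A B \<and> bij_betw G B A \<and> (\<forall>a \<in> A. G (F a) = a) \<and> (\<forall>b \<in> B. F (G b) = b)"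

end

theory Submission
  imports Defs
begin

text \<open>
  Everything is reduced to the splitting of conflations and to lifting problems against a syzygy
  \<open>K \<rightarrowtail> P \<twoheadrightarrow> X\<close> with \<open>P\<close> projective: \<open>Ext\<^sup>1(X, Y) = 0\<close> means that all conflations
  \<open>Y \<rightarrowtail> M \<twoheadrightarrow> X\<close> split, \<open>Ext\<^sup>2(X, Y) = 0\<close> yields lifts along 2-extensions up to maps factoring
  through \<open>P\<close>, and \<open>Ext\<^sup>n(X, -) = 0\<close> for \<open>n \<ge> 2\<close> as soon as \<open>K\<close> is projective.

  Let \<open>\<T>\<close> be support \<open>\<tau>\<close>-tilting. To recover \<open>\<T>\<close> from \<open>Fac \<T>\<close>, take \<open>X\<close> in \<open>Fac \<T>\<close> with
  \<open>Ext\<^sup>1(X, Fac \<T>) = 0\<close> and a conflation \<open>K \<rightarrowtail> T \<twoheadrightarrow> X\<close>. For a projective \<open>P \<twoheadrightarrow> K\<close>, the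
  approximation of \<open>P\<close> gives a conflation \<open>K \<rightarrowtail> Q \<twoheadrightarrow> T\<^sub>1\<close> with \<open>Q\<close> in \<open>Fac \<T>\<close>, and the pushout of both
  inflations is at the same time \<open>Q \<oplus> X\<close> and \<open>T \<oplus> T\<^sub>1\<close>, so \<open>X\<close> is a summand of an object of \<open>\<T>\<close>.
  Conversely, if \<open>(\<C>, \<D>)\<close> is a \<open>\<tau>\<close>-cotorsion pair and \<open>P \<twoheadrightarrow> X\<close> with \<open>X\<close> in \<open>\<D>\<close>, then \<open>P \<rightarrow> X\<close>
  factors through the approximation \<open>P \<rightarrow> D\<^sub>0\<close>, and \<open>D\<^sub>0 \<rightarrow> X\<close> is a deflation by weak idempotent
  completeness; hence \<open>\<D> = Fac (\<C> \<inter> \<D>)\<close>.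
\<close>

section \<open>Preadditive categories\<close>

text \<open>An \<open>Ext\<close> group is only a set of classes here, and equivalence of extensions
  is generated by morphisms in both directions. A vanishing hypothesis therefore gives a zigzag from
  the trivial extension to a given one, not a morphism. It can be exploited only through a property
  that survives each link read forwards and backwards: being split for \<open>Ext^1\<close>, having
  a compatible lift of the syzygy for \<open>Ext^2\<close>. Travelling against a morphism is the
  hard direction in length two; it is the reason for \<open>same_kernel_lift\<close> and for a
  projective middle term. Establishing vanishing is easier, since one extension that maps to all
  others suffices. No long exact sequence is set up; diagram chases take its place.

  In the tilting half, \<open>Ext^2(T, -) = 0\<close> carries \<open>Ext^1(T, T') = 0\<close> over
  to the factor objects of \<open>T'\<close>. In the other direction, projective dimension at most
  one is read off from the torsion class: an arbitrary object embeds into an object of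
  \<open>\<D>\<close>, and the cokernels that arise stay in \<open>\<D>\<close> because
  \<open>\<D>\<close> is factor closed, so syzygies of objects of \<open>\<C>\<close> lift along all
  deflations.\<close>

lemma Hom_iff [simp]: "f \<in> Hom E X Y \<longleftrightarrow> f \<in> arr E \<and> src E f = X \<and> tgt E f = Y"
  by (simp add: Hom_def)

section \<open>Arithmetic of composition\<close>

context category
begin

lemmas src_obj [simp] = src_in_obj and tgt_obj [simp] = tgt_in_obj

lemma idt_arr [simp]: "X \<in> obj E \<Longrightarrow> idt E X \<in> arr E"
  and src_idt [simp]: "X \<in> obj E \<Longrightarrow> src E (idt E X) = X"
  and tgt_idt [simp]: "X \<in> obj E \<Longrightarrow> tgt E (idt E X) = X"
  using idt_in_Hom by auto

lemma
  assumes "f \<in> arr E" "g \<in> arr E" "tgt E f = src E g"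
  shows cmp_arr [simp]: "g \<cdot> f \<in> arr E"
    and src_cmp [simp]: "src E (g \<cdot> f) = src E f"
    and tgt_cmp [simp]: "tgt E (g \<cdot> f) = tgt E g"
  using cmp_in_Hom[of f "src E f" "src E g" g "tgt E g"] assms by auto

lemma assoc_cmp [simp]:
  "\<lbrakk>f \<in> arr E; g \<in> arr E; h \<in> arr E; tgt E f = src E g; tgt E g = src E h\<rbrakk>
    \<Longrightarrow> (h \<cdot> g) \<cdot> f = h \<cdot> (g \<cdot> f)"
  using cmp_assoc[of f "src E f" "src E g" g "src E h" h "tgt E h"] by simp

lemma idt_cmp [simp]: "\<lbrakk>f \<in> arr E; tgt E f = Y\<rbrakk> \<Longrightarrow> idt E Y \<cdot> f = f"
  using cmp_idt_left[of f "src E f" Y] by simp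

lemma cmp_idt [simp]: "\<lbrakk>f \<in> arr E; src E f = X\<rbrakk> \<Longrightarrow> f \<cdot> idt E X = f"
  using cmp_idt_right[of f X "tgt E f"] by simp

text \<open>Composites are normalized to the right, so a known equation for
  \<open>g \<cdot> f\<close> no longer matches inside \<open>g \<cdot> (f \<cdot> u)\<close>. This
  rule supplies it in the form that still matches.\<close>

lemma cmp_reduce:
  assumes "g \<cdot> f = h" "f \<in> arr E" "g \<in> arr E" "tgt E f = src E g"
    and "u \<in> arr E" "tgt E u = src E f"
  shows "g \<cdot> (f \<cdot> u) = h \<cdot> u"
  using assms assoc_cmp[of u f g] by simp

end

section \<open>The additive groups of morphisms\<close>

context preadditive_category
begin

abbreviation add (infixl "\<boxplus>" 65) where "f \<boxplus> g \<equiv> hplus E f g"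

text \<open>The hom group is recovered from the source and target of \<open>f\<close>, so that
  negation takes no object arguments.\<close>

definition neg where "neg f = inv\<^bsub>hom_group E (src E f) (tgt E f)\<^esub> f"

abbreviation sub (infixl "\<boxminus>" 65) where "f \<boxminus> g \<equiv> f \<boxplus> neg g"

lemma hom_group_sel [simp]:
  "carrier (hom_group E X Y) = Hom E X Y"
  "mult (hom_group E X Y) = hplus E"
  "one (hom_group E X Y) = hzero E X Y"
  by (simp_all add: hom_group_def)

lemma
  assumes "f \<in> arr E" "g \<in> arr E" "src E f = src E g" "tgt E f = tgt E g"
  shows add_arr [simp]: "f \<boxplus> g \<in> arr E"
    and src_add [simp]: "src E (f \<boxplus> g) = src E g"
    and tgt_add [simp]: "tgt E (f \<boxplus> g) = tgt E g"
proof -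
  interpret G: comm_group "hom_group E (src E g) (tgt E g)" using hom_comm_group assms by simp
  show "f \<boxplus> g \<in> arr E" "src E (f \<boxplus> g) = src E g" "tgt E (f \<boxplus> g) = tgt E g"
    using G.m_closed[of f g] assms by auto
qed

lemma
  assumes "X \<in> obj E" "Y \<in> obj E"
  shows zero_arr [simp]: "hzero E X Y \<in> arr E"
    and src_zero [simp]: "src E (hzero E X Y) = X"
    and tgt_zero [simp]: "tgt E (hzero E X Y) = Y"
proof -
  interpret G: comm_group "hom_group E X Y" using hom_comm_group assms by simp
  show "hzero E X Y \<in> arr E" "src E (hzero E X Y) = X" "tgt E (hzero E X Y) = Y"
    using G.one_closed by auto
qed

lemma
  assumes "f \<in> arr E"
  shows neg_arr [simp]: "neg f \<in> arr E"
    and src_neg [simp]: "src E (neg f) = src E f"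
    and tgt_neg [simp]: "tgt E (neg f) = tgt E f"
    and add_neg: "f \<boxplus> neg f = hzero E (src E f) (tgt E f)"
proof -
  interpret G: comm_group "hom_group E (src E f) (tgt E f)" using hom_comm_group assms by simp
  show "neg f \<in> arr E" "src E (neg f) = src E f" "tgt E (neg f) = tgt E f"
    "f \<boxplus> neg f = hzero E (src E f) (tgt E f)"
    using G.inv_closed[of f] G.r_inv[of f] assms by (auto simp: neg_def)
qed

lemma add_neg' [simp]: "\<lbrakk>f \<in> arr E; src E f = X; tgt E f = Y\<rbrakk> \<Longrightarrow> f \<boxplus> neg f = hzero E X Y"
  using add_neg by auto

lemma add_commute:
  assumes "f \<in> arr E" "g \<in> arr E" "src E f = src E g" "tgt E f = tgt E g"
  shows "f \<boxplus> g = g \<boxplus> f"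
proof -
  interpret G: comm_group "hom_group E (src E g) (tgt E g)" using hom_comm_group assms by simp
  show ?thesis using G.m_comm[of f g] assms by auto
qed

lemma add_assoc [simp]:
  assumes "f \<in> arr E" "g \<in> arr E" "h \<in> arr E"
    "src E f = src E g" "tgt E f = tgt E g" "src E h = src E g" "tgt E h = tgt E g"
  shows "(f \<boxplus> g) \<boxplus> h = f \<boxplus> (g \<boxplus> h)"
proof -
  interpret G: comm_group "hom_group E (src E g) (tgt E g)" using hom_comm_group assms by simp
  show ?thesis using G.m_assoc[of f g h] assms by auto
qed

lemma add_left_commute:
  assumes "f \<in> arr E" "g \<in> arr E" "h \<in> arr E"
    "src E f = src E g" "tgt E f = tgt E g" "src E h = src E g" "tgt E h = tgt E g"
  shows "f \<boxplus> (g \<boxplus> h) = g \<boxplus> (f \<boxplus> h)"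
  using add_assoc[of f g h] add_assoc[of g f h] add_commute[of f g] assms by simp

lemmas add_ac = add_commute add_left_commute

lemma add_zero [simp]:
  assumes "f \<in> arr E" "src E f = X" "tgt E f = Y"
  shows "f \<boxplus> hzero E X Y = f" and zero_add [simp]: "hzero E X Y \<boxplus> f = f"
proof -
  interpret G: comm_group "hom_group E X Y" using hom_comm_group assms by auto
  show "f \<boxplus> hzero E X Y = f" "hzero E X Y \<boxplus> f = f"
    using G.r_one[of f] G.l_one[of f] assms by auto
qed

lemma neg_add_self [simp]: "\<lbrakk>f \<in> arr E; src E f = X; tgt E f = Y\<rbrakk> \<Longrightarrow> neg f \<boxplus> f = hzero E X Y"
  using add_commute[of "neg f" f] by simp

lemma add_cancel_left:
  assumes "f \<in> arr E" "g \<in> arr E" "src E f = src E g" "tgt E f = tgt E g"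
  shows "f \<boxplus> (neg f \<boxplus> g) = g" and "neg f \<boxplus> (f \<boxplus> g) = g"
proof -
  have "f \<boxplus> (neg f \<boxplus> g) = (f \<boxplus> neg f) \<boxplus> g" "neg f \<boxplus> (f \<boxplus> g) = (neg f \<boxplus> f) \<boxplus> g"
    using assms by (simp_all del: add_neg' neg_add_self)
  then show "f \<boxplus> (neg f \<boxplus> g) = g" "neg f \<boxplus> (f \<boxplus> g) = g" using assms by simp_all
qed

lemma cmp_add [simp]:
  "\<lbrakk>f \<in> arr E; g \<in> arr E; h \<in> arr E; src E f = src E g; tgt E f = src E h; tgt E g = src E h\<rbrakk>
    \<Longrightarrow> h \<cdot> (f \<boxplus> g) = (h \<cdot> f) \<boxplus> (h \<cdot> g)"
  using cmp_hplus_right[of f "src E g" "src E h" g h "tgt E h"] by simp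

lemma add_cmp [simp]:
  "\<lbrakk>f \<in> arr E; g \<in> arr E; h \<in> arr E; src E f = tgt E h; src E g = tgt E h; tgt E f = tgt E g\<rbrakk>
    \<Longrightarrow> (f \<boxplus> g) \<cdot> h = (f \<cdot> h) \<boxplus> (g \<cdot> h)"
  using cmp_hplus_left[of h "src E h" "tgt E h" f "tgt E g" g] by simp

lemma neg_unique:
  assumes "f \<in> arr E" "g \<in> arr E" "src E f = src E g" "tgt E f = tgt E g"
    and "f \<boxplus> g = hzero E (src E g) (tgt E g)"
  shows "neg f = g"
  using assms add_cancel_left(2)[of f g] by simp

text \<open>The only idempotent of a group is its unit; applied to a composite with a zero map, this
  turns biadditivity into absorption.\<close>

lemma add_self_zero:
  assumes "f \<in> arr E" "f \<boxplus> f = f"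
  shows "f = hzero E (src E f) (tgt E f)"
  using add_cancel_left(2)[of f f] assms by simp

lemma cmp_zero [simp]:
  assumes "f \<in> arr E" "W \<in> obj E" "src E f = X"
  shows "f \<cdot> hzero E W X = hzero E W (tgt E f)"
proof -
  have X: "X \<in> obj E" using assms by auto
  have "f \<cdot> hzero E W X \<boxplus> f \<cdot> hzero E W X = f \<cdot> (hzero E W X \<boxplus> hzero E W X)"
    using assms X by (simp del: add_zero zero_add)
  also have "\<dots> = f \<cdot> hzero E W X" using X assms by simp
  finally show ?thesis using add_self_zero[of "f \<cdot> hzero E W X"] assms X by simp
qed

lemma zero_cmp [simp]:
  assumes "f \<in> arr E" "W \<in> obj E" "tgt E f = X"
  shows "hzero E X W \<cdot> f = hzero E (src E f) W"
proof -
  have X: "X \<in> obj E" using assms by auto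
  have "hzero E X W \<cdot> f \<boxplus> hzero E X W \<cdot> f = (hzero E X W \<boxplus> hzero E X W) \<cdot> f"
    using assms X by (simp del: add_zero zero_add)
  also have "\<dots> = hzero E X W \<cdot> f" using X assms by simp
  finally show ?thesis using add_self_zero[of "hzero E X W \<cdot> f"] assms X by simp
qed

lemma cmp_neg [simp]:
  assumes "f \<in> arr E" "g \<in> arr E" "tgt E f = src E g"
  shows "g \<cdot> neg f = neg (g \<cdot> f)"
  using assms neg_unique[of "g \<cdot> f" "g \<cdot> neg f"] cmp_add[of f "neg f" g, symmetric]
  by (simp del: cmp_add)

lemma neg_cmp [simp]:
  assumes "f \<in> arr E" "g \<in> arr E" "tgt E f = src E g"
  shows "neg g \<cdot> f = neg (g \<cdot> f)"
  using assms neg_unique[of "g \<cdot> f" "neg g \<cdot> f"] add_cmp[of g "neg g" f, symmetric]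
  by (simp del: add_cmp)

lemma neg_neg [simp]: "f \<in> arr E \<Longrightarrow> neg (neg f) = f"
  using neg_unique[of "neg f" f] by simp

lemma neg_zero [simp]: "\<lbrakk>X \<in> obj E; Y \<in> obj E\<rbrakk> \<Longrightarrow> neg (hzero E X Y) = hzero E X Y"
  using neg_unique[of "hzero E X Y" "hzero E X Y"] by simp

lemma neg_add [simp]:
  assumes "f \<in> arr E" "g \<in> arr E" "src E f = src E g" "tgt E f = tgt E g"
  shows "neg (f \<boxplus> g) = neg f \<boxplus> neg g"
  using assms neg_unique[of "f \<boxplus> g" "neg f \<boxplus> neg g"]
    add_left_commute[of g "neg f" "neg g"]
  by simp

subsection \<open>Kernels and cokernels\<close>

definition monic where "monic f \<longleftrightarrow> f \<in> arr E \<and>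
  (\<forall>u\<in>arr E. \<forall>v\<in>arr E. tgt E u = src E f \<longrightarrow> tgt E v = src E f \<longrightarrow> src E u = src E v \<longrightarrow>
    f \<cdot> u = f \<cdot> v \<longrightarrow> u = v)"

definition epic where "epic f \<longleftrightarrow> f \<in> arr E \<and>
  (\<forall>u\<in>arr E. \<forall>v\<in>arr E. src E u = tgt E f \<longrightarrow> src E v = tgt E f \<longrightarrow> tgt E u = tgt E v \<longrightarrow>
    u \<cdot> f = v \<cdot> f \<longrightarrow> u = v)"

lemma monicD:
  "\<lbrakk>monic f; f \<cdot> u = f \<cdot> v; u \<in> arr E; v \<in> arr E; tgt E u = src E f; tgt E v = src E f; src E u = src E v\<rbrakk>
   \<Longrightarrow> u = v"
  unfolding monic_def by blast

lemma epicD: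
  "\<lbrakk>epic f; u \<cdot> f = v \<cdot> f; u \<in> arr E; v \<in> arr E; src E u = tgt E f; src E v = tgt E f; tgt E u = tgt E v\<rbrakk>
   \<Longrightarrow> u = v"
  unfolding epic_def by blast

lemma monic_zeroD:
  "\<lbrakk>monic f; f \<cdot> u = hzero E (src E u) (tgt E f); u \<in> arr E; tgt E u = src E f\<rbrakk>
    \<Longrightarrow> u = hzero E (src E u) (src E f)"
  by (rule monicD[of f]) (auto simp: monic_def)

lemma kernel_eqs:
  assumes "is_kernel E g k"
  shows "g \<in> arr E" "k \<in> arr E" "tgt E k = src E g" "g \<cdot> k = hzero E (src E k) (tgt E g)"
  using assms by (auto simp: is_kernel_def)

lemma kernel_monic: assumes "is_kernel E g k" shows "monic k"
  unfolding monic_def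
proof (intro conjI ballI impI)
  note K = kernel_eqs[OF assms]
  show "k \<in> arr E" by fact
  fix u v assume *: "u \<in> arr E" "v \<in> arr E" "tgt E u = src E k" "tgt E v = src E k"
    "src E u = src E v" "k \<cdot> u = k \<cdot> v"
  have "g \<cdot> (k \<cdot> u) = hzero E (src E u) (tgt E g)"
    using K * cmp_reduce[OF K(4)] by simp
  then have "\<exists>!w. w \<in> Hom E (src E u) (src E k) \<and> k \<cdot> w = k \<cdot> u"
    using assms * K unfolding is_kernel_def by simp
  then show "u = v" using * by (metis Hom_iff)
qed

lemma kernel_lift:
  assumes "is_kernel E g k" "h \<in> arr E" "tgt E h = src E g"
    "g \<cdot> h = hzero E (src E h) (tgt E g)"
  obtains u where "u \<in> arr E" "src E u = src E h" "tgt E u = src E k" "k \<cdot> u = h"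
  using assms unfolding is_kernel_def by (metis Hom_iff)

text \<open>Uniqueness of lifts is split off as \<open>monic k\<close>, which leaves only existence
  to be checked for test maps.\<close>

lemma kernelI:
  assumes "monic k" "g \<in> arr E" "tgt E k = src E g" "g \<cdot> k = hzero E (src E k) (tgt E g)"
    and "\<And>h. \<lbrakk>h \<in> arr E; tgt E h = src E g; g \<cdot> h = hzero E (src E h) (tgt E g)\<rbrakk>
      \<Longrightarrow> \<exists>u. u \<in> arr E \<and> src E u = src E h \<and> tgt E u = src E k \<and> k \<cdot> u = h"
  shows "is_kernel E g k"
  unfolding is_kernel_def
proof (intro conjI allI ballI impI)
  show "g \<in> arr E" "tgt E k = src E g" "g \<cdot> k = hzero E (src E k) (tgt E g)" by fact+
  show k: "k \<in> arr E" using assms(1) by (simp add: monic_def)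
  fix W h assume *: "h \<in> Hom E W (src E g)" "g \<cdot> h = hzero E W (tgt E g)"
  then obtain u where "u \<in> arr E" "src E u = src E h" "tgt E u = src E k" "k \<cdot> u = h"
    using assms(5)[of h] by auto
  then show "\<exists>!u. u \<in> Hom E W (src E k) \<and> k \<cdot> u = h"
    using * monicD[OF assms(1)] by (intro ex1I[of _ u]) auto
qed

lemma cokernel_eqs:
  assumes "is_cokernel E f c"
  shows "f \<in> arr E" "c \<in> arr E" "tgt E f = src E c" "c \<cdot> f = hzero E (src E f) (tgt E c)"
  using assms by (auto simp: is_cokernel_def)

lemma cokernel_epic: assumes "is_cokernel E f c" shows "epic c"
  unfolding epic_def
proof (intro conjI ballI impI)
  note K = cokernel_eqs[OF assms]
  show "c \<in> arr E" by fact
  fix u v assume *: "u \<in> arr E" "v \<in> arr E" "src E u = tgt E c" "src E v = tgt E c"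
    "tgt E u = tgt E v" "u \<cdot> c = v \<cdot> c"
  have "(u \<cdot> c) \<cdot> f = hzero E (src E f) (tgt E u)"
    using K * by simp
  then have "\<exists>!w. w \<in> Hom E (tgt E c) (tgt E u) \<and> w \<cdot> c = u \<cdot> c"
    using assms * K unfolding is_cokernel_def by simp
  then show "u = v" using * by (metis Hom_iff)
qed

lemma cokernel_colift:
  assumes "is_cokernel E f c" "h \<in> arr E" "src E h = tgt E f"
    "h \<cdot> f = hzero E (src E f) (tgt E h)"
  obtains u where "u \<in> arr E" "tgt E u = tgt E h" "src E u = tgt E c" "u \<cdot> c = h"
  using assms unfolding is_cokernel_def by (metis Hom_iff)

lemma cokernelI:
  assumes "epic c" "f \<in> arr E" "tgt E f = src E c" "c \<cdot> f = hzero E (src E f) (tgt E c)"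
    and "\<And>h. \<lbrakk>h \<in> arr E; src E h = tgt E f; h \<cdot> f = hzero E (src E f) (tgt E h)\<rbrakk>
      \<Longrightarrow> \<exists>u. u \<in> arr E \<and> tgt E u = tgt E h \<and> src E u = tgt E c \<and> u \<cdot> c = h"
  shows "is_cokernel E f c"
  unfolding is_cokernel_def
proof (intro conjI allI ballI impI)
  show "f \<in> arr E" "tgt E f = src E c" "c \<cdot> f = hzero E (src E f) (tgt E c)" by fact+
  show k: "c \<in> arr E" using assms(1) by (simp add: epic_def)
  fix W h assume *: "h \<in> Hom E (tgt E f) W" "h \<cdot> f = hzero E (src E f) W"
  then obtain u where "u \<in> arr E" "tgt E u = tgt E h" "src E u = tgt E c" "u \<cdot> c = h"
    using assms(5)[of h] by auto
  then show "\<exists>!u. u \<in> Hom E (tgt E c) W \<and> u \<cdot> c = h"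
    using * epicD[OF assms(1)] by (intro ex1I[of _ u]) auto
qed

lemma is_isoI:
  "\<lbrakk>f \<in> arr E; g \<in> arr E; src E g = tgt E f; tgt E g = src E f;
    g \<cdot> f = idt E (src E f); f \<cdot> g = idt E (tgt E f)\<rbrakk> \<Longrightarrow> is_iso E f"
  unfolding is_iso_def by auto

lemma is_isoE:
  assumes "is_iso E f"
  obtains g where "f \<in> arr E" "g \<in> arr E" "src E g = tgt E f" "tgt E g = src E f"
    "g \<cdot> f = idt E (src E f)" "f \<cdot> g = idt E (tgt E f)"
  using assms unfolding is_iso_def by auto

lemma is_iso_idt [simp]: "X \<in> obj E \<Longrightarrow> is_iso E (idt E X)"
  by (rule is_isoI[of _ "idt E X"]) auto

lemma kernel_unique:
  assumes "is_kernel E g k" "is_kernel E g k'"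
  obtains u where "is_iso E u" "src E u = src E k" "tgt E u = src E k'" "k' \<cdot> u = k"
proof -
  note K = kernel_eqs[OF assms(1)] and K' = kernel_eqs[OF assms(2)]
  obtain u where u: "u \<in> arr E" "src E u = src E k" "tgt E u = src E k'" "k' \<cdot> u = k"
    using kernel_lift[OF assms(2) K(2,3,4)] .
  obtain v where v: "v \<in> arr E" "src E v = src E k'" "tgt E v = src E k" "k \<cdot> v = k'"
    using kernel_lift[OF assms(1) K'(2,3,4)] .
  have "v \<cdot> u = idt E (src E u)"
    by (rule monicD[OF kernel_monic[OF assms(1)]]) (use u v K K' cmp_reduce[OF v(4)] in auto)
  moreover have "u \<cdot> v = idt E (tgt E u)"
    by (rule monicD[OF kernel_monic[OF assms(2)]]) (use u v K K' cmp_reduce[OF u(4)] in auto)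
  ultimately show ?thesis using that is_isoI[of u v] u v by auto
qed

lemma cokernel_unique:
  assumes "is_cokernel E f c" "is_cokernel E f c'"
  obtains u where "is_iso E u" "src E u = tgt E c" "tgt E u = tgt E c'" "u \<cdot> c = c'"
proof -
  note K = cokernel_eqs[OF assms(1)] and K' = cokernel_eqs[OF assms(2)]
  obtain u where u: "u \<in> arr E" "tgt E u = tgt E c'" "src E u = tgt E c" "u \<cdot> c = c'"
    using cokernel_colift[OF assms(1) K'(2) K'(3)[symmetric] K'(4)] .
  obtain v where v: "v \<in> arr E" "tgt E v = tgt E c" "src E v = tgt E c'" "v \<cdot> c' = c"
    using cokernel_colift[OF assms(2) K(2) K(3)[symmetric] K(4)] .
  have "v \<cdot> u = idt E (src E u)"
    by (rule epicD[OF cokernel_epic[OF assms(1)]]) (use u v K K' in auto)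
  moreover have "u \<cdot> v = idt E (tgt E u)"
    by (rule epicD[OF cokernel_epic[OF assms(2)]]) (use u v K K' in auto)
  ultimately show ?thesis using that is_isoI[of u v] u v by auto
qed

subsection \<open>Pushouts and pullbacks\<close>

lemma pushout_eqs:
  assumes "is_pushout E i f f' i'"
  shows "i \<in> arr E" "f \<in> arr E" "f' \<in> arr E" "i' \<in> arr E"
    "src E f = src E i" "src E f' = tgt E i" "src E i' = tgt E f" "tgt E f' = tgt E i'"
    "f' \<cdot> i = i' \<cdot> f"
  using assms by (auto simp: is_pushout_def)

lemma pushout_factor:
  assumes "is_pushout E i f f' i'" "a \<in> arr E" "b \<in> arr E" "src E a = tgt E i" "src E b = tgt E f"
    "tgt E a = tgt E b" "a \<cdot> i = b \<cdot> f"
  obtains u where "u \<in> arr E" "src E u = tgt E i'" "tgt E u = tgt E b" "u \<cdot> f' = a" "u \<cdot> i' = b"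
  using assms unfolding is_pushout_def by (metis Hom_iff)

lemma pushout_unique:
  assumes "is_pushout E i f f' i'" "u \<in> arr E" "v \<in> arr E" "src E u = tgt E i'" "src E v = tgt E i'"
    "tgt E u = tgt E v" "u \<cdot> f' = v \<cdot> f'" "u \<cdot> i' = v \<cdot> i'"
  shows "u = v"
proof -
  note P = pushout_eqs[OF assms(1)]
  have "(u \<cdot> f') \<cdot> i = (u \<cdot> i') \<cdot> f" using P assms(2-) by simp
  moreover have "u \<cdot> f' \<in> Hom E (tgt E i) (tgt E v)" "u \<cdot> i' \<in> Hom E (tgt E f) (tgt E v)"
    using P assms(2-6) by auto
  ultimately have "\<exists>!w. w \<in> Hom E (tgt E f') (tgt E v) \<and> w \<cdot> f' = u \<cdot> f' \<and> w \<cdot> i' = u \<cdot> i'"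
    using assms(1) unfolding is_pushout_def by blast
  then show ?thesis using P assms(2-) by (metis Hom_iff)
qed

lemma pushoutI:
  assumes "i \<in> arr E" "f \<in> arr E" "f' \<in> arr E" "i' \<in> arr E"
    "src E f = src E i" "src E f' = tgt E i" "src E i' = tgt E f" "tgt E f' = tgt E i'"
    "f' \<cdot> i = i' \<cdot> f"
    and "\<And>a b. \<lbrakk>a \<in> arr E; b \<in> arr E; src E a = tgt E i; src E b = tgt E f; tgt E a = tgt E b;
      a \<cdot> i = b \<cdot> f\<rbrakk> \<Longrightarrow> \<exists>u. u \<in> arr E \<and> src E u = tgt E i' \<and> tgt E u = tgt E b \<and> u \<cdot> f' = a \<and> u \<cdot> i' = b"
    and "\<And>u v. \<lbrakk>u \<in> arr E; v \<in> arr E; src E u = tgt E i'; src E v = tgt E i'; tgt E u = tgt E v;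
      u \<cdot> f' = v \<cdot> f'; u \<cdot> i' = v \<cdot> i'\<rbrakk> \<Longrightarrow> u = v"
  shows "is_pushout E i f f' i'"
  unfolding is_pushout_def
proof (intro conjI allI ballI impI)
  fix W a b assume *: "a \<in> Hom E (tgt E i) W" "b \<in> Hom E (tgt E f) W" "a \<cdot> i = b \<cdot> f"
  then obtain u where u: "u \<in> arr E" "src E u = tgt E i'" "tgt E u = tgt E b" "u \<cdot> f' = a" "u \<cdot> i' = b"
    using assms(10)[of a b] by auto
  show "\<exists>!u. u \<in> Hom E (tgt E f') W \<and> u \<cdot> f' = a \<and> u \<cdot> i' = b"
  proof (rule ex1I[of _ u])
    show "u \<in> Hom E (tgt E f') W \<and> u \<cdot> f' = a \<and> u \<cdot> i' = b" using u * assms(8) by simp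
    fix v assume "v \<in> Hom E (tgt E f') W \<and> v \<cdot> f' = a \<and> v \<cdot> i' = b"
    then show "v = u" using assms(11)[of v u] u * assms(8) by simp
  qed
qed (use assms in auto)

lemma pushout_swap:
  assumes "is_pushout E i f f' i'" shows "is_pushout E f i i' f'"
proof (rule pushoutI)
  note P = pushout_eqs[OF assms]
  show "i' \<cdot> f = f' \<cdot> i" using P by simp
  fix a b assume "a \<in> arr E" "b \<in> arr E" "src E a = tgt E f" "src E b = tgt E i" "tgt E a = tgt E b"
    "a \<cdot> f = b \<cdot> i"
  then show "\<exists>u. u \<in> arr E \<and> src E u = tgt E f' \<and> tgt E u = tgt E b \<and> u \<cdot> i' = a \<and> u \<cdot> f' = b"
    using pushout_factor[OF assms, of b a] P by metis
next
  fix u v assume "u \<in> arr E" "v \<in> arr E" "src E u = tgt E f'" "src E v = tgt E f'" "tgt E u = tgt E v"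
    "u \<cdot> i' = v \<cdot> i'" "u \<cdot> f' = v \<cdot> f'"
  then show "u = v" using pushout_unique[OF assms, of u v] pushout_eqs[OF assms] by simp
qed (use pushout_eqs[OF assms] in auto)

lemma pushout_iso:
  assumes "is_pushout E i f f' i'" "is_pushout E i f f'' i''"
  obtains u where "is_iso E u" "u \<in> arr E" "src E u = tgt E i'" "tgt E u = tgt E i''"
    "u \<cdot> f' = f''" "u \<cdot> i' = i''"
proof -
  note P = pushout_eqs[OF assms(1)] and P' = pushout_eqs[OF assms(2)]
  obtain u where u: "u \<in> arr E" "src E u = tgt E i'" "tgt E u = tgt E i''" "u \<cdot> f' = f''" "u \<cdot> i' = i''"
    using pushout_factor[OF assms(1), of f'' i''] P' by auto
  obtain v where v: "v \<in> arr E" "src E v = tgt E i''" "tgt E v = tgt E i'" "v \<cdot> f'' = f'" "v \<cdot> i'' = i'"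
    using pushout_factor[OF assms(2), of f' i'] P by auto
  have "v \<cdot> u = idt E (src E u)"
    by (rule pushout_unique[OF assms(1)]) (use P P' u v in auto)
  moreover have "u \<cdot> v = idt E (tgt E u)"
    by (rule pushout_unique[OF assms(2)]) (use P P' u v in auto)
  ultimately show ?thesis using that[OF is_isoI[of u v]] u v by auto
qed

lemma pullback_eqs:
  assumes "is_pullback E p f f' p'"
  shows "p \<in> arr E" "f \<in> arr E" "f' \<in> arr E" "p' \<in> arr E"
    "tgt E f = tgt E p" "tgt E f' = src E p" "tgt E p' = src E f" "src E f' = src E p'"
    "p \<cdot> f' = f \<cdot> p'"
  using assms by (auto simp: is_pullback_def)

lemma pullback_factor:
  assumes "is_pullback E p f f' p'" "a \<in> arr E" "b \<in> arr E" "tgt E a = src E p" "tgt E b = src E f"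
    "src E a = src E b" "p \<cdot> a = f \<cdot> b"
  obtains u where "u \<in> arr E" "tgt E u = src E p'" "src E u = src E b" "f' \<cdot> u = a" "p' \<cdot> u = b"
  using assms unfolding is_pullback_def by (metis Hom_iff)

lemma pullback_unique:
  assumes "is_pullback E p f f' p'" "u \<in> arr E" "v \<in> arr E" "tgt E u = src E p'" "tgt E v = src E p'"
    "src E u = src E v" "f' \<cdot> u = f' \<cdot> v" "p' \<cdot> u = p' \<cdot> v"
  shows "u = v"
proof -
  note P = pullback_eqs[OF assms(1)]
  have "p \<cdot> (f' \<cdot> u) = f \<cdot> (p' \<cdot> u)"
    using P(1-8) assms(2-6) cmp_reduce[OF P(9)] by simp
  moreover have "f' \<cdot> u \<in> Hom E (src E v) (src E p)" "p' \<cdot> u \<in> Hom E (src E v) (src E f)"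
    using P assms(2-6) by auto
  ultimately have "\<exists>!w. w \<in> Hom E (src E v) (src E f') \<and> f' \<cdot> w = f' \<cdot> u \<and> p' \<cdot> w = p' \<cdot> u"
    using assms(1) unfolding is_pullback_def by blast
  then show ?thesis using P assms(2-) by (metis Hom_iff)
qed

lemma pullbackI:
  assumes "p \<in> arr E" "f \<in> arr E" "f' \<in> arr E" "p' \<in> arr E"
    "tgt E f = tgt E p" "tgt E f' = src E p" "tgt E p' = src E f" "src E f' = src E p'"
    "p \<cdot> f' = f \<cdot> p'"
    and "\<And>a b. \<lbrakk>a \<in> arr E; b \<in> arr E; tgt E a = src E p; tgt E b = src E f; src E a = src E b;
      p \<cdot> a = f \<cdot> b\<rbrakk> \<Longrightarrow> \<exists>u. u \<in> arr E \<and> tgt E u = src E p' \<and> src E u = src E b \<and> f' \<cdot> u = a \<and> p' \<cdot> u = b"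
    and "\<And>u v. \<lbrakk>u \<in> arr E; v \<in> arr E; tgt E u = src E p'; tgt E v = src E p'; src E u = src E v;
      f' \<cdot> u = f' \<cdot> v; p' \<cdot> u = p' \<cdot> v\<rbrakk> \<Longrightarrow> u = v"
  shows "is_pullback E p f f' p'"
  unfolding is_pullback_def
proof (intro conjI allI ballI impI)
  fix W a b assume *: "a \<in> Hom E W (src E p)" "b \<in> Hom E W (src E f)" "p \<cdot> a = f \<cdot> b"
  then obtain u where u: "u \<in> arr E" "tgt E u = src E p'" "src E u = src E b" "f' \<cdot> u = a" "p' \<cdot> u = b"
    using assms(10)[of a b] by auto
  show "\<exists>!u. u \<in> Hom E W (src E f') \<and> f' \<cdot> u = a \<and> p' \<cdot> u = b"
  proof (rule ex1I[of _ u])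
    show "u \<in> Hom E W (src E f') \<and> f' \<cdot> u = a \<and> p' \<cdot> u = b" using u * assms(8) by simp
    fix v assume "v \<in> Hom E W (src E f') \<and> f' \<cdot> v = a \<and> p' \<cdot> v = b"
    then show "v = u" using assms(11)[of v u] u * assms(8) by simp
  qed
qed (use assms in auto)

lemma pullback_swap:
  assumes "is_pullback E p f f' p'" shows "is_pullback E f p p' f'"
proof (rule pullbackI)
  note P = pullback_eqs[OF assms]
  show "f \<cdot> p' = p \<cdot> f'" using P by simp
  fix a b assume "a \<in> arr E" "b \<in> arr E" "tgt E a = src E f" "tgt E b = src E p" "src E a = src E b"
    "f \<cdot> a = p \<cdot> b"
  then show "\<exists>u. u \<in> arr E \<and> tgt E u = src E f' \<and> src E u = src E b \<and> p' \<cdot> u = a \<and> f' \<cdot> u = b"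
    using pullback_factor[OF assms, of b a] P by metis
next
  fix u v assume "u \<in> arr E" "v \<in> arr E" "tgt E u = src E f'" "tgt E v = src E f'" "src E u = src E v"
    "p' \<cdot> u = p' \<cdot> v" "f' \<cdot> u = f' \<cdot> v"
  then show "u = v" using pullback_unique[OF assms, of u v] pullback_eqs[OF assms] by simp
qed (use pullback_eqs[OF assms] in auto)

lemma pullback_iso:
  assumes "is_pullback E p f f' p'" "is_pullback E p f f'' p''"
  obtains u where "is_iso E u" "u \<in> arr E" "src E u = src E p''" "tgt E u = src E p'"
    "f' \<cdot> u = f''" "p' \<cdot> u = p''"
proof -
  note P = pullback_eqs[OF assms(1)] and P' = pullback_eqs[OF assms(2)]
  obtain u where u: "u \<in> arr E" "tgt E u = src E p'" "src E u = src E p''" "f' \<cdot> u = f''" "p' \<cdot> u = p''"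
    using pullback_factor[OF assms(1), of f'' p''] P' by auto
  obtain v where v: "v \<in> arr E" "tgt E v = src E p''" "src E v = src E p'" "f'' \<cdot> v = f'" "p'' \<cdot> v = p'"
    using pullback_factor[OF assms(2), of f' p'] P by auto
  have "u \<cdot> v = idt E (tgt E u)"
    by (rule pullback_unique[OF assms(1)])
      (use P P' u v cmp_reduce[OF u(4)] cmp_reduce[OF u(5)] in auto)
  moreover have "v \<cdot> u = idt E (src E u)"
    by (rule pullback_unique[OF assms(2)])
      (use P P' u v cmp_reduce[OF v(4)] cmp_reduce[OF v(5)] in auto)
  ultimately show ?thesis using that[OF is_isoI[of u v]] u v by auto
qed

subsection \<open>Zero objects and biproducts\<close>

definition zero_obj where "zero_obj Z \<longleftrightarrow> Z \<in> obj E \<and> idt E Z = hzero E Z Z"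

lemma zero_obj_tgt: "\<lbrakk>zero_obj Z; f \<in> arr E; tgt E f = Z\<rbrakk> \<Longrightarrow> f = hzero E (src E f) Z"
  using idt_cmp[of f Z] zero_cmp[of f Z Z] unfolding zero_obj_def by simp

lemma zero_obj_src: "\<lbrakk>zero_obj Z; f \<in> arr E; src E f = Z\<rbrakk> \<Longrightarrow> f = hzero E Z (tgt E f)"
  using cmp_idt[of f Z] cmp_zero[of f Z Z] unfolding zero_obj_def by simp

lemma zero_obj_obj: "zero_obj Z \<Longrightarrow> Z \<in> obj E"
  by (simp add: zero_obj_def)

text \<open>The binary case of \<open>direct_sum\<close> with the four maps named instead of
  indexed: \<open>i\<close>, \<open>p\<close> belong to \<open>A\<close> and \<open>j\<close>,
  \<open>q\<close> to \<open>B\<close>. The bridge is \<open>direct_sum_pair\<close>.\<close>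

definition biprod where "biprod A B S i p j q \<longleftrightarrow> A \<in> obj E \<and> B \<in> obj E \<and> S \<in> obj E \<and>
  i \<in> Hom E A S \<and> p \<in> Hom E S A \<and> j \<in> Hom E B S \<and> q \<in> Hom E S B \<and>
  p \<cdot> i = idt E A \<and> q \<cdot> j = idt E B \<and> p \<cdot> j = hzero E B A \<and> q \<cdot> i = hzero E A B \<and>
  i \<cdot> p \<boxplus> j \<cdot> q = idt E S"

lemma biprod_eqs:
  assumes "biprod A B S i p j q"
  shows "A \<in> obj E" "B \<in> obj E" "S \<in> obj E" "i \<in> arr E" "p \<in> arr E" "j \<in> arr E" "q \<in> arr E"
    "src E i = A" "tgt E i = S" "src E p = S" "tgt E p = A"
    "src E j = B" "tgt E j = S" "src E q = S" "tgt E q = B"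
    "p \<cdot> i = idt E A" "q \<cdot> j = idt E B" "p \<cdot> j = hzero E B A" "q \<cdot> i = hzero E A B"
    "i \<cdot> p \<boxplus> j \<cdot> q = idt E S"
  using assms unfolding biprod_def by auto

lemma biprod_reduce:
  assumes "biprod A B S i p j q" "f \<in> arr E"
  shows "tgt E f = A \<Longrightarrow> p \<cdot> (i \<cdot> f) = f" "tgt E f = B \<Longrightarrow> q \<cdot> (j \<cdot> f) = f"
    "tgt E f = B \<Longrightarrow> p \<cdot> (j \<cdot> f) = hzero E (src E f) A"
    "tgt E f = A \<Longrightarrow> q \<cdot> (i \<cdot> f) = hzero E (src E f) B"
  using assms(2) biprod_eqs[OF assms(1)] cmp_reduce[of p i _ f] cmp_reduce[of q j _ f]
    cmp_reduce[of p j _ f] cmp_reduce[of q i _ f] by simp_all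

lemma biprod_swap: "biprod A B S i p j q \<Longrightarrow> biprod B A S j q i p"
  unfolding biprod_def using add_commute[of "i \<cdot> p" "j \<cdot> q"] by auto

lemma biprod_decomp:
  assumes "biprod A B S i p j q" "f \<in> arr E" "tgt E f = S"
  shows "f = i \<cdot> (p \<cdot> f) \<boxplus> j \<cdot> (q \<cdot> f)"
proof -
  note b = biprod_eqs[OF assms(1)]
  have "f = (i \<cdot> p \<boxplus> j \<cdot> q) \<cdot> f" using assms b by simp
  also have "\<dots> = i \<cdot> (p \<cdot> f) \<boxplus> j \<cdot> (q \<cdot> f)" using assms b(1-15) by simp
  finally show ?thesis .
qed

lemma biprod_codecomp:
  assumes "biprod A B S i p j q" "f \<in> arr E" "src E f = S"
  shows "f = (f \<cdot> i) \<cdot> p \<boxplus> (f \<cdot> j) \<cdot> q"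
proof -
  note b = biprod_eqs[OF assms(1)]
  have "f = f \<cdot> (i \<cdot> p \<boxplus> j \<cdot> q)" using assms b by simp
  also have "\<dots> = (f \<cdot> i) \<cdot> p \<boxplus> (f \<cdot> j) \<cdot> q" using assms b(1-15) by simp
  finally show ?thesis .
qed

lemma biprod_hom_ext:
  assumes "biprod A B S i p j q" "f \<in> arr E" "g \<in> arr E" "tgt E f = S" "tgt E g = S" "p \<cdot> f = p \<cdot> g" "q \<cdot> f = q \<cdot> g"
  shows "f = g"
  using biprod_decomp[OF assms(1,2,4)] biprod_decomp[OF assms(1,3,5)] assms(6,7) by simp

lemma biprod_hom_coext:
  assumes "biprod A B S i p j q" "f \<in> arr E" "g \<in> arr E" "src E f = S" "src E g = S" "f \<cdot> i = g \<cdot> i" "f \<cdot> j = g \<cdot> j"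
  shows "f = g"
  using biprod_codecomp[OF assms(1,2,4)] biprod_codecomp[OF assms(1,3,5)] assms(6,7) by simp

text \<open>The finite product unfolds to a sum of two terms only when the composites lie in the hom
  group. If one of the maps has the wrong source or target, both sides are false.\<close>

lemma direct_sum_pair:
  "direct_sum E [A, B] S i p \<longleftrightarrow> biprod A B S (i 0) (p 0) (i (Suc 0)) (p (Suc 0))"
proof (cases "S \<in> obj E \<and> A \<in> obj E \<and> B \<in> obj E \<and> i 0 \<in> Hom E A S \<and> p 0 \<in> Hom E S A \<and>
    i (Suc 0) \<in> Hom E B S \<and> p (Suc 0) \<in> Hom E S B")
  case True
  interpret G: comm_group "hom_group E S S" using hom_comm_group True by blast
  have [simp]: "{..<Suc (Suc 0)} = {0, Suc 0}" by auto
  have "(\<Otimes>\<^bsub>hom_group E S S\<^esub>k\<in>{..<Suc (Suc 0)}. i k \<cdot> p k) = i 0 \<cdot> p 0 \<boxplus> i (Suc 0) \<cdot> p (Suc 0)"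
    using True by (simp add: Pi_def)
  then show ?thesis using True unfolding direct_sum_def biprod_def
    by (auto simp: less_Suc_eq)
next
  case False
  then show ?thesis unfolding direct_sum_def biprod_def by (auto simp: less_Suc_eq)
qed

lemma biprod_direct_sum:
  assumes "biprod A B S i p j q"
  shows "direct_sum E [A, B] S (\<lambda>k. if k = 0 then i else j) (\<lambda>k. if k = 0 then p else q)"
  using assms by (simp add: direct_sum_pair)

lemma biprod_summand: "biprod A B S i p j q \<Longrightarrow> direct_summand E A S"
  unfolding direct_summand_def using biprod_direct_sum by blast

lemma direct_summandE:
  assumes "direct_summand E A S"
  obtains B i p j q where "biprod A B S i p j q"
  using assms unfolding direct_summand_def direct_sum_pair by blast

text \<open>The biproduct structure transported along the automorphism \<open>(a, b) \<mapsto> (a, b + f a)\<close>.\<close>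

lemma biprod_shear:
  assumes "biprod A B S i p j q" "f \<in> arr E" "src E f = A" "tgt E f = B"
  shows "biprod A B S (i \<boxminus> j \<cdot> f) p j (q \<boxplus> f \<cdot> p)"
proof -
  note b = biprod_eqs[OF assms(1)]
  have "(i \<boxminus> j \<cdot> f) \<cdot> p \<boxplus> j \<cdot> (q \<boxplus> f \<cdot> p) = i \<cdot> p \<boxplus> j \<cdot> q"
    using b(1-15) assms(2-) add_cancel_left[of "j \<cdot> (f \<cdot> p)"]
      add_commute[of "j \<cdot> q" "j \<cdot> (f \<cdot> p)"] by simp
  then show ?thesis
    using b assms(2-) biprod_reduce[OF assms(1)] unfolding biprod_def by (simp add: add_ac)
qed

end

context additive_category
begin

text \<open>In the empty direct sum the identity is an empty sum, hence zero.\<close>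

lemma ex_zero_obj: obtains Z where "zero_obj Z"
proof -
  obtain S i p where S: "direct_sum E [] S i p" using ex_direct_sum[of "[]"] by auto
  then have "S \<in> obj E" by (simp add: direct_sum_def)
  interpret G: comm_group "hom_group E S S" using hom_comm_group \<open>S \<in> obj E\<close> by simp
  from S have "zero_obj S" by (simp add: direct_sum_def zero_obj_def)
  then show ?thesis using that by blast
qed

lemma ex_biprod:
  assumes "A \<in> obj E" "B \<in> obj E"
  obtains S i p j q where "biprod A B S i p j q"
  using ex_direct_sum[of "[A, B]"] assms unfolding direct_sum_pair by auto

end

section \<open>Exact categories\<close>

context exact_category
begin

abbreviation conf where "conf i p \<equiv> (i, p) \<in> conflations E"

lemma conf_eqs:
  assumes "conf i p"
  shows "i \<in> arr E" "p \<in> arr E" "src E p = tgt E i" "p \<cdot> i = hzero E (src E i) (tgt E p)"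
  using conflation_kernel_cokernel[OF assms] unfolding kernel_cokernel_pair_def is_kernel_def by auto

lemma conf_kernel: "conf i p \<Longrightarrow> is_kernel E p i"
  and conf_cokernel: "conf i p \<Longrightarrow> is_cokernel E i p"
  using conflation_kernel_cokernel unfolding kernel_cokernel_pair_def by auto

lemma conf_monic: "conf i p \<Longrightarrow> monic i" and conf_epic: "conf i p \<Longrightarrow> epic p"
  using conf_kernel kernel_monic conf_cokernel cokernel_epic by blast+

lemma deflation_arr: "deflation E p \<Longrightarrow> p \<in> arr E"
  and inflation_arr: "inflation E i \<Longrightarrow> i \<in> arr E"
  unfolding deflation_def inflation_def using conf_eqs by blast+

lemma deflation_epic: "deflation E p \<Longrightarrow> epic p"
  and inflation_monic: "inflation E i \<Longrightarrow> monic i"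
  unfolding deflation_def inflation_def using conf_epic conf_monic by blast+

lemma conf_lift:
  assumes "conf i p" "h \<in> arr E" "tgt E h = tgt E i" "p \<cdot> h = hzero E (src E h) (tgt E p)"
  obtains u where "u \<in> arr E" "src E u = src E h" "tgt E u = src E i" "i \<cdot> u = h"
  using kernel_lift[OF conf_kernel[OF assms(1)], of h] conf_eqs[OF assms(1)] assms by metis

lemma conf_colift:
  assumes "conf i p" "h \<in> arr E" "src E h = tgt E i" "h \<cdot> i = hzero E (src E i) (tgt E h)"
  obtains u where "u \<in> arr E" "tgt E u = tgt E h" "src E u = tgt E p" "u \<cdot> p = h"
  using cokernel_colift[OF conf_cokernel[OF assms(1)], of h] assms by metis

lemma conf_iso:
  assumes "conf i p" "i' \<in> arr E" "p' \<in> arr E" "tgt E i' = src E p'"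
    "is_iso E a" "is_iso E b" "is_iso E c"
    "src E a = src E i" "src E b = tgt E i" "src E c = tgt E p"
    "tgt E a = src E i'" "tgt E b = tgt E i'" "tgt E c = tgt E p'"
    "b \<cdot> i = i' \<cdot> a" "c \<cdot> p = p' \<cdot> b"
  shows "conf i' p'"
  by (rule conflation_iso_closed[OF assms(1), of i' "src E i'" "tgt E i'" p' "tgt E p'" a b c])
    (use assms conf_eqs[OF assms(1)] in \<open>auto elim: is_isoE\<close>)

text \<open>Kernels are unique up to isomorphism and conflations are stable under isomorphism. Hence
  a conflation can be recognized by exhibiting any kernel of a deflation, or dually any cokernel of
  an inflation.\<close>

lemma conf_other_kernel:
  assumes "conf i p" "is_kernel E p i'" shows "conf i' p"
proof -
  note c = conf_eqs[OF assms(1)] and k = kernel_eqs[OF assms(2)]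
  obtain u where u: "is_iso E u" "src E u = src E i" "tgt E u = src E i'" "i' \<cdot> u = i"
    using kernel_unique[OF conf_kernel[OF assms(1)] assms(2)] .
  show ?thesis
    by (rule conf_iso[OF assms(1), of i' p u "idt E (tgt E i)" "idt E (tgt E p)"]) (use c k u in auto)
qed

lemma conf_other_cokernel:
  assumes "conf i p" "is_cokernel E i p'" shows "conf i p'"
proof -
  note c = conf_eqs[OF assms(1)] and k = cokernel_eqs[OF assms(2)]
  obtain u where u: "is_iso E u" "src E u = tgt E p" "tgt E u = tgt E p'" "u \<cdot> p = p'"
    using cokernel_unique[OF conf_cokernel[OF assms(1)] assms(2)] .
  show ?thesis
    by (rule conf_iso[OF assms(1), of i p' "idt E (src E i)" "idt E (tgt E i)" u]) (use c k u in auto)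
qed

lemma deflation_kernel_conf: "\<lbrakk>deflation E p; is_kernel E p i\<rbrakk> \<Longrightarrow> conf i p"
  unfolding deflation_def using conf_other_kernel by blast

lemma inflation_cokernel_conf: "\<lbrakk>inflation E i; is_cokernel E i p\<rbrakk> \<Longrightarrow> conf i p"
  unfolding inflation_def using conf_other_cokernel by blast

text \<open>The axioms make the identity an inflation with an unspecified partner; the map to a zero
  object is a cokernel of it, and any cokernel may serve as the partner.\<close>

lemma conf_idt_zero:
  assumes "zero_obj Z" "X \<in> obj E" shows "conf (idt E X) (hzero E X Z)"
proof -
  note Z = zero_obj_obj[OF assms(1)]
  show ?thesis
  proof (rule inflation_cokernel_conf[OF idt_inflation[OF assms(2)] cokernelI])
    show "epic (hzero E X Z)" unfolding epic_def
      using Z assms zero_obj_src[OF assms(1)] by auto metis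
    fix h assume "h \<in> arr E" "src E h = tgt E (idt E X)"
      "h \<cdot> idt E X = hzero E (src E (idt E X)) (tgt E h)"
    then show "\<exists>u. u \<in> arr E \<and> tgt E u = tgt E h \<and> src E u = tgt E (hzero E X Z) \<and> u \<cdot> hzero E X Z = h"
      using Z assms by (intro exI[of _ "hzero E Z (tgt E h)"]) simp
  qed (use Z assms in auto)
qed

lemma conf_zero_idt:
  assumes "zero_obj Z" "X \<in> obj E" shows "conf (hzero E Z X) (idt E X)"
proof -
  note Z = zero_obj_obj[OF assms(1)]
  show ?thesis
  proof (rule deflation_kernel_conf[OF idt_deflation[OF assms(2)] kernelI])
    show "monic (hzero E Z X)" unfolding monic_def
      using Z assms zero_obj_tgt[OF assms(1)] by auto metis
    fix h assume "h \<in> arr E" "tgt E h = src E (idt E X)"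
      "idt E X \<cdot> h = hzero E (src E h) (tgt E (idt E X))"
    then show "\<exists>u. u \<in> arr E \<and> src E u = src E h \<and> tgt E u = src E (hzero E Z X) \<and> hzero E Z X \<cdot> u = h"
      using Z assms by (intro exI[of _ "hzero E (src E h) Z"]) simp
  qed (use Z assms in auto)
qed

lemma iso_deflation:
  assumes "is_iso E f" shows "deflation E f"
proof -
  obtain Z where Z: "zero_obj Z" using ex_zero_obj .
  note Z' = zero_obj_obj[OF Z]
  have f: "f \<in> arr E" using assms is_isoE by blast
  have "conf (hzero E Z (src E f)) f"
    by (rule conf_iso[OF conf_zero_idt[OF Z, of "src E f"], of _ _ "idt E Z" "idt E (src E f)" f])
      (use f assms Z' in auto)
  then show ?thesis unfolding deflation_def by blast
qed

lemma iso_inflation: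
  assumes "is_iso E f" shows "inflation E f"
proof -
  obtain Z where Z: "zero_obj Z" using ex_zero_obj .
  note Z' = zero_obj_obj[OF Z]
  have f: "f \<in> arr E" using assms is_isoE by blast
  have "conf f (hzero E (tgt E f) Z)"
    by (rule conf_iso[OF conf_idt_zero[OF Z, of "src E f"], of _ _ "idt E (src E f)" f "idt E Z"])
      (use f assms Z' in auto)
  then show ?thesis unfolding inflation_def by blast
qed

text \<open>The axiom provides one good pushout. Any other differs from it by an isomorphism, which
  is itself an inflation.\<close>

lemma pushout_inflation:
  assumes "is_pushout E i f f' i'" "inflation E i" shows "inflation E i'"
proof -
  note P = pushout_eqs[OF assms(1)]
  obtain f'' i'' where *: "is_pushout E i f f'' i''" "inflation E i''"
    using inflation_pushout[of i f] P assms(2) by auto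
  obtain u where "is_iso E u" "src E u = tgt E i''" "u \<cdot> i'' = i'"
    using pushout_iso[OF *(1) assms(1)] by metis
  then show ?thesis using inflation_cmp[OF *(2) iso_inflation] by metis
qed

lemma pullback_deflation:
  assumes "is_pullback E p f f' p'" "deflation E p" shows "deflation E p'"
proof -
  note P = pullback_eqs[OF assms(1)]
  obtain f'' p'' where *: "is_pullback E p f f'' p''" "deflation E p''"
    using deflation_pullback[of p f] P assms(2) by auto
  obtain u where "is_iso E u" "tgt E u = src E p''" "p'' \<cdot> u = p'"
    using pullback_iso[OF *(1) assms(1)] by metis
  then show ?thesis using deflation_cmp[OF iso_deflation *(2)] by metis
qed

text \<open>A pushout does not change the cokernel: \<open>p'\<close> is induced by \<open>p\<close>
  and zero, and a map killing \<open>i'\<close> restricts along \<open>f'\<close> to one that kills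
  \<open>i\<close> and so descends along \<open>p\<close>.\<close>

lemma pushout_conf:
  assumes "is_pushout E i f f' i'" "conf i p"
  obtains p' where "conf i' p'" "p' \<cdot> f' = p" "tgt E p' = tgt E p"
proof -
  note P = pushout_eqs[OF assms(1)] and c = conf_eqs[OF assms(2)]
  have *: "inflation E i'" using pushout_inflation assms unfolding inflation_def by blast
  obtain p' where p': "p' \<in> arr E" "src E p' = tgt E i'" "tgt E p' = tgt E p" "p' \<cdot> f' = p"
    "p' \<cdot> i' = hzero E (tgt E f) (tgt E p)"
    using pushout_factor[OF assms(1), of p "hzero E (tgt E f) (tgt E p)"] P c by auto
  have "conf i' p'"
  proof (rule inflation_cokernel_conf[OF * cokernelI])
    show "epic p'" unfolding epic_def
    proof (intro conjI ballI impI)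
      fix u v assume *: "u \<in> arr E" "v \<in> arr E" "src E u = tgt E p'" "src E v = tgt E p'"
        "tgt E u = tgt E v" "u \<cdot> p' = v \<cdot> p'"
      then have "u \<cdot> p = v \<cdot> p" using cmp_reduce[OF *(6), of f'] p' P by simp
      then show "u = v" using epicD[OF conf_epic[OF assms(2)], of u v] * p' by simp
    qed (fact p')
    fix h assume h: "h \<in> arr E" "src E h = tgt E i'" "h \<cdot> i' = hzero E (src E i') (tgt E h)"
    have "(h \<cdot> f') \<cdot> i = (h \<cdot> i') \<cdot> f" using h(1,2) P by simp
    also have "\<dots> = hzero E (src E i) (tgt E h)" unfolding h(3) using h(1,2) P by simp
    finally obtain w where w: "w \<in> arr E" "tgt E w = tgt E h" "src E w = tgt E p" "w \<cdot> p = h \<cdot> f'"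
      using conf_colift[OF assms(2), of "h \<cdot> f'"] h P by auto
    have "w \<cdot> p' = h"
      by (rule pushout_unique[OF assms(1)]) (use w h p' P in auto)
    then show "\<exists>u. u \<in> arr E \<and> tgt E u = tgt E h \<and> src E u = tgt E p' \<and> u \<cdot> p' = h"
      using w p' by auto
  qed (use p' P in auto)
  then show ?thesis using that p' by blast
qed

lemma pullback_conf:
  assumes "is_pullback E p f f' p'" "conf i p"
  obtains i' where "conf i' p'" "f' \<cdot> i' = i" "src E i' = src E i"
proof -
  note P = pullback_eqs[OF assms(1)] and c = conf_eqs[OF assms(2)]
  have *: "deflation E p'" using pullback_deflation assms unfolding deflation_def by blast
  obtain i' where i': "i' \<in> arr E" "tgt E i' = src E p'" "src E i' = src E i" "f' \<cdot> i' = i"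
    "p' \<cdot> i' = hzero E (src E i) (src E f)"
    using pullback_factor[OF assms(1), of i "hzero E (src E i) (src E f)"] P c by auto
  have "conf i' p'"
  proof (rule deflation_kernel_conf[OF * kernelI])
    show "monic i'" unfolding monic_def
    proof (intro conjI ballI impI)
      fix u v assume *: "u \<in> arr E" "v \<in> arr E" "tgt E u = src E i'" "tgt E v = src E i'"
        "src E u = src E v" "i' \<cdot> u = i' \<cdot> v"
      have "i \<cdot> u = f' \<cdot> (i' \<cdot> u)" using *(1-5) i' P cmp_reduce[OF i'(4), of u] by simp
      also have "\<dots> = i \<cdot> v" unfolding *(6) using *(1-5) i' P cmp_reduce[OF i'(4), of v] by simp
      finally have "i \<cdot> u = i \<cdot> v" .
      then show "u = v" using monicD[OF conf_monic[OF assms(2)], of u v] * i' by simp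
    qed (fact i')
    fix h assume h: "h \<in> arr E" "tgt E h = src E p'" "p' \<cdot> h = hzero E (src E h) (tgt E p')"
    have "p \<cdot> (f' \<cdot> h) = f \<cdot> (p' \<cdot> h)" using h(1,2) P cmp_reduce[OF P(9)] by simp
    also have "\<dots> = hzero E (src E h) (tgt E p)" unfolding h(3) using h(1,2) P by simp
    finally obtain w where w: "w \<in> arr E" "src E w = src E h" "tgt E w = src E i" "i \<cdot> w = f' \<cdot> h"
      using conf_lift[OF assms(2), of "f' \<cdot> h"] h P c by auto
    have "i' \<cdot> w = h"
      by (rule pullback_unique[OF assms(1)])
        (use w h i' P cmp_reduce[OF i'(4)] cmp_reduce[OF i'(5)] in auto)
    then show "\<exists>u. u \<in> arr E \<and> src E u = src E h \<and> tgt E u = src E i' \<and> i' \<cdot> u = h"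
      using w i' by auto
  qed (use i' P in auto)
  then show ?thesis using that i' by blast
qed

lemma ex_pushout_conf:
  assumes "conf i p" "f \<in> arr E" "src E f = src E i"
  obtains f' i' p' where "is_pushout E i f f' i'" "conf i' p'" "p' \<cdot> f' = p" "tgt E p' = tgt E p"
  using inflation_pushout[of i f] pushout_conf assms unfolding inflation_def by metis

lemma ex_pullback_conf:
  assumes "conf i p" "f \<in> arr E" "tgt E f = tgt E p"
  obtains f' i' p' where "is_pullback E p f f' p'" "conf i' p'" "f' \<cdot> i' = i" "src E i' = src E i"
  using deflation_pullback[of p f] pullback_conf assms unfolding deflation_def by metis

text \<open>If \<open>l\<close> is a kernel of \<open>d\<close>, then \<open>d'\<close> is a
  cokernel of \<open>i \<cdot> l\<close>, and this is an inflation as a composite of two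
  inflations.\<close>

lemma pushout_deflation:
  assumes P: "is_pushout E i d d' i'" and i: "inflation E i" and d: "deflation E d"
  shows "deflation E d'"
proof -
  note po = pushout_eqs[OF P]
  obtain l where l: "conf l d" using d unfolding deflation_def by blast
  note c = conf_eqs[OF l]
  have "inflation E l" using l unfolding inflation_def by blast
  then have "inflation E (i \<cdot> l)" by (rule inflation_cmp[OF _ i]) (use c po in simp)
  then have "conf (i \<cdot> l) d'"
  proof (rule inflation_cokernel_conf[OF _ cokernelI])
    show "epic d'" unfolding epic_def
    proof (intro conjI ballI impI)
      fix u v assume *: "u \<in> arr E" "v \<in> arr E" "src E u = tgt E d'" "src E v = tgt E d'"
        "tgt E u = tgt E v" "u \<cdot> d' = v \<cdot> d'"
      have "(u \<cdot> i') \<cdot> d = (u \<cdot> d') \<cdot> i" using *(1-5) po by simp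
      also have "\<dots> = (v \<cdot> i') \<cdot> d" unfolding *(6) using *(1-5) po by simp
      finally have "(u \<cdot> i') \<cdot> d = (v \<cdot> i') \<cdot> d" .
      then have "u \<cdot> i' = v \<cdot> i'"
        by (rule epicD[OF deflation_epic[OF d]]) (use * po in simp_all)
      then show "u = v" using pushout_unique[OF P, of u v] * po by simp
    qed (fact po)
    show "d' \<cdot> i \<cdot> l = hzero E (src E (i \<cdot> l)) (tgt E d')"
      using po c cmp_reduce[OF po(9), of l] by simp
    fix h assume h: "h \<in> arr E" "src E h = tgt E (i \<cdot> l)"
      "h \<cdot> i \<cdot> l = hzero E (src E (i \<cdot> l)) (tgt E h)"
    then have "(h \<cdot> i) \<cdot> l = hzero E (src E l) (tgt E (h \<cdot> i))" using po c by simp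
    then obtain w where w: "w \<in> arr E" "tgt E w = tgt E h" "src E w = tgt E d" "w \<cdot> d = h \<cdot> i"
      using conf_colift[OF l, of "h \<cdot> i"] h po c by auto
    obtain u where "u \<in> arr E" "src E u = tgt E i'" "tgt E u = tgt E w" "u \<cdot> d' = h"
      using pushout_factor[OF P, of h w] w h po c by auto
    then show "\<exists>u. u \<in> arr E \<and> tgt E u = tgt E h \<and> src E u = tgt E d' \<and> u \<cdot> d' = h"
      using w po by auto
  qed (use c po in auto)
  then show ?thesis unfolding deflation_def by blast
qed

subsection \<open>Biproducts and split conflations\<close>

text \<open>A biproduct is the pushout of \<open>A\<close> and \<open>B\<close> over a zero object.
  Pushing the conflation \<open>Z >-> B ->> B\<close> out along \<open>Z -> A\<close> makes
  \<open>i\<close> an inflation; its cokernel is \<open>q\<close>, since the two agree on both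
  injections.\<close>

lemma biprod_conf:
  assumes "biprod A B S i p j q" shows "conf i q"
proof -
  note b = biprod_eqs[OF assms]
  obtain Z where Z: "zero_obj Z" using ex_zero_obj .
  note Z' = zero_obj_obj[OF Z]
  have "is_pushout E (hzero E Z B) (hzero E Z A) j i"
  proof (rule pushoutI)
    fix a c assume *: "a \<in> arr E" "c \<in> arr E" "src E a = tgt E (hzero E Z B)"
      "src E c = tgt E (hzero E Z A)" "tgt E a = tgt E c"
    then show "\<exists>u. u \<in> arr E \<and> src E u = tgt E i \<and> tgt E u = tgt E c \<and> u \<cdot> j = a \<and> u \<cdot> i = c"
      using b Z' by (intro exI[of _ "a \<cdot> q \<boxplus> c \<cdot> p"]) simp
  next
    fix u v assume "u \<in> arr E" "v \<in> arr E" "src E u = tgt E i" "src E v = tgt E i" "tgt E u = tgt E v"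
      "u \<cdot> j = v \<cdot> j" "u \<cdot> i = v \<cdot> i"
    then show "u = v" using biprod_hom_coext[OF assms, of u v] b by simp
  qed (use b Z' in auto)
  then obtain q' where q': "conf i q'" "q' \<cdot> j = idt E B" "tgt E q' = tgt E (idt E B)"
    using pushout_conf[OF _ conf_zero_idt[OF Z, of B]] b by metis
  have "q' = q"
    by (rule biprod_hom_coext[OF assms]) (use q' b conf_eqs[OF q'(1)] in auto)
  then show ?thesis using q' by simp
qed

lemma biprod_deflation: "biprod A B S i p j q \<Longrightarrow> deflation E q" "biprod A B S i p j q \<Longrightarrow> deflation E p"
  using biprod_conf biprod_swap unfolding deflation_def by blast+

text \<open>The complementary idempotent \<open>1 - i r\<close> kills \<open>i\<close>, so it
  descends along \<open>p\<close> to a section \<open>s\<close>. The next lemma is the dual: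
  \<open>1 - s p\<close> lifts along \<open>i\<close> to a retraction.\<close>

lemma retraction_biprod:
  assumes "conf i p" "r \<in> arr E" "src E r = tgt E i" "tgt E r = src E i" "r \<cdot> i = idt E (src E i)"
  obtains s where "biprod (src E i) (tgt E p) (tgt E i) i r s p"
proof -
  note c = conf_eqs[OF assms(1)]
  have "(idt E (tgt E i) \<boxminus> i \<cdot> r) \<cdot> i = hzero E (src E i) (tgt E i)"
    using assms c by simp
  then obtain s where s: "s \<in> arr E" "tgt E s = tgt E i" "src E s = tgt E p"
    "s \<cdot> p = idt E (tgt E i) \<boxminus> i \<cdot> r"
    using conf_colift[OF assms(1), of "idt E (tgt E i) \<boxminus> i \<cdot> r"] assms c by auto
  have "p \<cdot> s = idt E (tgt E p)"
    by (rule epicD[OF conf_epic[OF assms(1)]])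
      (use assms c s cmp_reduce[OF c(4)] in auto)
  moreover have "r \<cdot> s = hzero E (tgt E p) (src E i)"
    by (rule epicD[OF conf_epic[OF assms(1)]])
      (use assms c s cmp_reduce[OF assms(5)] in auto)
  moreover have "i \<cdot> r \<boxplus> s \<cdot> p = idt E (tgt E i)"
    using s assms c add_left_commute[of "i \<cdot> r" "idt E (tgt E i)" "neg (i \<cdot> r)"] by simp
  ultimately have "biprod (src E i) (tgt E p) (tgt E i) i r s p"
    unfolding biprod_def using assms s c by simp
  then show ?thesis using that by blast
qed

lemma section_biprod:
  assumes "conf i p" "s \<in> arr E" "tgt E s = tgt E i" "src E s = tgt E p" "p \<cdot> s = idt E (tgt E p)"
  obtains r where "biprod (src E i) (tgt E p) (tgt E i) i r s p"
proof -
  note c = conf_eqs[OF assms(1)]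
  have "p \<cdot> (idt E (tgt E i) \<boxminus> s \<cdot> p) = hzero E (tgt E i) (tgt E p)"
    using assms c cmp_reduce[OF assms(5)] by simp
  then obtain r where r: "r \<in> arr E" "src E r = tgt E i" "tgt E r = src E i"
    "i \<cdot> r = idt E (tgt E i) \<boxminus> s \<cdot> p"
    using conf_lift[OF assms(1), of "idt E (tgt E i) \<boxminus> s \<cdot> p"] assms c by auto
  have "r \<cdot> i = idt E (src E i)"
    by (rule monicD[OF conf_monic[OF assms(1)]])
      (use assms c r cmp_reduce[OF r(4)] in auto)
  moreover have "r \<cdot> s = hzero E (tgt E p) (src E i)"
    by (rule monicD[OF conf_monic[OF assms(1)]])
      (use assms c r cmp_reduce[OF r(4)] in auto)
  moreover have "i \<cdot> r \<boxplus> s \<cdot> p = idt E (tgt E i)"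
    using r assms c by simp
  ultimately have "biprod (src E i) (tgt E p) (tgt E i) i r s p"
    unfolding biprod_def using assms r c by simp
  then show ?thesis using that by blast
qed

text \<open>The right-hand square is a weak pullback. On the pullback of \<open>p\<close> along \<open>u\<close>, the two maps to the
  target of \<open>b\<close> differ by a map \<open>t\<close> into the common kernel; correcting by \<open>t\<close> gives a map that
  descends to the source of \<open>u\<close>.\<close>

lemma same_kernel_lift:
  assumes "conf i p" "conf i' p'" "b \<in> arr E" "c \<in> arr E"
    "src E b = tgt E i" "tgt E b = tgt E i'" "src E c = tgt E p" "tgt E c = tgt E p'"
    "b \<cdot> i = i'" "p' \<cdot> b = c \<cdot> p"
    and "u \<in> arr E" "v \<in> arr E" "src E u = src E v" "tgt E u = tgt E p" "tgt E v = tgt E i'"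
    "c \<cdot> u = p' \<cdot> v"
  obtains w where "w \<in> arr E" "src E w = src E u" "tgt E w = tgt E i" "p \<cdot> w = u" "b \<cdot> w = v"
proof -
  note c1 = conf_eqs[OF assms(1)] and c2 = conf_eqs[OF assms(2)]
  have "src E i' = src E i" using assms(9) c1 assms(3,5) by (metis src_cmp)
  note a = assms(3-) this
  obtain u' j q where pb: "is_pullback E p u u' q" and q: "conf j q" "u' \<cdot> j = i" "src E j = src E i"
    using ex_pullback_conf[OF assms(1,11)] a by metis
  note p = pullback_eqs[OF pb] and c3 = conf_eqs[OF q(1)]
  have "p' \<cdot> (b \<cdot> u' \<boxminus> v \<cdot> q) = hzero E (src E q) (tgt E p')"
    using a c1 c2 p cmp_reduce[OF a(8)] cmp_reduce[OF a(14)] by simp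
  then obtain t where t: "t \<in> arr E" "src E t = src E q" "tgt E t = src E i'"
    "i' \<cdot> t = b \<cdot> u' \<boxminus> v \<cdot> q"
    using conf_lift[OF assms(2), of "b \<cdot> u' \<boxminus> v \<cdot> q"] a c1 c2 p by auto
  \<comment> \<open>On \<open>j\<close> the map \<open>b \<cdot> u'\<close> becomes
    \<open>i'\<close> and \<open>v \<cdot> q\<close> vanishes. So \<open>t\<close> retracts
    \<open>j\<close>, which is why subtracting \<open>i \<cdot> t\<close> from \<open>u'\<close>
    kills \<open>j\<close>.\<close>
  have tj: "t \<cdot> j = idt E (src E j)"
    by (rule monicD[OF conf_monic[OF assms(2)]])
      (use a c1 c2 c3 p t q cmp_reduce[OF t(4)] in auto)
  then have "(u' \<boxminus> i \<cdot> t) \<cdot> j = hzero E (src E j) (tgt E i)"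
    using a c1 c2 c3 p t q by simp
  then obtain w where w: "w \<in> arr E" "tgt E w = tgt E i" "src E w = tgt E q" "w \<cdot> q = u' \<boxminus> i \<cdot> t"
    using conf_colift[OF q(1), of "u' \<boxminus> i \<cdot> t"] a c1 c2 c3 p t q by auto
  have "p \<cdot> w = u"
    by (rule epicD[OF conf_epic[OF q(1)]])
      (use a c1 c2 c3 p t q w cmp_reduce[OF c1(4)] in auto)
  moreover have "b \<cdot> w = v"
  proof (rule epicD[OF conf_epic[OF q(1)]])
    have "b \<cdot> w \<cdot> q = b \<cdot> u' \<boxminus> i' \<cdot> t"
      using a c1 c2 c3 p t q w cmp_reduce[OF a(7)] by simp
    also have "\<dots> = v \<cdot> q"
      unfolding t(4) using a c1 c2 c3 p q add_cancel_left(1)[of "b \<cdot> u'" "v \<cdot> q"] by simp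
    finally show "(b \<cdot> w) \<cdot> q = v \<cdot> q" using a c1 c2 c3 p t q w by simp
  qed (use a c1 c2 c3 p t q w in auto)
  ultimately show ?thesis using that[of w] w p by simp
qed

text \<open>The map in question is the direct sum of \<open>d\<close> with an identity, and it is
  the pullback of \<open>d\<close> along the projection \<open>p\<close>.\<close>

lemma biprod_map_deflation:
  assumes "biprod A B S i p j q" "biprod A' B S' i' p' j' q'" "deflation E d" "src E d = A'" "tgt E d = A"
  shows "deflation E (i \<cdot> (d \<cdot> p') \<boxplus> j \<cdot> q')"
proof (rule pullback_deflation[OF _ assms(3)])
  note b = biprod_eqs[OF assms(1)] and b' = biprod_eqs[OF assms(2)] and d = deflation_arr[OF assms(3)]
  note r = biprod_reduce[OF assms(1)] biprod_reduce[OF assms(2)]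
  show "is_pullback E d p p' (i \<cdot> (d \<cdot> p') \<boxplus> j \<cdot> q')"
  proof (rule pullbackI)
    fix u v assume *: "u \<in> arr E" "v \<in> arr E" "tgt E u = src E d" "tgt E v = src E p"
      "src E u = src E v" "d \<cdot> u = p \<cdot> v"
    show "\<exists>w. w \<in> arr E \<and> tgt E w = src E (i \<cdot> (d \<cdot> p') \<boxplus> j \<cdot> q') \<and> src E w = src E v \<and> p' \<cdot> w = u \<and>
      (i \<cdot> (d \<cdot> p') \<boxplus> j \<cdot> q') \<cdot> w = v"
      by (rule exI[of _ "i' \<cdot> u \<boxplus> j' \<cdot> (q \<cdot> v)"])
        (use * b b' d assms(4,5) r biprod_decomp[OF assms(1), of v] in simp)
  next
    fix u v assume *: "u \<in> arr E" "v \<in> arr E" "tgt E u = src E (i \<cdot> (d \<cdot> p') \<boxplus> j \<cdot> q')"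
      "tgt E v = src E (i \<cdot> (d \<cdot> p') \<boxplus> j \<cdot> q')" "src E u = src E v" "p' \<cdot> u = p' \<cdot> v"
      "(i \<cdot> (d \<cdot> p') \<boxplus> j \<cdot> q') \<cdot> u = (i \<cdot> (d \<cdot> p') \<boxplus> j \<cdot> q') \<cdot> v"
    then have "q \<cdot> ((i \<cdot> (d \<cdot> p') \<boxplus> j \<cdot> q') \<cdot> u) = q \<cdot> ((i \<cdot> (d \<cdot> p') \<boxplus> j \<cdot> q') \<cdot> v)" by simp
    then have "q' \<cdot> u = q' \<cdot> v"
      using *(1-6) b b' d assms(4,5) r by simp
    then show "u = v" using biprod_hom_ext[OF assms(2), of u v] * b b' d assms(4,5) by simp
  qed (use b b' d assms(4,5) r in auto)
qed

end

section \<open>Weak idempotent completeness: cancellation for deflations\<close>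

locale wic_exact_category = exact_category +
  assumes wic: "weakly_idempotent_complete E"
    and enough_projectives: "enough_projectives E"
begin

text \<open>Replacing \<open>g\<close> by \<open>g \<cdot> q\<close> for a projection \<open>q\<close> of a biproduct makes it a deflation; its kernel
  contains the complementary summand, and pushing the kernel out along the cokernel of that
  summand produces a kernel of \<open>g\<close> that is an inflation.\<close>

lemma deflation_cancel:
  assumes d: "deflation E (g \<cdot> f)" and fg: "f \<in> arr E" "g \<in> arr E" "tgt E f = src E g"
  shows "deflation E g"
proof -
  let ?A = "src E f" and ?B = "src E g" and ?C = "tgt E g"
  obtain S i p j q where S: "biprod ?A ?B S i p j q" using ex_biprod[OF src_obj[OF fg(1)] src_obj[OF fg(2)]] .
  obtain T i1 p1 j1 q1 where T: "biprod ?C ?B T i1 p1 j1 q1" using ex_biprod[OF tgt_obj[OF fg(2)] src_obj[OF fg(2)]] .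
  note s = biprod_eqs[OF S] and t = biprod_eqs[OF T]
  \<comment> \<open>The map \<open>(g f, g)\<close> from \<open>A + B\<close> to \<open>C\<close> is
    written as the direct sum of \<open>g f\<close> with an identity, followed by
    \<open>(1, g)\<close>. The latter is a projection up to a shear, so both factors are deflations.
    A further shear by \<open>f\<close> exhibits the composite as \<open>g\<close> after the
    projection \<open>q'\<close>.\<close>
  have d1: "deflation E (i1 \<cdot> ((g \<cdot> f) \<cdot> p) \<boxplus> j1 \<cdot> q)"
    by (rule biprod_map_deflation[OF T S d]) (use fg in auto)
  have d2: "deflation E (p1 \<boxplus> g \<cdot> q1)"
    using biprod_deflation(1)[OF biprod_shear[OF biprod_swap[OF T] fg(2)]] by simp
  have "deflation E ((p1 \<boxplus> g \<cdot> q1) \<cdot> (i1 \<cdot> ((g \<cdot> f) \<cdot> p) \<boxplus> j1 \<cdot> q))"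
    by (rule deflation_cmp[OF d1 d2]) (use fg s t in simp)
  also have "(p1 \<boxplus> g \<cdot> q1) \<cdot> (i1 \<cdot> ((g \<cdot> f) \<cdot> p) \<boxplus> j1 \<cdot> q) = g \<cdot> (q \<boxplus> f \<cdot> p)"
    using fg s t biprod_reduce[OF T] add_commute[of "g \<cdot> q" "g \<cdot> (f \<cdot> p)"] by simp
  finally have "deflation E (g \<cdot> (q \<boxplus> f \<cdot> p))" .
  moreover define q' i' where "q' = q \<boxplus> f \<cdot> p" and "i' = i \<boxminus> j \<cdot> f"
  moreover have S': "biprod ?A ?B S i' p j q'"
    unfolding q'_def i'_def by (rule biprod_shear[OF S]) (use fg in auto)
  ultimately obtain k where k: "conf k (g \<cdot> q')" unfolding deflation_def by auto
  note s = biprod_eqs[OF S'] and c = conf_eqs[OF k]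
  have "(g \<cdot> q') \<cdot> i' = hzero E (src E i') (tgt E (g \<cdot> q'))" using s fg by simp
  then obtain u where u: "u \<in> arr E" "src E u = ?A" "tgt E u = src E k" "k \<cdot> u = i'"
    using conf_lift[OF k, of i'] s c fg by auto
  \<comment> \<open>This retraction turns \<open>u\<close> into a section, so that weak idempotent
    completeness provides its cokernel \<open>e\<close>.\<close>
  have "(p \<cdot> k) \<cdot> u = idt E (src E u)" using u s c fg by simp
  then obtain e where e: "is_cokernel E u e"
    using wic u s c fg unfolding weakly_idempotent_complete_def
    by (metis Hom_iff cmp_arr src_cmp tgt_cmp)
  note ce = cokernel_eqs[OF e]
  obtain l where l: "l \<in> arr E" "tgt E l = ?B" "src E l = tgt E e" "l \<cdot> e = q' \<cdot> k"
    using cokernel_colift[OF e, of "q' \<cdot> k"] u s c fg by auto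
  \<comment> \<open>Both \<open>q'\<close> and \<open>e\<close> divide out a copy of
    \<open>A\<close>, embedded by \<open>i'\<close> and by \<open>u\<close> with
    \<open>k \<cdot> u = i'\<close>. A pair of maps that agrees on the kernel therefore kills
    \<open>i'\<close> and factors through \<open>q'\<close>.\<close>
  have "is_pushout E k e q' l"
  proof (rule pushoutI)
    fix a b assume *: "a \<in> arr E" "b \<in> arr E" "src E a = tgt E k" "src E b = tgt E e"
      "tgt E a = tgt E b" "a \<cdot> k = b \<cdot> e"
    have "a \<cdot> i' = a \<cdot> (k \<cdot> u)" using u by simp
    also have "\<dots> = b \<cdot> (e \<cdot> u)" using * u s c fg ce cmp_reduce[OF *(6), of u] by simp
    also have "\<dots> = hzero E ?A (tgt E a)" using * u s c fg ce by simp
    finally have "a = a \<cdot> j \<cdot> q'"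
      using biprod_codecomp[OF S', of a] * s c fg by simp
    moreover have "(a \<cdot> j) \<cdot> l = b"
    proof (rule epicD[OF cokernel_epic[OF e]])
      have "((a \<cdot> j) \<cdot> l) \<cdot> e = (a \<cdot> j \<cdot> q') \<cdot> k" using * u s c fg ce l by simp
      also have "\<dots> = b \<cdot> e" using \<open>a = a \<cdot> j \<cdot> q'\<close> * by simp
      finally show "((a \<cdot> j) \<cdot> l) \<cdot> e = b \<cdot> e" .
    qed (use * u s c fg ce l in auto)
    ultimately show "\<exists>w. w \<in> arr E \<and> src E w = tgt E l \<and> tgt E w = tgt E b \<and> w \<cdot> q' = a \<and> w \<cdot> l = b"
      using * s c fg l by (intro exI[of _ "a \<cdot> j"]) simp
  next
    fix v w assume *: "v \<in> arr E" "w \<in> arr E" "src E v = tgt E l" "src E w = tgt E l"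
      "tgt E v = tgt E w" "v \<cdot> q' = w \<cdot> q'"
    show "v = w"
      by (rule epicD[OF deflation_epic[OF biprod_deflation(1)[OF S']] *(6)]) (use * s l in auto)
  qed (use u s c fg ce l in auto)
  then obtain g' where g': "conf l g'" "g' \<cdot> q' = g \<cdot> q'" "tgt E g' = tgt E (g \<cdot> q')"
    using pushout_conf[OF _ k] by metis
  have "g' = g"
    by (rule epicD[OF deflation_epic[OF biprod_deflation(1)[OF S']] g'(2)])
      (use g' conf_eqs[OF g'(1)] s l fg in auto)
  then show ?thesis using g' unfolding deflation_def by blast
qed

end

context exact_category
begin

subsection \<open>Projective objects\<close>

lemma projective_obj: "P \<in> projectives E \<Longrightarrow> P \<in> obj E"
  unfolding projectives_def by simp

text \<open>For every object \<open>P\<close> the functor \<open>Hom(P, -)\<close> is exact at the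
  left and in the middle of a conflation, because the inflation is a kernel. What remains is
  surjectivity on the right, that is, lifting along deflations.\<close>

lemma projective_iff:
  "P \<in> projectives E \<longleftrightarrow> P \<in> obj E \<and> (\<forall>p h. deflation E p \<longrightarrow> h \<in> arr E \<longrightarrow> src E h = P \<longrightarrow>
    tgt E h = tgt E p \<longrightarrow> (\<exists>u. u \<in> arr E \<and> src E u = P \<and> tgt E u = src E p \<and> p \<cdot> u = h))"
proof -
  have "short_exact_sequence (hom_group E P (tgt E p)) (hom_group E P (tgt E i)) (hom_group E P (src E i))
      (\<lambda>h. p \<cdot> h) (\<lambda>h. i \<cdot> h) \<longleftrightarrow>
      (\<forall>h. h \<in> arr E \<longrightarrow> src E h = P \<longrightarrow>
    tgt E h = tgt E p \<longrightarrow> (\<exists>u. u \<in> arr E \<and> src E u = P \<and> tgt E u = src E p \<and> p \<cdot> u = h))"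
    (is "?L \<longleftrightarrow> ?R")
    if P: "P \<in> obj E" and c: "conf i p" for i p
  proof -
    note ce = conf_eqs[OF c]
    interpret GZ: comm_group "hom_group E P (tgt E p)" using hom_comm_group P ce by simp
    interpret GY: comm_group "hom_group E P (tgt E i)" using hom_comm_group P ce by simp
    interpret GX: comm_group "hom_group E P (src E i)" using hom_comm_group P ce by simp
    have h1: "group_hom (hom_group E P (tgt E i)) (hom_group E P (tgt E p)) (\<lambda>h. p \<cdot> h)"
      by unfold_locales (use ce in \<open>auto simp: hom_def\<close>)
    have h2: "group_hom (hom_group E P (src E i)) (hom_group E P (tgt E i)) (\<lambda>h. i \<cdot> h)"
      by unfold_locales (use ce in \<open>auto simp: hom_def\<close>)
    have ker: "kernel (hom_group E P (tgt E i)) (hom_group E P (tgt E p)) (\<lambda>h. p \<cdot> h)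
      = (\<lambda>h. i \<cdot> h) ` carrier (hom_group E P (src E i))"
    proof (intro equalityI subsetI)
      fix h assume h: "h \<in> kernel (hom_group E P (tgt E i)) (hom_group E P (tgt E p)) (\<lambda>h. p \<cdot> h)"
      then have "h \<in> arr E" "src E h = P" "tgt E h = tgt E i" "p \<cdot> h = hzero E P (tgt E p)"
        by (auto simp: kernel_def)
      then obtain u where "u \<in> arr E" "src E u = P" "tgt E u = src E i" "i \<cdot> u = h"
        using conf_lift[OF c, of h] by metis
      then show "h \<in> (\<lambda>h. i \<cdot> h) ` carrier (hom_group E P (src E i))" by auto
    next
      fix h assume "h \<in> (\<lambda>h. i \<cdot> h) ` carrier (hom_group E P (src E i))"
      then obtain u where u: "h = i \<cdot> u" "u \<in> arr E" "src E u = P" "tgt E u = src E i" by auto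
      have "p \<cdot> (i \<cdot> u) = hzero E P (tgt E p)"
        using u(2-) ce(1-3) cmp_reduce[OF ce(4) ce(1), of u] by simp
      then show "h \<in> kernel (hom_group E P (tgt E i)) (hom_group E P (tgt E p)) (\<lambda>h. p \<cdot> h)"
        using u ce(1-3) unfolding kernel_def by simp
    qed
    have inj: "inj_on (\<lambda>h. i \<cdot> h) (carrier (hom_group E P (src E i)))"
      using monicD[OF conf_monic[OF c]] by (auto simp: inj_on_def)
    have surj: "(\<lambda>h. p \<cdot> h) ` carrier (hom_group E P (tgt E i)) = carrier (hom_group E P (tgt E p)) \<longleftrightarrow> ?R"
    proof
      assume L: "(\<lambda>h. p \<cdot> h) ` carrier (hom_group E P (tgt E i)) = carrier (hom_group E P (tgt E p))"
      show ?R
      proof (intro allI impI)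
        fix h assume "h \<in> arr E" "src E h = P" "tgt E h = tgt E p"
        then have "h \<in> (\<lambda>h. p \<cdot> h) ` carrier (hom_group E P (tgt E i))" unfolding L by simp
        then show "\<exists>u. u \<in> arr E \<and> src E u = P \<and> tgt E u = src E p \<and> p \<cdot> u = h" using ce(3) by auto
      qed
    next
      assume R: ?R
      show "(\<lambda>h. p \<cdot> h) ` carrier (hom_group E P (tgt E i)) = carrier (hom_group E P (tgt E p))"
      proof (intro equalityI subsetI)
        fix h assume "h \<in> (\<lambda>h. p \<cdot> h) ` carrier (hom_group E P (tgt E i))"
        then show "h \<in> carrier (hom_group E P (tgt E p))" using ce by auto
      next
        fix h assume "h \<in> carrier (hom_group E P (tgt E p))"
        then obtain u where "u \<in> arr E" "src E u = P" "tgt E u = src E p" "p \<cdot> u = h"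
          using R by (metis Hom_iff hom_group_sel(1))
        then show "h \<in> (\<lambda>h. p \<cdot> h) ` carrier (hom_group E P (tgt E i))" using ce(3) by auto
      qed
    qed
    show ?thesis
      using h1 h2 ker inj surj group_hom.homh[OF h1] group_hom.homh[OF h2]
        GX.is_group GY.is_group GZ.is_group
      by (auto simp: short_exact_sequence_iff epi_def mon_def)
  qed
  note ses = this
  show ?thesis
  proof (cases "P \<in> obj E")
    case True
    have "P \<in> projectives E \<longleftrightarrow> (\<forall>i p. conf i p \<longrightarrow> short_exact_sequence (hom_group E P (tgt E p))
      (hom_group E P (tgt E i)) (hom_group E P (src E i)) (\<lambda>h. p \<cdot> h) (\<lambda>h. i \<cdot> h))"
      using True conf_eqs unfolding projectives_def conflation_on_def by auto
    then show ?thesis using ses[OF True] True unfolding deflation_def by metis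
  qed (simp add: projectives_def)
qed

subsection \<open>Split extensions\<close>

text \<open>The working form of \<open>Ext^1(X, Y) = 0\<close>, justified by
  \<open>Ext_zero_1_iff\<close>. Membership of both objects is built in, so that it never holds
  vacuously outside the category.\<close>

definition ext_split where "ext_split X Y \<longleftrightarrow> X \<in> obj E \<and> Y \<in> obj E \<and>
  (\<forall>i p. conf i p \<longrightarrow> src E i = Y \<longrightarrow> tgt E p = X \<longrightarrow>
    (\<exists>s. s \<in> arr E \<and> src E s = X \<and> tgt E s = tgt E i \<and> p \<cdot> s = idt E X))"

lemma ext_splitD:
  assumes "ext_split X Y" "conf i p" "src E i = Y" "tgt E p = X"
  obtains r s where "biprod Y X (tgt E i) i r s p"
proof -
  obtain s where "s \<in> arr E" "src E s = X" "tgt E s = tgt E i" "p \<cdot> s = idt E X"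
    using assms unfolding ext_split_def by blast
  then show ?thesis using section_biprod[OF assms(2), of s] assms that by metis
qed

lemma ext_splitI:
  assumes "X \<in> obj E" "Y \<in> obj E"
    and "\<And>i p. \<lbrakk>conf i p; src E i = Y; tgt E p = X\<rbrakk> \<Longrightarrow>
      \<exists>s. s \<in> arr E \<and> src E s = X \<and> tgt E s = tgt E i \<and> p \<cdot> s = idt E X"
  shows "ext_split X Y"
  using assms unfolding ext_split_def by blast

lemma ext_split_obj: "ext_split X Y \<Longrightarrow> X \<in> obj E" "ext_split X Y \<Longrightarrow> Y \<in> obj E"
  by (auto simp: ext_split_def)

text \<open>The obstruction to lifting \<open>u\<close> along \<open>p\<close> is the conflation
  pulled back along \<open>u\<close>. It splits, and its section followed by the projection to the
  middle term is the lift.\<close>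

lemma ext_lift:
  assumes "ext_split W Y" "conf i p" "src E i = Y" "u \<in> arr E" "src E u = W" "tgt E u = tgt E p"
  obtains v where "v \<in> arr E" "src E v = W" "tgt E v = tgt E i" "p \<cdot> v = u"
proof -
  obtain u' j q where pb: "is_pullback E p u u' q" and q: "conf j q" "src E j = src E i"
    using ex_pullback_conf[OF assms(2,4,6)] by metis
  note p = pullback_eqs[OF pb] and c = conf_eqs[OF q(1)] conf_eqs[OF assms(2)]
  obtain r s where "biprod Y W (tgt E j) j r s q"
    using ext_splitD[OF assms(1) q(1)] q(2) assms(3,5) p by metis
  note b = biprod_eqs[OF this]
  show ?thesis
    by (rule that[of "u' \<cdot> s"]) (use p c b assms(3-) cmp_reduce[OF p(9)] in auto)
qed

text \<open>Dually, the obstruction to extending \<open>u\<close> along \<open>i\<close> is the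
  conflation pushed out along \<open>u\<close>; a retraction of it provides the extension.\<close>

lemma ext_extend:
  assumes "ext_split X W" "conf i p" "tgt E p = X" "u \<in> arr E" "tgt E u = W" "src E u = src E i"
  obtains v where "v \<in> arr E" "tgt E v = W" "src E v = tgt E i" "v \<cdot> i = u"
proof -
  obtain u' j q where pb: "is_pushout E i u u' j" and q: "conf j q" "tgt E q = tgt E p"
    using ex_pushout_conf[OF assms(2,4,6)] by metis
  note p = pushout_eqs[OF pb] and c = conf_eqs[OF q(1)] conf_eqs[OF assms(2)]
  obtain r s where "biprod W X (tgt E j) j r s q"
    using ext_splitD[OF assms(1) q(1)] q(2) assms(3,5) p by metis
  note b = biprod_eqs[OF this]
  show ?thesis
    by (rule that[of "r \<cdot> u'"]) (use p c b assms(3-) cmp_reduce[OF b(16), of u] in auto)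
qed

lemma ext_split_projective:
  assumes "P \<in> projectives E" "Y \<in> obj E" shows "ext_split P Y"
proof (rule ext_splitI)
  fix i p assume "conf i p" "src E i = Y" "tgt E p = P"
  moreover from this have "deflation E p" unfolding deflation_def by blast
  ultimately show "\<exists>s. s \<in> arr E \<and> src E s = P \<and> tgt E s = tgt E i \<and> p \<cdot> s = idt E P"
    using assms conf_eqs[of i p] unfolding projective_iff
    by (metis idt_arr src_idt tgt_idt)
qed (use assms projective_obj in auto)

lemma ext_split_retract:
  assumes "ext_split S Y" "f \<in> arr E" "g \<in> arr E" "src E f = X" "tgt E f = S" "src E g = S" "tgt E g = X"
    "g \<cdot> f = idt E X"
  shows "ext_split X Y"
proof (rule ext_splitI)
  show "X \<in> obj E" "Y \<in> obj E" using assms ext_split_obj by auto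
  fix i p assume *: "conf i p" "src E i = Y" "tgt E p = X"
  note c = conf_eqs[OF *(1)]
  obtain v where v: "v \<in> arr E" "src E v = S" "tgt E v = tgt E i" "p \<cdot> v = g"
    using ext_lift[OF assms(1) *(1,2), of g] assms * by metis
  show "\<exists>s. s \<in> arr E \<and> src E s = X \<and> tgt E s = tgt E i \<and> p \<cdot> s = idt E X"
    by (rule exI[of _ "v \<cdot> f"]) (use assms * c v cmp_reduce[OF v(4)] in simp)
qed

text \<open>A conflation over the middle term is first restricted to the subobject
  \<open>src E i\<close>, where it splits with a retraction \<open>r\<close>. The restricted middle
  term sits in the full one with cokernel \<open>p \<cdot> q\<close>, so the second hypothesis
  extends \<open>r\<close> to a retraction of \<open>j\<close>.\<close>

lemma ext_split_extension:
  assumes "conf i p" "ext_split (src E i) Y" "ext_split (tgt E p) Y"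
  shows "ext_split (tgt E i) Y"
proof (rule ext_splitI)
  note c = conf_eqs[OF assms(1)]
  show "tgt E i \<in> obj E" "Y \<in> obj E" using c ext_split_obj[OF assms(2)] by auto
  fix j q assume j: "conf j q" "src E j = Y" "tgt E q = tgt E i"
  note cj = conf_eqs[OF j(1)]
  obtain i' j' q' where pb: "is_pullback E q i i' q'" and q': "conf j' q'" "i' \<cdot> j' = j" "src E j' = src E j"
    using ex_pullback_conf[OF j(1), of i] c j by metis
  note pe = pullback_eqs(1-4,6-9)[OF pb] and cq = conf_eqs[OF q'(1)]
  have "deflation E (p \<cdot> q)"
    by (rule deflation_cmp) (use j assms(1) c in \<open>auto simp: deflation_def\<close>)
  then have ci: "conf i' (p \<cdot> q)"
  proof (rule deflation_kernel_conf[OF _ kernelI])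
    show "monic i'" unfolding monic_def
    proof (intro conjI ballI impI)
      fix u v assume *: "u \<in> arr E" "v \<in> arr E" "tgt E u = src E i'" "tgt E v = src E i'"
        "src E u = src E v" "i' \<cdot> u = i' \<cdot> v"
      have "i \<cdot> (q' \<cdot> u) = q \<cdot> (i' \<cdot> u)" using *(1-5) pe cmp_reduce[OF pe(8), of u] by simp
      also have "\<dots> = i \<cdot> (q' \<cdot> v)" unfolding *(6) using *(1-5) pe cmp_reduce[OF pe(8), of v] by simp
      finally have "q' \<cdot> u = q' \<cdot> v"
        by (rule monicD[OF conf_monic[OF assms(1)]]) (use * pe in simp_all)
      then show "u = v" using pullback_unique[OF pb, of u v] * pe by simp
    qed (fact pe)
    show "(p \<cdot> q) \<cdot> i' = hzero E (src E i') (tgt E (p \<cdot> q))"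
      using pe c cj j cmp_reduce[OF c(4), of q'] by simp
    fix h assume h: "h \<in> arr E" "tgt E h = src E (p \<cdot> q)"
      "(p \<cdot> q) \<cdot> h = hzero E (src E h) (tgt E (p \<cdot> q))"
    then have "p \<cdot> (q \<cdot> h) = hzero E (src E (q \<cdot> h)) (tgt E p)" using c cj j by simp
    then obtain w where w: "w \<in> arr E" "src E w = src E h" "tgt E w = src E i" "i \<cdot> w = q \<cdot> h"
      using conf_lift[OF assms(1), of "q \<cdot> h"] h c cj j by auto
    obtain u where "u \<in> arr E" "tgt E u = src E q'" "src E u = src E w" "i' \<cdot> u = h"
      using pullback_factor[OF pb, of h w] w h c cj j by auto
    then show "\<exists>u. u \<in> arr E \<and> src E u = src E h \<and> tgt E u = src E i' \<and> i' \<cdot> u = h"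
      using w pe by auto
  qed (use c cj j pe in auto)
  obtain r s where r: "biprod Y (src E i) (tgt E j') j' r s q'"
    using ext_splitD[OF assms(2) q'(1)] q'(3) j pe by metis
  note br = biprod_eqs[OF r]
  obtain v where v: "v \<in> arr E" "tgt E v = Y" "src E v = tgt E i'" "v \<cdot> i' = r"
    using ext_extend[OF assms(3) ci, of r] br c cj j pe cq by auto
  have "v \<cdot> j = (v \<cdot> i') \<cdot> j'" using v(1-3) q' pe cq by simp
  then have "v \<cdot> j = idt E (src E j)" using v(4) br j by simp
  then obtain s' where "biprod (src E j) (tgt E q) (tgt E j) j v s' q"
    using retraction_biprod[OF j(1), of v] v j cj pe by auto
  from biprod_eqs[OF this] j
  show "\<exists>s. s \<in> arr E \<and> src E s = tgt E i \<and> tgt E s = tgt E j \<and> q \<cdot> s = idt E (tgt E i)"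
    by (intro exI[of _ s']) auto
qed

text \<open>The section is the sum of the \<open>s k \<cdot> p k\<close>. The induction over subsets
  carries membership in the hom set along, since a finite product unfolds only for terms in the
  carrier.\<close>

lemma direct_sum_induced:
  assumes "direct_sum E Xs S i p"
    and "\<And>k. k < length Xs \<Longrightarrow> s k \<in> Hom E (Xs ! k) M"
    and "q \<in> arr E" "src E q = M" "tgt E q = S"
    and "\<And>k. k < length Xs \<Longrightarrow> q \<cdot> s k = i k"
  obtains u where "u \<in> arr E" "src E u = S" "tgt E u = M" "q \<cdot> u = idt E S"
proof -
  have d: "S \<in> obj E" "set Xs \<subseteq> obj E"
    "\<And>k. k < length Xs \<Longrightarrow> i k \<in> Hom E (Xs ! k) S \<and> p k \<in> Hom E S (Xs ! k)"
    "(\<Otimes>\<^bsub>hom_group E S S\<^esub>k\<in>{..<length Xs}. i k \<cdot> p k) = idt E S"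
    using assms(1) unfolding direct_sum_def by auto
  have M: "M \<in> obj E" using assms by auto
  interpret GS: comm_group "hom_group E S S" using hom_comm_group d by simp
  interpret GM: comm_group "hom_group E S M" using hom_comm_group d M by simp
  have "q \<cdot> (\<Otimes>\<^bsub>hom_group E S M\<^esub>k\<in>A. s k \<cdot> p k) = (\<Otimes>\<^bsub>hom_group E S S\<^esub>k\<in>A. i k \<cdot> p k) \<and>
      (\<Otimes>\<^bsub>hom_group E S M\<^esub>k\<in>A. s k \<cdot> p k) \<in> Hom E S M"
    if "A \<subseteq> {..<length Xs}" for A
    using finite_subset[OF that finite_lessThan] that
  proof (induction A rule: finite_induct)
    case empty
    then show ?case using d M assms(3-5) by simp
  next
    case (insert k A)
    have k: "(\<lambda>k. s k \<cdot> p k) \<in> insert k A \<rightarrow> carrier (hom_group E S M)"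
      "(\<lambda>k. i k \<cdot> p k) \<in> insert k A \<rightarrow> carrier (hom_group E S S)"
      using insert.prems d(3) assms(2) by (auto simp: Pi_def subset_iff)
    have "q \<cdot> (s k \<cdot> p k) = i k \<cdot> p k"
      using insert.prems d(3)[of k] assms(2)[of k] assms(3-5) assms(6)[of k]
        cmp_reduce[OF assms(6)[of k], of "p k"] by auto
    moreover have "s k \<cdot> p k \<in> Hom E S M" using k by auto
    ultimately show ?case using insert k assms(3-5) by (simp add: Pi_def)
  qed
  from this[of "{..<length Xs}"] show ?thesis using that d(4) by auto
qed

lemma ext_split_direct_sum:
  assumes "direct_sum E Xs S i p" "\<And>X. X \<in> set Xs \<Longrightarrow> ext_split X Y" "Y \<in> obj E"
  shows "ext_split S Y"
proof (rule ext_splitI)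
  show "S \<in> obj E" using assms(1) unfolding direct_sum_def by simp
  fix j q assume j: "conf j q" "src E j = Y" "tgt E q = S"
  have "\<exists>v. v \<in> arr E \<and> src E v = Xs ! k \<and> tgt E v = tgt E j \<and> q \<cdot> v = i k" if "k < length Xs" for k
  proof -
    have "i k \<in> Hom E (Xs ! k) S" using assms(1) that unfolding direct_sum_def by blast
    then show ?thesis
      using ext_lift[OF assms(2)[OF nth_mem[OF that]] j(1,2), of "i k"] j by auto
  qed
  then obtain s where s: "\<And>k. k < length Xs \<Longrightarrow> s k \<in> arr E \<and> src E (s k) = Xs ! k \<and>
    tgt E (s k) = tgt E j \<and> q \<cdot> s k = i k" by metis
  show "\<exists>s. s \<in> arr E \<and> src E s = S \<and> tgt E s = tgt E j \<and> q \<cdot> s = idt E S"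
    using direct_sum_induced[OF assms(1), of s "tgt E j" q] s conf_eqs[OF j(1)] j by auto
qed (fact assms)

end

subsection \<open>Yoneda extensions\<close>

text \<open>The relation lives on all lists while only the extensions are divided by it, so it is
  treated as an equivalence on \<open>UNIV\<close>. Existence of an extension has to be stated, as
  an empty quotient is not a singleton.\<close>

lemma Ext_zero_iff:
  "Ext_zero E n X Y \<longleftrightarrow> extensions E n X Y \<noteq> {} \<and>
    (\<forall>fs \<in> extensions E n X Y. \<forall>gs \<in> extensions E n X Y. equivclp (extension_morphism E n X Y) fs gs)"
proof -
  let ?A = "extensions E n X Y" and ?r = "{(fs, gs). equivclp (extension_morphism E n X Y) fs gs}"
  have eq: "equiv UNIV ?r"
    by (intro equivI) (auto simp: refl_on_def sym_def trans_def intro: equivclp_sym equivclp_trans)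
  show ?thesis
  proof
    assume "Ext_zero E n X Y"
    then obtain c where c: "?A // ?r = {c}" unfolding Ext_zero_def Yoneda_Ext_def is_singleton_def by blast
    then have "?r `` {fs} = c" if "fs \<in> ?A" for fs using quotientI[OF that, of ?r] by simp
    then have "gs \<in> ?r `` {fs}" if "fs \<in> ?A" "gs \<in> ?A" for fs gs
      using that equiv_class_self[OF eq, of gs] by simp
    moreover have "?A \<noteq> {}"
    proof
      assume "?A = {}"
      then have "?A // ?r = {}" by (simp add: quotient_def)
      then show False using c by simp
    qed
    ultimately show "?A \<noteq> {} \<and> (\<forall>fs \<in> ?A. \<forall>gs \<in> ?A. equivclp (extension_morphism E n X Y) fs gs)"
      by blast
  next
    assume *: "?A \<noteq> {} \<and> (\<forall>fs \<in> ?A. \<forall>gs \<in> ?A. equivclp (extension_morphism E n X Y) fs gs)"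
    have "is_singleton (?A // ?r)"
    proof (rule is_singletonI')
      show "?A // ?r \<noteq> {}" using * by (simp add: quotient_def)
      fix x y assume "x \<in> ?A // ?r" "y \<in> ?A // ?r"
      then obtain a b where ab: "a \<in> ?A" "x = ?r `` {a}" "b \<in> ?A" "y = ?r `` {b}" by (elim quotientE)
      then have "(a, b) \<in> ?r" using * by simp
      then show "x = y" unfolding ab(2,4) by (rule equiv_class_eq[OF eq])
    qed
    then show "Ext_zero E n X Y" unfolding Ext_zero_def Yoneda_Ext_def by simp
  qed
qed

text \<open>Any two extensions are linked by a zigzag of length two through
  \<open>e\<close>.\<close>

lemma Ext_zero_weakly_initial:
  assumes "e \<in> extensions E n X Y"
    and "\<And>fs. fs \<in> extensions E n X Y \<Longrightarrow> extension_morphism E n X Y e fs"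
  shows "Ext_zero E n X Y"
  unfolding Ext_zero_iff
proof (intro conjI ballI)
  fix fs gs assume "fs \<in> extensions E n X Y" "gs \<in> extensions E n X Y"
  then have "equivclp (extension_morphism E n X Y) e fs" "equivclp (extension_morphism E n X Y) e gs"
    using assms(2) by (auto intro: r_into_equivclp)
  then show "equivclp (extension_morphism E n X Y) fs gs" by (blast intro: equivclp_sym equivclp_trans)
qed (use assms in auto)

text \<open>Transport of a property along the zigzag from a known extension \<open>e\<close>. Both
  directions of transport are required because the links point either way.\<close>

lemma Ext_zero_invariant:
  assumes "Ext_zero E n X Y" "e \<in> extensions E n X Y" "fs \<in> extensions E n X Y" "Q e"
    and "\<And>fs gs. \<lbrakk>extension_morphism E n X Y fs gs; Q fs\<rbrakk> \<Longrightarrow> Q gs"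
    and "\<And>fs gs. \<lbrakk>extension_morphism E n X Y fs gs; Q gs\<rbrakk> \<Longrightarrow> Q fs"
  shows "Q fs"
proof -
  have "equivclp (extension_morphism E n X Y) e fs" using assms(1-3) unfolding Ext_zero_iff by blast
  then show ?thesis by (induction rule: equivclp_induct) (use assms(4-6) in blast)+
qed

section \<open>Images and kernels in exact sequences\<close>

context exact_category
begin

text \<open>The kernel of a monic deflation is a zero map, so the identity descends along
  \<open>d\<close> to an inverse.\<close>

lemma monic_deflation_iso:
  assumes "deflation E d" "monic d" shows "is_iso E d"
proof -
  obtain l where l: "conf l d" using assms(1) unfolding deflation_def by blast
  note c = conf_eqs[OF l]
  have "l = hzero E (src E l) (tgt E l)"
    using monic_zeroD[OF assms(2), of l] c by simp
  then have "idt E (tgt E l) \<cdot> l = hzero E (src E l) (tgt E l)" using c by simp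
  then obtain u where u: "u \<in> arr E" "tgt E u = tgt E l" "src E u = tgt E d" "u \<cdot> d = idt E (tgt E l)"
    using conf_colift[OF l, of "idt E (tgt E l)"] c by auto
  have "d \<cdot> u = idt E (tgt E d)"
    by (rule epicD[OF conf_epic[OF l]]) (use c u in auto)
  then show ?thesis using c u by (intro is_isoI[of d u]) auto
qed

text \<open>Exactness speaks of some factorization \<open>f = i \<cdot> d\<close> with
  \<open>i\<close> a kernel of \<open>g\<close>. If \<open>f\<close> is monic then so is
  \<open>d\<close>, which is therefore invertible, and \<open>f\<close> itself is a kernel.\<close>

lemma inflation_im_kernel:
  assumes "im_eq_ker E f g" "inflation E f" shows "is_kernel E g f"
proof -
  obtain i d where *: "deflation E d" "inflation E i" "tgt E d = src E i" "f = i \<cdot> d" "is_kernel E g i"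
    using assms(1) unfolding im_eq_ker_def by blast
  note a = deflation_arr[OF *(1)] inflation_arr[OF *(2)] and k = kernel_eqs[OF *(5)]
  have f: "monic f" using inflation_monic[OF assms(2)] .
  have "monic d" unfolding monic_def
  proof (intro conjI ballI impI)
    fix u v assume **: "u \<in> arr E" "v \<in> arr E" "tgt E u = src E d" "tgt E v = src E d"
      "src E u = src E v" "d \<cdot> u = d \<cdot> v"
    show "u = v" by (rule monicD[OF f]) (use * ** a in auto)
  qed (fact a)
  then obtain e where e: "e \<in> arr E" "src E e = tgt E d" "tgt E e = src E d" "d \<cdot> e = idt E (tgt E d)"
    using is_isoE[OF monic_deflation_iso[OF *(1)]] by metis
  show ?thesis
  proof (rule kernelI[OF f])
    show "g \<cdot> f = hzero E (src E f) (tgt E g)" using * a k cmp_reduce[OF k(4), of d] by simp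
    fix h assume h: "h \<in> arr E" "tgt E h = src E g" "g \<cdot> h = hzero E (src E h) (tgt E g)"
    obtain w where w: "w \<in> arr E" "src E w = src E h" "tgt E w = src E i" "i \<cdot> w = h"
      using kernel_lift[OF *(5) h] .
    show "\<exists>u. u \<in> arr E \<and> src E u = src E h \<and> tgt E u = src E f \<and> f \<cdot> u = h"
      by (rule exI[of _ "e \<cdot> w"]) (use w e * a cmp_reduce[OF e(4), of w] in simp)
  qed (use * a k in auto)
qed

lemma inflation_admissible: "inflation E i \<Longrightarrow> admissible E i"
  unfolding admissible_def using idt_deflation[of "src E i"] inflation_arr
  by (intro exI[of _ i] exI[of _ "idt E (src E i)"]) simp

lemma deflation_admissible: "deflation E p \<Longrightarrow> admissible E p"
  unfolding admissible_def using idt_inflation[of "tgt E p"] deflation_arr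
  by (intro exI[of _ p] exI[of _ "idt E (tgt E p)"]) simp

lemma conf_inflation: "conf i p \<Longrightarrow> inflation E i" and conf_deflation: "conf i p \<Longrightarrow> deflation E p"
  by (auto simp: inflation_def deflation_def)

lemma im_eq_kerI: "\<lbrakk>deflation E d; conf i g; tgt E d = src E i\<rbrakk> \<Longrightarrow> im_eq_ker E (i \<cdot> d) g"
  unfolding im_eq_ker_def using conf_inflation conf_kernel by blast

lemma im_eq_ker_conf: "conf i g \<Longrightarrow> im_eq_ker E i g"
  using im_eq_kerI[OF idt_deflation, of "src E i" i g] conf_eqs[of i g] by simp

lemma im_eq_ker_zero: 
  assumes "im_eq_ker E f g" shows "g \<cdot> f = hzero E (src E f) (tgt E g)"
    "f \<in> arr E" "g \<in> arr E" "tgt E f = src E g"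
proof -
  obtain i d where *: "deflation E d" "inflation E i" "tgt E d = src E i" "f = i \<cdot> d" "is_kernel E g i"
    using assms(1) unfolding im_eq_ker_def by blast
  note a = deflation_arr[OF *(1)] inflation_arr[OF *(2)] and k = kernel_eqs[OF *(5)]
  show "g \<cdot> f = hzero E (src E f) (tgt E g)" "f \<in> arr E" "g \<in> arr E" "tgt E f = src E g"
    using * a k cmp_reduce[OF k(4), of d] by simp_all
qed

lemma im_eq_ker_deflationE:
  assumes "im_eq_ker E f g" "deflation E g"
  obtains i d where "deflation E d" "conf i g" "tgt E d = src E i" "f = i \<cdot> d"
  using assms deflation_kernel_conf unfolding im_eq_ker_def by metis

section \<open>Extensions of length one\<close>

lemma extensions_1:
  "fs \<in> extensions E 1 X Y \<longleftrightarrow> (\<exists>i p. fs = [i, p] \<and> conf i p \<and> src E i = Y \<and> tgt E p = X)"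
proof
  assume fs: "fs \<in> extensions E 1 X Y"
  then obtain i p where ip: "fs = [i, p]"
    unfolding extensions_def by (auto simp: length_Suc_conv)
  have "im_eq_ker E i p" "inflation E i" "deflation E p" "src E i = Y" "tgt E p = X"
    using fs unfolding ip extensions_def exact_sequence_def by auto
  then show "\<exists>i p. fs = [i, p] \<and> conf i p \<and> src E i = Y \<and> tgt E p = X"
    using ip inflation_im_kernel deflation_kernel_conf by blast
next
  assume "\<exists>i p. fs = [i, p] \<and> conf i p \<and> src E i = Y \<and> tgt E p = X"
  then obtain i p where ip: "fs = [i, p]" "conf i p" "src E i = Y" "tgt E p = X" by blast
  then show "fs \<in> extensions E 1 X Y"
    using inflation_admissible deflation_admissible conf_inflation conf_deflation im_eq_ker_conf
      conf_eqs[OF ip(2)]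
    unfolding extensions_def exact_sequence_def by (auto simp: less_Suc_eq)
qed

lemma extension_morphism_1:
  assumes "conf i p" "conf i' p'" "src E i = Y" "src E i' = Y" "tgt E p = X" "tgt E p' = X"
  shows "extension_morphism E 1 X Y [i, p] [i', p'] \<longleftrightarrow>
    (\<exists>t. t \<in> arr E \<and> src E t = tgt E i \<and> tgt E t = tgt E i' \<and> t \<cdot> i = i' \<and> p' \<cdot> t = p)" (is "_ \<longleftrightarrow> ?R")
proof
  note c = conf_eqs[OF assms(1)] conf_eqs[OF assms(2)]
  assume "extension_morphism E 1 X Y [i, p] [i', p']"
  then obtain h :: "nat \<Rightarrow> 'b" where h: "h 0 = idt E Y" "h 2 = idt E X"
    and "\<And>k. k \<le> 1 \<Longrightarrow> h k \<in> Hom E (src E ([i, p] ! k)) (src E ([i', p'] ! k)) \<and>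
                h (Suc k) \<in> Hom E (tgt E ([i, p] ! k)) (tgt E ([i', p'] ! k)) \<and>
                h (Suc k) \<cdot> ([i, p] ! k) = ([i', p'] ! k) \<cdot> h k"
    unfolding extension_morphism_def by (auto simp: numeral_2_eq_2)
  from this(3)[of 0] this(3)[of 1] show ?R
    using h c assms by (intro exI[of _ "h 1"]) (auto simp: numeral_2_eq_2)
next
  note c = conf_eqs[OF assms(1)] conf_eqs[OF assms(2)]
  have ob: "X \<in> obj E" "Y \<in> obj E" using src_obj[OF c(1)] tgt_obj[OF c(2)] assms by simp_all
  assume ?R
  then obtain t where t: "t \<in> arr E" "src E t = tgt E i" "tgt E t = tgt E i'" "t \<cdot> i = i'" "p' \<cdot> t = p" by blast
  have "[i, p] \<in> extensions E 1 X Y" "[i', p'] \<in> extensions E 1 X Y"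
    using assms unfolding extensions_1 by auto
  then show "extension_morphism E 1 X Y [i, p] [i', p']"
    unfolding extension_morphism_def
  proof (intro conjI exI[of _ "\<lambda>k. if k = 0 then idt E Y else if k = 1 then t else idt E X"] allI impI)
    fix k :: nat assume "k \<le> 1"
    then have k: "k = 0 \<or> k = 1" by linarith
    show "(if k = 0 then idt E Y else if k = 1 then t else idt E X) \<in> Hom E (src E ([i, p] ! k)) (src E ([i', p'] ! k))"
      using k by (elim disjE) (use c t assms ob in simp_all)
    show "(if Suc k = 0 then idt E Y else if Suc k = 1 then t else idt E X) \<in> Hom E (tgt E ([i, p] ! k)) (tgt E ([i', p'] ! k))"
      using k by (elim disjE) (use c t assms ob in simp_all)
    show "(if Suc k = 0 then idt E Y else if Suc k = 1 then t else idt E X) \<cdot> ([i, p] ! k) = ([i', p'] ! k) \<cdot> (if k = 0 then idt E Y else if k = 1 then t else idt E X)"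
      using k by (elim disjE) (use c t assms ob in simp_all)
  qed simp_all
qed

text \<open>Splitting passes both ways along a morphism \<open>t\<close> of extensions: a section
  \<open>s\<close> moves forward to \<open>t \<cdot> s\<close>, a retraction \<open>r\<close> moves
  back to \<open>r \<cdot> t\<close>. Conversely, if all conflations split, the biproduct maps to
  each of them by the inflation on \<open>Y\<close> and a section on \<open>X\<close>.\<close>

lemma Ext_zero_1_iff:
  assumes "X \<in> obj E" "Y \<in> obj E"
  shows "Ext_zero E 1 X Y \<longleftrightarrow> ext_split X Y"
proof -
  obtain S i p j q where S: "biprod Y X S i p j q" using ex_biprod[OF assms(2,1)] .
  note b = biprod_eqs[OF S]
  have e: "[i, q] \<in> extensions E 1 X Y" unfolding extensions_1 using biprod_conf[OF S] b by auto
  show ?thesis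
  proof
    assume Z: "Ext_zero E 1 X Y"
    define Q where "Q fs \<longleftrightarrow> (\<exists>r s. biprod Y X (tgt E (fs ! 0)) (fs ! 0) r s (fs ! 1))" for fs
    show "ext_split X Y"
    proof (rule ext_splitI[OF assms])
      fix i' p' assume *: "conf i' p'" "src E i' = Y" "tgt E p' = X"
      then have "[i', p'] \<in> extensions E 1 X Y" unfolding extensions_1 by blast
      then have "Q [i', p']"
      proof (rule Ext_zero_invariant[OF Z e])
        show "Q [i, q]" unfolding Q_def using S b by auto
        fix fs gs assume m: "extension_morphism E 1 X Y fs gs"
        then obtain f g f' g' where fg: "fs = [f, g]" "conf f g" "src E f = Y" "tgt E g = X"
          "gs = [f', g']" "conf f' g'" "src E f' = Y" "tgt E g' = X"
          unfolding extension_morphism_def extensions_1 by blast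
        note c = conf_eqs[OF fg(2)] conf_eqs[OF fg(6)]
        obtain t where t: "t \<in> arr E" "src E t = tgt E f" "tgt E t = tgt E f'" "t \<cdot> f = f'" "g' \<cdot> t = g"
          using m fg unfolding fg(1,5) extension_morphism_1[OF fg(2,6,3,7,4,8)] by blast
        show "Q gs" if "Q fs"
        proof -
          obtain r s where "biprod Y X (tgt E f) f r s g" using \<open>Q fs\<close> unfolding Q_def fg by auto
          note b = biprod_eqs[OF this]
          have "t \<cdot> s \<in> arr E" "tgt E (t \<cdot> s) = tgt E f'" "src E (t \<cdot> s) = tgt E g'"
            "g' \<cdot> (t \<cdot> s) = idt E (tgt E g')"
            using b t c fg cmp_reduce[OF t(5), of s] by simp_all
          from section_biprod[OF fg(6) this] obtain r' where
            "biprod (src E f') (tgt E g') (tgt E f') f' r' (t \<cdot> s) g'" .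
          then show ?thesis unfolding Q_def fg by auto
        qed
        show "Q fs" if "Q gs"
        proof -
          obtain r s where "biprod Y X (tgt E f') f' r s g'" using \<open>Q gs\<close> unfolding Q_def fg by auto
          note b = biprod_eqs[OF this]
          have "r \<cdot> t \<in> arr E" "src E (r \<cdot> t) = tgt E f" "tgt E (r \<cdot> t) = src E f"
            "(r \<cdot> t) \<cdot> f = idt E (src E f)"
            using b t c fg by simp_all
          from retraction_biprod[OF fg(2) this] obtain s' where
            "biprod (src E f) (tgt E g) (tgt E f) f (r \<cdot> t) s' g" .
          then show ?thesis unfolding Q_def fg by auto
        qed
      qed
      then show "\<exists>s. s \<in> arr E \<and> src E s = X \<and> tgt E s = tgt E i' \<and> p' \<cdot> s = idt E X"
        unfolding Q_def by (auto simp: biprod_def)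
    qed
  next
    assume sp: "ext_split X Y"
    show "Ext_zero E 1 X Y"
    proof (rule Ext_zero_weakly_initial[OF e])
      fix fs assume "fs \<in> extensions E 1 X Y"
      then obtain f g where fg: "fs = [f, g]" "conf f g" "src E f = Y" "tgt E g = X"
        unfolding extensions_1 by blast
      note c = conf_eqs[OF fg(2)]
      obtain r s where "biprod Y X (tgt E f) f r s g" using ext_splitD[OF sp fg(2-4)] .
      note b' = biprod_eqs[OF this]
      show "extension_morphism E 1 X Y [i, q] fs"
        unfolding fg(1) extension_morphism_1[OF biprod_conf[OF S] fg(2) b(8) fg(3) b(15) fg(4)]
        by (rule exI[of _ "f \<cdot> p \<boxplus> s \<cdot> q"])
          (use b b' c fg cmp_reduce[OF b'(17), of q] cmp_reduce[OF b'(19), of p] in simp)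
    qed
  qed
qed

section \<open>Extensions of length two as splices\<close>

lemma extension_2I:
  assumes "conf f d" "conf j h" "tgt E d = src E j"
  shows "[f, j \<cdot> d, h] \<in> extensions E 2 (tgt E h) (src E f)"
proof -
  note c = conf_eqs[OF assms(1)] conf_eqs[OF assms(2)]
  have adm: "admissible E (j \<cdot> d)"
    unfolding admissible_def using assms conf_inflation conf_deflation by blast
  have f: "im_eq_ker E f (j \<cdot> d)"
    unfolding im_eq_ker_def
  proof (intro exI conjI)
    show "is_kernel E (j \<cdot> d) f"
    proof (rule kernelI[OF conf_monic[OF assms(1)]])
      fix u assume u: "u \<in> arr E" "tgt E u = src E (j \<cdot> d)" "(j \<cdot> d) \<cdot> u = hzero E (src E u) (tgt E (j \<cdot> d))"
      have "d \<cdot> u = hzero E (src E (d \<cdot> u)) (src E j)"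
        by (rule monic_zeroD[OF conf_monic[OF assms(2)]]) (use u c assms in auto)
      then show "\<exists>w. w \<in> arr E \<and> src E w = src E u \<and> tgt E w = src E f \<and> f \<cdot> w = u"
        using conf_lift[OF assms(1), of u] u c assms by (metis src_cmp)
    qed (use c assms in auto)
    show "deflation E (idt E (src E f))" "inflation E f"
      using idt_deflation conf_inflation assms c by auto
  qed (use c in auto)
  show ?thesis
    using f adm im_eq_kerI[OF conf_deflation[OF assms(1)] assms(2,3)] assms c
      inflation_admissible deflation_admissible conf_inflation conf_deflation
    unfolding extensions_def exact_sequence_def by (auto simp: less_Suc_eq numeral_2_eq_2)
qed

text \<open>Converse to splicing: the middle map factors through the kernel \<open>j\<close> of
  \<open>h\<close>, and cancelling the monic \<open>j\<close> shows that \<open>f\<close> is a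
  kernel of the remaining factor \<open>d\<close>.\<close>

lemma extension_2E:
  assumes "fs \<in> extensions E 2 X Y"
  obtains f d j h where "fs = [f, j \<cdot> d, h]" "conf f d" "conf j h" "tgt E d = src E j" "src E f = Y" "tgt E h = X"
proof -
  obtain f g h where fs: "fs = [f, g, h]"
    using assms unfolding extensions_def by (auto simp: length_Suc_conv numeral_2_eq_2)
  have *: "im_eq_ker E f g" "im_eq_ker E g h" "inflation E f" "deflation E h" "src E f = Y" "tgt E h = X"
    using assms unfolding fs extensions_def exact_sequence_def by (auto simp: less_Suc_eq)
  obtain j d where d: "deflation E d" "conf j h" "tgt E d = src E j" "g = j \<cdot> d"
    using im_eq_ker_deflationE[OF *(2,4)] .
  have k: "is_kernel E g f" using inflation_im_kernel * by blast
  note c = conf_eqs[OF d(2)] kernel_eqs[OF k] deflation_arr[OF d(1)]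
  have "is_kernel E d f"
  proof (rule kernelI[OF kernel_monic[OF k]])
    show "d \<cdot> f = hzero E (src E f) (tgt E d)"
      using monic_zeroD[OF conf_monic[OF d(2)], of "d \<cdot> f"] c d by auto
    fix u assume "u \<in> arr E" "tgt E u = src E d" "d \<cdot> u = hzero E (src E u) (tgt E d)"
    then show "\<exists>w. w \<in> arr E \<and> src E w = src E u \<and> tgt E w = src E f \<and> f \<cdot> w = u"
      using kernel_lift[OF k, of u] c d by (metis assoc_cmp cmp_zero src_cmp tgt_cmp src_obj)
  qed (use c d in auto)
  then have "conf f d" using deflation_kernel_conf d by blast
  then show ?thesis using that fs d * by blast
qed

lemma extension_morphism_2:
  assumes "fs = [f, g, h]" "gs = [f', g', h']" "fs \<in> extensions E 2 X Y" "gs \<in> extensions E 2 X Y"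
  shows "extension_morphism E 2 X Y fs gs \<longleftrightarrow>
    (\<exists>s t. s \<in> Hom E (src E g) (src E g') \<and> t \<in> Hom E (src E h) (src E h') \<and>
      s \<cdot> f = f' \<and> t \<cdot> g = g' \<cdot> s \<and> h' \<cdot> t = h)" (is "_ \<longleftrightarrow> ?R")
proof -
  obtain f0 d0 j0 h0 where 0: "fs = [f0, j0 \<cdot> d0, h0]" "conf f0 d0" "conf j0 h0" "tgt E d0 = src E j0" "src E f0 = Y" "tgt E h0 = X"
    using extension_2E[OF assms(3)] .
  obtain f1 d1 j1 h1 where 1: "gs = [f1, j1 \<cdot> d1, h1]" "conf f1 d1" "conf j1 h1" "tgt E d1 = src E j1" "src E f1 = Y" "tgt E h1 = X"
    using extension_2E[OF assms(4)] .
  note c = conf_eqs[OF 0(2)] conf_eqs[OF 0(3)] conf_eqs[OF 1(2)] conf_eqs[OF 1(3)]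
  have e: "f0 = f" "j0 \<cdot> d0 = g" "h0 = h" "f1 = f'" "j1 \<cdot> d1 = g'" "h1 = h'"
    using 0 1 assms by auto
  have a: "f \<in> arr E" "g \<in> arr E" "h \<in> arr E" "f' \<in> arr E" "g' \<in> arr E" "h' \<in> arr E"
    "tgt E f = src E g" "tgt E g = src E h" "tgt E f' = src E g'" "tgt E g' = src E h'"
    "src E f = Y" "tgt E h = X" "src E f' = Y" "tgt E h' = X"
    using 0(4-) 1(4-) c unfolding e[symmetric] by auto
  have ob: "X \<in> obj E" "Y \<in> obj E" using src_obj[OF a(1)] tgt_obj[OF a(3)] a by simp_all
  show ?thesis
  proof
    assume "extension_morphism E 2 X Y fs gs"
    then obtain m :: "nat \<Rightarrow> 'b" where h: "m 0 = idt E Y" "m 3 = idt E X"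
      and "\<And>k. k \<le> 2 \<Longrightarrow> m k \<in> Hom E (src E (fs ! k)) (src E (gs ! k)) \<and>
                  m (Suc k) \<in> Hom E (tgt E (fs ! k)) (tgt E (gs ! k)) \<and>
                  m (Suc k) \<cdot> (fs ! k) = (gs ! k) \<cdot> m k"
      unfolding extension_morphism_def by (auto simp: numeral_2_eq_2 numeral_3_eq_3)
    note m = this(3)
    have "m 1 \<in> Hom E (src E g) (src E g')" "m 1 \<cdot> f = f'"
      using m[of 0] h a assms(1,2) by simp_all
    moreover have "m 2 \<in> Hom E (src E h) (src E h')" "m 2 \<cdot> g = g' \<cdot> m 1"
      using m[of 1] a assms(1,2) by (simp_all add: numeral_2_eq_2)
    moreover have "h' \<cdot> m 2 = h"
    proof -
      have "m (Suc 2) \<cdot> (fs ! 2) = (gs ! 2) \<cdot> m 2" using m[of 2] by blast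
      then have "h' \<cdot> m 2 = m 3 \<cdot> h" using assms(1,2) by (simp add: numeral_3_eq_3 numeral_2_eq_2)
      then show ?thesis using h a by simp
    qed
    ultimately show ?R by blast
  next
    assume ?R
    then obtain s t where "s \<in> Hom E (src E g) (src E g')" "t \<in> Hom E (src E h) (src E h')"
      "s \<cdot> f = f'" "t \<cdot> g = g' \<cdot> s" "h' \<cdot> t = h" by blast
    then show "extension_morphism E 2 X Y fs gs"
      unfolding extension_morphism_def
    proof (intro conjI assms(3,4) exI[of _ "\<lambda>k. if k = 0 then idt E Y else if k = 1 then s else if k = 2 then t else idt E X"] allI impI)
      assume R: "s \<in> Hom E (src E g) (src E g')" "t \<in> Hom E (src E h) (src E h')"
        "s \<cdot> f = f'" "t \<cdot> g = g' \<cdot> s" "h' \<cdot> t = h"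
      let ?m = "\<lambda>k::nat. if k = 0 then idt E Y else if k = 1 then s else if k = 2 then t else idt E X"
      fix k :: nat assume "k \<le> 2"
      then have k: "k = 0 \<or> k = 1 \<or> k = 2" by linarith
      show "?m k \<in> Hom E (src E (fs ! k)) (src E (gs ! k))"
        using k by (elim disjE) (use a R ob assms(1,2) in simp_all)
      show "?m (Suc k) \<in> Hom E (tgt E (fs ! k)) (tgt E (gs ! k))"
        using k by (elim disjE) (use a R ob assms(1,2) in simp_all)
      show "?m (Suc k) \<cdot> (fs ! k) = (gs ! k) \<cdot> ?m k"
        using k by (elim disjE) (use a R ob assms(1,2) in simp_all)
    qed simp_all
  qed
qed

text \<open>For a syzygy \<open>K \<rightarrowtail> P \<twoheadrightarrow> X\<close>, a 2-extension of \<open>X\<close> by \<open>Y\<close> is trivial iff the map \<open>K \<rightarrow> Z\<close>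
  classifying its right half \<open>Z \<rightarrowtail> A \<twoheadrightarrow> X\<close> lifts to its middle object, modulo maps that factor
  through \<open>P\<close>. This condition is invariant under morphisms of extensions in both directions.\<close>

lemma Ext_zero_2_lift:
  assumes Z: "Ext_zero E 2 X Y"
    and K: "conf k \<pi>" "tgt E \<pi> = X" "tgt E k \<in> projectives E"
    and F: "conf f d" "conf j h" "tgt E d = src E j" "src E f = Y" "tgt E h = X"
  obtains \<phi> \<psi> where "\<phi> \<in> Hom E (tgt E k) (src E h)" "\<psi> \<in> Hom E (src E k) (src E d)"
    "h \<cdot> \<phi> = \<pi>" "(j \<cdot> d) \<cdot> \<psi> = \<phi> \<cdot> k"
proof -
  note ck = conf_eqs[OF K(1)]
  have Y: "Y \<in> obj E" using src_obj[OF conf_eqs(1)[OF F(1)]] F(4) by simp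
  obtain S i p l q where S: "biprod Y (src E k) S i p l q"
    using ex_biprod[OF Y src_obj[OF ck(1)]] .
  note b = biprod_eqs[OF S]
  define Q where "Q fs \<longleftrightarrow> (\<exists>\<phi> \<psi>. \<phi> \<in> Hom E (tgt E k) (src E (fs ! 2)) \<and>
    \<psi> \<in> Hom E (src E k) (src E (fs ! 1)) \<and> (fs ! 2) \<cdot> \<phi> = \<pi> \<and> (fs ! 1) \<cdot> \<psi> = \<phi> \<cdot> k)" for fs
  \<comment> \<open>The zero class, realized over the chosen syzygy: a split conflation from
    \<open>Y\<close> to the syzygy, spliced with \<open>k\<close> and \<open>\<pi>\<close>. Here
    \<open>Q\<close> holds with the identity of the projective and the injection
    \<open>l\<close>.\<close>
  have e: "[i, k \<cdot> q, \<pi>] \<in> extensions E 2 X Y"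
    using extension_2I[OF biprod_conf[OF S] K(1)] b K by simp
  have fs: "[f, j \<cdot> d, h] \<in> extensions E 2 X Y"
    using extension_2I[OF F(1-3)] F by simp
  note cf = conf_eqs[OF F(1)] conf_eqs[OF F(2)]
  have "Q [f, j \<cdot> d, h]"
  proof (rule Ext_zero_invariant[OF Z e fs])
    show "Q [i, k \<cdot> q, \<pi>]"
      unfolding Q_def
      by (rule exI[of _ "idt E (tgt E k)"], rule exI[of _ l]) (use b ck in simp)
    fix y z assume m: "extension_morphism E 2 X Y y z"
    then have yz: "y \<in> extensions E 2 X Y" "z \<in> extensions E 2 X Y"
      unfolding extension_morphism_def by auto
    obtain f0 d0 j0 h0 where 0: "y = [f0, j0 \<cdot> d0, h0]" "conf f0 d0" "conf j0 h0" "tgt E d0 = src E j0" "src E f0 = Y" "tgt E h0 = X"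
      using extension_2E[OF yz(1)] .
    obtain f1 d1 j1 h1 where 1: "z = [f1, j1 \<cdot> d1, h1]" "conf f1 d1" "conf j1 h1" "tgt E d1 = src E j1" "src E f1 = Y" "tgt E h1 = X"
      using extension_2E[OF yz(2)] .
    note c = conf_eqs[OF 0(2)] conf_eqs[OF 0(3)] conf_eqs[OF 1(2)] conf_eqs[OF 1(3)]
    obtain s t where "s \<in> Hom E (src E (j0 \<cdot> d0)) (src E (j1 \<cdot> d1))" "t \<in> Hom E (src E h0) (src E h1)"
      and st: "s \<cdot> f0 = f1" "t \<cdot> j0 \<cdot> d0 = (j1 \<cdot> d1) \<cdot> s" "h1 \<cdot> t = h0"
      using m unfolding extension_morphism_2[OF 0(1) 1(1) yz] by auto
    then have s: "s \<in> arr E" "src E s = tgt E f0" "tgt E s = tgt E f1"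
      and t: "t \<in> arr E" "src E t = tgt E j0" "tgt E t = tgt E j1"
      using c 0 1 by simp_all
    have st2: "t \<cdot> j0 \<cdot> d0 = j1 \<cdot> d1 \<cdot> s" using st(2) s c 1 by simp
    show "Q z" if "Q y"
    proof -
      obtain \<phi> \<psi> where phi: "\<phi> \<in> arr E" "src E \<phi> = tgt E k" "tgt E \<phi> = tgt E j0"
        and psi: "\<psi> \<in> arr E" "src E \<psi> = src E k" "tgt E \<psi> = tgt E f0"
        and eq: "h0 \<cdot> \<phi> = \<pi>" "j0 \<cdot> d0 \<cdot> \<psi> = \<phi> \<cdot> k"
        using \<open>Q y\<close> c 0(2-4) unfolding Q_def 0(1) by (auto simp: numeral_2_eq_2)
      have "h1 \<cdot> t \<cdot> \<phi> = \<pi>" using cmp_reduce[OF st(3), of \<phi>] s t phi c 1 eq by simp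
      moreover have "(j1 \<cdot> d1) \<cdot> s \<cdot> \<psi> = (t \<cdot> j0 \<cdot> d0) \<cdot> \<psi>"
        unfolding st2 using s psi c 1 by simp
      moreover have "(t \<cdot> j0 \<cdot> d0) \<cdot> \<psi> = (t \<cdot> \<phi>) \<cdot> k"
        using t s psi phi c 0 eq ck by simp
      ultimately show ?thesis
        unfolding Q_def 1(1)
        by (intro exI[of _ "t \<cdot> \<phi>"] exI[of _ "s \<cdot> \<psi>"])
          (use c s t phi psi 0 1 ck in \<open>simp add: numeral_2_eq_2\<close>)
    qed
    show "Q y" if "Q z"
    proof -
      obtain \<phi>' \<psi>' where phi': "\<phi>' \<in> arr E" "src E \<phi>' = tgt E k" "tgt E \<phi>' = tgt E j1"
        and psi': "\<psi>' \<in> arr E" "src E \<psi>' = src E k" "tgt E \<psi>' = tgt E f1"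
        and eq: "h1 \<cdot> \<phi>' = \<pi>" "j1 \<cdot> d1 \<cdot> \<psi>' = \<phi>' \<cdot> k"
        using \<open>Q z\<close> c 1(2-4) unfolding Q_def 1(1) by (auto simp: numeral_2_eq_2)
      \<comment> \<open>Against the morphism, \<open>\<phi>'\<close> cannot be transported. A fresh
        lift \<open>\<phi>\<close> of \<open>\<pi>\<close> along \<open>h0\<close> is compared with
        it after applying \<open>t\<close>: the difference lies in the kernel of \<open>h1\<close>,
        and by projectivity it lifts further to a map \<open>v\<close> into the source of
        \<open>d1\<close>.\<close>
      have "\<pi> \<in> arr E" "src E \<pi> = tgt E k" "tgt E \<pi> = tgt E h0" using ck K 0 by auto
      then obtain \<phi> where phi: "\<phi> \<in> arr E" "src E \<phi> = tgt E k" "tgt E \<phi> = tgt E j0" "h0 \<cdot> \<phi> = \<pi>"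
        using K(3) conf_deflation[OF 0(3)] c unfolding projective_iff by metis
      have "h1 \<cdot> (t \<cdot> \<phi> \<boxminus> \<phi>') = hzero E (tgt E k) (tgt E h1)"
        using cmp_reduce[OF st(3), of \<phi>] t phi phi' c 1 eq ck K by simp
      then obtain w where w: "w \<in> arr E" "src E w = tgt E k" "tgt E w = src E j1" "j1 \<cdot> w = t \<cdot> \<phi> \<boxminus> \<phi>'"
        using conf_lift[OF 1(3), of "t \<cdot> \<phi> \<boxminus> \<phi>'"] t phi phi' c by auto
      then obtain v where v: "v \<in> arr E" "src E v = tgt E k" "tgt E v = tgt E f1" "d1 \<cdot> v = w"
        using K(3) conf_deflation[OF 1(2)] c 1 unfolding projective_iff by metis
      have "\<phi>' \<boxplus> j1 \<cdot> w = t \<cdot> \<phi>"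
        unfolding w(4) using t phi phi' add_left_commute[of \<phi>' "t \<cdot> \<phi>" "neg \<phi>'"] by simp
      then have tphi: "t \<cdot> \<phi> = \<phi>' \<boxplus> j1 \<cdot> d1 \<cdot> v" using v by simp
      have "h0 \<cdot> (\<phi> \<cdot> k) = hzero E (src E (\<phi> \<cdot> k)) (tgt E h0)"
        using cmp_reduce[OF phi(4), of k] phi(1-3) ck c K 0 by simp
      then obtain a where a: "a \<in> arr E" "src E a = src E k" "tgt E a = src E j0" "j0 \<cdot> a = \<phi> \<cdot> k"
        using conf_lift[OF 0(3), of "\<phi> \<cdot> k"] phi c ck by auto
      have "h1 \<cdot> (t \<cdot> j0) = hzero E (src E (t \<cdot> j0)) (tgt E h1)"
        using cmp_reduce[OF st(3), of j0] t c 0 1 by simp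
      then obtain g where g: "g \<in> arr E" "src E g = src E j0" "tgt E g = src E j1" "j1 \<cdot> g = t \<cdot> j0"
        using conf_lift[OF 1(3), of "t \<cdot> j0"] t c by auto
      have d: "d1 \<cdot> s = g \<cdot> d0"
      proof (rule monicD[OF conf_monic[OF 1(3)]])
        show "j1 \<cdot> d1 \<cdot> s = j1 \<cdot> g \<cdot> d0"
          unfolding st2[symmetric] using cmp_reduce[OF g(4), of d0] g(1-3) t c 0 1 by simp
      qed (use s g c 0 1 in auto)
      have u: "g \<cdot> a = d1 \<cdot> (\<psi>' \<boxplus> v \<cdot> k)"
      proof (rule monicD[OF conf_monic[OF 1(3)]])
        have "j1 \<cdot> g \<cdot> a = (t \<cdot> \<phi>) \<cdot> k"
          using cmp_reduce[OF g(4), of a] g(1-3) a t phi c ck by simp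
        also have "\<dots> = j1 \<cdot> d1 \<cdot> (\<psi>' \<boxplus> v \<cdot> k)"
          unfolding tphi using phi' psi' v(1-3) c ck 1 eq by simp
        finally show "j1 \<cdot> g \<cdot> a = j1 \<cdot> d1 \<cdot> (\<psi>' \<boxplus> v \<cdot> k)" .
      qed (use g a psi' v c ck 1 in auto)
      \<comment> \<open>The map \<open>s\<close> respects the common kernel \<open>Y\<close>, so the
        square \<open>d1 s = g d0\<close> is a weak pullback. The maps \<open>a\<close> and
        \<open>\<psi>' + v k\<close> agree after \<open>g\<close> and \<open>d1\<close>, which
        yields \<open>\<psi>\<close>.\<close>
      obtain \<psi> where psi: "\<psi> \<in> arr E" "src E \<psi> = src E a" "tgt E \<psi> = tgt E f0" "d0 \<cdot> \<psi> = a"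
      proof (rule same_kernel_lift[OF 0(2) 1(2) s(1) g(1) s(2,3) _ _ st(1) d, of a "\<psi>' \<boxplus> v \<cdot> k"])
      qed (use g a psi' v c ck 0 1 u in auto)
      have "(j0 \<cdot> d0) \<cdot> \<psi> = \<phi> \<cdot> k" using psi a c 0 by simp
      then show ?thesis
        unfolding Q_def 0(1)
        by (intro exI[of _ \<phi>] exI[of _ \<psi>])
          (use c phi psi a 0 in \<open>simp add: numeral_2_eq_2\<close>)
    qed
  qed
  then obtain \<phi> \<psi> where *: "\<phi> \<in> Hom E (tgt E k) (src E h)" "\<psi> \<in> Hom E (src E k) (src E (j \<cdot> d))"
    "h \<cdot> \<phi> = \<pi>" "(j \<cdot> d) \<cdot> \<psi> = \<phi> \<cdot> k" unfolding Q_def by (auto simp: numeral_2_eq_2)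
  show ?thesis by (rule that[OF *(1) _ *(3,4)]) (use * cf F in auto)
qed

text \<open>A projective resolution of length one maps to the right end of every extension.
  Completed on the left by the trivial part with end \<open>Y\<close>, it becomes a weakly initial
  extension.\<close>

lemma Ext_zero_projective_syzygy:
  assumes "n \<ge> 2" "conf k \<pi>" "tgt E k \<in> projectives E" "src E k \<in> projectives E" "Y \<in> obj E"
  shows "Ext_zero E n (tgt E \<pi>) Y"
proof -
  note c = conf_eqs[OF assms(2)]
  \<comment> \<open>Two steps of the comparison theorem: \<open>\<phi>\<close> lifts
    \<open>\<pi>\<close> along \<open>h\<close>, and its restriction to the syzygy lands in the
    kernel of \<open>h\<close>, which is covered by the source of \<open>g\<close>.\<close>
  have comparison: "\<exists>\<phi> \<psi>. \<phi> \<in> Hom E (tgt E k) (src E h) \<and> \<psi> \<in> Hom E (src E k) (src E g) \<and>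
    h \<cdot> \<phi> = \<pi> \<and> g \<cdot> \<psi> = \<phi> \<cdot> k" if gh: "im_eq_ker E g h" "deflation E h" "tgt E h = tgt E \<pi>" for g h
  proof -
    obtain j d where d: "deflation E d" "conf j h" "tgt E d = src E j" "g = j \<cdot> d"
      using im_eq_ker_deflationE[OF gh(1,2)] .
    note ch = conf_eqs[OF d(2)] deflation_arr[OF d(1)]
    have "\<pi> \<in> arr E" "src E \<pi> = tgt E k" "tgt E \<pi> = tgt E h" using c gh by auto
    then obtain \<phi> where phi: "\<phi> \<in> arr E" "src E \<phi> = tgt E k" "tgt E \<phi> = src E h" "h \<cdot> \<phi> = \<pi>"
      using assms(3) gh unfolding projective_iff by metis
    have "h \<cdot> (\<phi> \<cdot> k) = hzero E (src E (\<phi> \<cdot> k)) (tgt E h)"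
      using cmp_reduce[OF phi(4), of k] phi(1-3) c ch gh by simp
    then obtain a where a: "a \<in> arr E" "src E a = src E k" "tgt E a = src E j" "j \<cdot> a = \<phi> \<cdot> k"
      using conf_lift[OF d(2), of "\<phi> \<cdot> k"] phi c ch by auto
    then obtain \<psi> where psi: "\<psi> \<in> arr E" "src E \<psi> = src E k" "tgt E \<psi> = src E d" "d \<cdot> \<psi> = a"
      using assms(4) d unfolding projective_iff by metis
    show ?thesis
      by (intro exI[of _ \<phi>] exI[of _ \<psi>]) (use phi psi a ch d in simp)
  qed
  show ?thesis
  proof (cases "n = 2")
    case True
    \<comment> \<open>In length two, \<open>Y\<close> and the syzygy have to share one object, hence
      the biproduct; from length three on they sit at different places.\<close>
    obtain S i p l q where S: "biprod Y (src E k) S i p l q"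
      using ex_biprod[OF assms(5) src_obj[OF c(1)]] .
    note b = biprod_eqs[OF S]
    have e: "[i, k \<cdot> q, \<pi>] \<in> extensions E 2 (tgt E \<pi>) Y"
      using extension_2I[OF biprod_conf[OF S] assms(2)] b by simp
    show ?thesis unfolding True
    proof (rule Ext_zero_weakly_initial[OF e])
      fix fs assume fs: "fs \<in> extensions E 2 (tgt E \<pi>) Y"
      obtain f d j h where 0: "fs = [f, j \<cdot> d, h]" "conf f d" "conf j h" "tgt E d = src E j"
        "src E f = Y" "tgt E h = tgt E \<pi>"
        using extension_2E[OF fs] .
      note cf = conf_eqs[OF 0(2)] conf_eqs[OF 0(3)]
      obtain \<phi> \<psi> where "\<phi> \<in> Hom E (tgt E k) (src E h)" "\<psi> \<in> Hom E (src E k) (src E (j \<cdot> d))"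
        and eq: "h \<cdot> \<phi> = \<pi>" "(j \<cdot> d) \<cdot> \<psi> = \<phi> \<cdot> k"
        using comparison[OF im_eq_kerI[OF conf_deflation[OF 0(2)] 0(3,4)] conf_deflation[OF 0(3)] 0(6)]
        by blast
      then have phi: "\<phi> \<in> arr E" "src E \<phi> = tgt E k" "tgt E \<phi> = tgt E j"
        and psi: "\<psi> \<in> arr E" "src E \<psi> = src E k" "tgt E \<psi> = tgt E f"
        using cf 0 by simp_all
      have "(j \<cdot> d) \<cdot> (f \<cdot> p \<boxplus> \<psi> \<cdot> q) = (j \<cdot> d \<cdot> f) \<cdot> p \<boxplus> ((j \<cdot> d) \<cdot> \<psi>) \<cdot> q"
        using cf(1-3,5-7) 0(2-) phi psi b(1-15) by simp
      also have "\<dots> = \<phi> \<cdot> k \<cdot> q" unfolding eq(2) using cf 0(2-) phi psi b c by simp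
      finally have 1: "\<phi> \<cdot> k \<cdot> q = (j \<cdot> d) \<cdot> (f \<cdot> p \<boxplus> \<psi> \<cdot> q)" by simp
      show "extension_morphism E 2 (tgt E \<pi>) Y [i, k \<cdot> q, \<pi>] fs"
        unfolding extension_morphism_2[OF refl 0(1) e fs]
      proof (rule exI[of _ "f \<cdot> p \<boxplus> \<psi> \<cdot> q"], rule exI[of _ \<phi>], intro conjI 1 eq(1))
        show "(f \<cdot> p \<boxplus> \<psi> \<cdot> q) \<cdot> i = f" using cf 0(2-) phi psi b by simp
      qed (use cf 0(2-) phi psi b c in simp_all)
    qed
  next
    case False
    then have n: "n \<ge> 3" using assms(1) by simp
    then have [simp]: "\<not> n - Suc 0 \<le> Suc 0" "n - Suc 0 \<noteq> n" "n \<noteq> n - Suc 0" "\<not> n < n - Suc 0"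
      "Suc (n - Suc 0) = n" "Suc 0 < n - Suc 0" "n \<noteq> 0" "n \<noteq> Suc 0" "\<not> n \<le> Suc 0"
      "Suc n \<noteq> n - Suc 0" "\<not> Suc n < n - Suc 0" by auto
    obtain Z where Z: "zero_obj Z" using ex_zero_obj .
    note Zo = zero_obj_obj[OF Z]
    \<comment> \<open>The objects of the resolution padded to length \<open>n\<close>:
      \<open>Y\<close>, \<open>Y\<close>, zeros, then the syzygy at index \<open>n - 1\<close>, the
      projective at \<open>n\<close>, and the end term at \<open>n + 1\<close>. For
      \<open>n = 3\<close> there are no zeros in between. The repeated \<open>Y\<close> makes the
      first map an identity.\<close>
    define ob where "ob m = (if m \<le> 1 then Y else if m < n - 1 then Z else if m = n - 1 then src E k
      else if m = n then tgt E k else tgt E \<pi>)" for m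
    define e where "e m = (if m = 0 then idt E Y else if m < n - 1 then hzero E (ob m) (ob (Suc m))
      else if m = n - 1 then k else \<pi>)" for m
    have ob: "ob m \<in> obj E" for m unfolding ob_def using Zo assms(5) c by simp
    have e: "e m \<in> arr E \<and> src E (e m) = ob m \<and> tgt E (e m) = ob (Suc m)" if m: "m \<le> n" for m
    proof -
      consider "m = 0" | "0 < m" "m < n - 1" | "m = n - 1" | "m = n" using m by linarith
      then show ?thesis
      proof cases
        case 1 then show ?thesis using assms(5) by (simp add: e_def ob_def)
      next
        case 2 then show ?thesis using ob[of m] ob[of "Suc m"] by (simp add: e_def)
      next
        case 3 then show ?thesis using n c by (simp add: e_def ob_def)
      next
        case 4 then show ?thesis using n c by (simp add: e_def ob_def)
      qed
    qed
    have z_mono: "monic (hzero E Z B)" and z_infl: "inflation E (hzero E Z B)" if "B \<in> obj E" for B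
      using conf_zero_idt[OF Z that] conf_monic conf_inflation by blast+
    have z_defl: "deflation E (hzero E B Z)" if "B \<in> obj E" for B
      using conf_idt_zero[OF Z that] conf_deflation by blast
    have zero_adm: "admissible E (hzero E A B)" if "A \<in> obj E" "B \<in> obj E" for A B
      unfolding admissible_def
      by (rule exI[of _ "hzero E Z B"], rule exI[of _ "hzero E A Z"])
        (use that Zo z_infl z_defl in auto)
    \<comment> \<open>The image of a zero map is a zero object, and this is the kernel of any monic.
      It covers the zero maps of the padding, including the last one, which is followed by
      \<open>k\<close>.\<close>
    have zero_im: "im_eq_ker E (hzero E A (src E g)) g" if "A \<in> obj E" "monic g" for A g
      unfolding im_eq_ker_def
    proof (rule exI[of _ "hzero E Z (src E g)"], rule exI[of _ "hzero E A Z"], intro conjI)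
      have g: "g \<in> arr E" using that unfolding monic_def by simp
      show "is_kernel E g (hzero E Z (src E g))"
      proof (rule kernelI[OF z_mono])
        fix h assume h: "h \<in> arr E" "tgt E h = src E g" "g \<cdot> h = hzero E (src E h) (tgt E g)"
        then have "h = hzero E (src E h) (src E g)" using monic_zeroD[OF that(2)] by simp
        then show "\<exists>u. u \<in> arr E \<and> src E u = src E h \<and> tgt E u = src E (hzero E Z (src E g)) \<and> hzero E Z (src E g) \<cdot> u = h"
          using h g Zo by (intro exI[of _ "hzero E (src E h) Z"]) simp
      qed (use g Zo in auto)
      show "deflation E (hzero E A Z)" "inflation E (hzero E Z (src E g))"
        "tgt E (hzero E A Z) = src E (hzero E Z (src E g))"
        "hzero E A (src E g) = hzero E Z (src E g) \<cdot> hzero E A Z"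
        using z_defl z_infl that g Zo by auto
    qed
    have adm: "admissible E (e m)" if m: "m \<le> n" for m
    proof -
      consider "m = 0" | "0 < m" "m < n - 1" | "m = n - 1" | "m = n" using m by linarith
      then show ?thesis
      proof cases
        case 1 then show ?thesis using inflation_admissible[OF idt_inflation[OF assms(5)]] by (simp add: e_def)
      next
        case 2 then show ?thesis using zero_adm ob by (simp add: e_def)
      next
        case 3 then show ?thesis using n inflation_admissible[OF conf_inflation[OF assms(2)]] by (simp add: e_def)
      next
        case 4 then show ?thesis using n deflation_admissible[OF conf_deflation[OF assms(2)]] by (simp add: e_def)
      qed
    qed
    have im: "im_eq_ker E (e m) (e (Suc m))" if m: "m < n" for m
    proof -
      consider "m = 0" | "0 < m" "m < n - 1" | "m = n - 1" using m by linarith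
      then show ?thesis
      proof cases
        case 1
        have "is_kernel E (hzero E Y (ob 2)) (idt E Y)"
        proof (rule kernelI[OF inflation_monic[OF idt_inflation[OF assms(5)]]])
        qed (use assms(5) ob[of 2] in auto)
        then have "im_eq_ker E (idt E Y) (hzero E Y (ob 2))"
          unfolding im_eq_ker_def using idt_deflation idt_inflation assms(5)
          by (intro exI[of _ "idt E Y"]) simp
        then show ?thesis using 1 n by (simp add: e_def ob_def numeral_2_eq_2)
      next
        case 2
        have "monic (e (Suc m))"
        proof (cases "Suc m < n - 1")
          case True
          then have "e (Suc m) = hzero E Z (ob (Suc (Suc m)))" using 2 by (simp add: e_def ob_def)
          then show ?thesis using z_mono ob by simp
        next
          case False
          then have "e (Suc m) = k" using 2 by (simp add: e_def)
          then show ?thesis using conf_monic assms(2) by simp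
        qed
        then have "im_eq_ker E (hzero E (ob m) (src E (e (Suc m)))) (e (Suc m))" using zero_im ob by simp
        moreover have "src E (e (Suc m)) = ob (Suc m)" using e[of "Suc m"] 2 by simp
        ultimately show ?thesis using 2 by (simp add: e_def[of m])
      next
        case 3 then show ?thesis using n im_eq_ker_conf[OF assms(2)] by (simp add: e_def)
      qed
    qed
    let ?es = "map e [0..<Suc n]"
    have len: "length ?es = Suc n" by simp
    have nth: "?es ! m = e m" if "m \<le> n" for m using that by (simp del: upt_Suc)
    have es: "?es \<in> extensions E n (tgt E \<pi>) Y"
      unfolding extensions_def exact_sequence_def
    proof (intro CollectI conjI ballI allI impI)
      fix f assume "f \<in> set ?es"
      then show "admissible E f" using adm by auto
    next
      fix m assume "Suc m < length ?es"
      then have m: "m < n" by simp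
      show "tgt E (?es ! m) = src E (?es ! Suc m)" using nth[of m] nth[of "Suc m"] m e[of m] e[of "Suc m"] by simp
      show "im_eq_ker E (?es ! m) (?es ! Suc m)" using nth[of m] nth[of "Suc m"] m im[of m] by simp
    next
      have hd: "hd ?es = idt E Y" by (simp add: hd_map e_def upt_conv_Cons del: upt_Suc)
      have last: "last ?es = \<pi>" using n by (simp add: e_def)
      show "inflation E (hd ?es)" "src E (hd ?es) = Y" unfolding hd using idt_inflation assms(5) by auto
      show "deflation E (last ?es)" "tgt E (last ?es) = tgt E \<pi>" unfolding last using conf_deflation assms(2) by auto
    qed (rule len)
    show ?thesis
    proof (rule Ext_zero_weakly_initial[OF es])
      fix fs assume fs: "fs \<in> extensions E n (tgt E \<pi>) Y"
      then have lfs: "length fs = Suc n" and ex: "exact_sequence E fs"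
        and "inflation E (hd fs)" "deflation E (last fs)" "src E (hd fs) = Y" "tgt E (last fs) = tgt E \<pi>"
        unfolding extensions_def by auto
      moreover have "fs \<noteq> []" using lfs by auto
      ultimately have ends: "src E (fs ! 0) = Y" "deflation E (fs ! n)" "tgt E (fs ! n) = tgt E \<pi>"
        using hd_conv_nth[of fs] last_conv_nth[of fs] by auto
      have imf: "im_eq_ker E (fs ! m) (fs ! Suc m)" if "m < n" for m
        using ex that lfs unfolding exact_sequence_def by simp
      note imz = im_eq_ker_zero[OF imf]
      have fa: "fs ! m \<in> arr E" if "m \<le> n" for m
        using imz(2)[of m] deflation_arr[OF ends(2)] that by (cases "m = n") auto
      have sn: "Suc (n - 1) = n" using n by simp
      obtain \<phi> \<psi> where phi: "\<phi> \<in> arr E" "src E \<phi> = tgt E k" "tgt E \<phi> = src E (fs ! n)"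
        and psi: "\<psi> \<in> arr E" "src E \<psi> = src E k" "tgt E \<psi> = src E (fs ! (n - 1))"
        and eq: "fs ! n \<cdot> \<phi> = \<pi>" "fs ! (n - 1) \<cdot> \<psi> = \<phi> \<cdot> k"
        using comparison[OF imf[of "n - 1"]] ends n unfolding sn by auto
      \<comment> \<open>The identity at the end \<open>Y\<close> and the identity as first map of
        the padded sequence force \<open>fs ! 0\<close> at index \<open>1\<close>. The comparison
        maps occupy \<open>n - 1\<close> and \<open>n\<close>; everything between starts at a zero
        object.\<close>
      define h where "h m = (if m = 0 then idt E Y else if m = 1 then fs ! 0
        else if m < n - 1 then hzero E Z (src E (fs ! m)) else if m = n - 1 then \<psi>
        else if m = n then \<phi> else idt E (tgt E \<pi>))" for m
      have h1: "h m \<in> arr E \<and> src E (h m) = ob m \<and> tgt E (h m) = src E (fs ! m)" if m: "m \<le> n" for m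
      proof -
        consider "m = 0" | "m = 1" | "1 < m" "m < n - 1" | "m = n - 1" "m \<noteq> 1" "m \<noteq> 0" | "m = n" "m \<noteq> n - 1" using m n by linarith
        then show ?thesis
        proof cases
          case 1 then show ?thesis using ends assms(5) by (simp add: h_def ob_def)
        next
          case 2 then show ?thesis using ends fa[of 0] imz(4)[of 0] n by (simp add: h_def ob_def)
        next
          case 3 then show ?thesis using Zo fa[of m] by (simp add: h_def ob_def)
        next
          case 4 then show ?thesis using n psi by (simp add: h_def ob_def)
        next
          case 5 then show ?thesis using n phi by (simp add: h_def ob_def)
        qed
      qed
      have h2: "h (Suc n) = idt E (tgt E \<pi>)" using n by (simp add: h_def)
      have h3: "h (Suc m) \<in> arr E \<and> src E (h (Suc m)) = ob (Suc m) \<and> tgt E (h (Suc m)) = tgt E (fs ! m)" if "m \<le> n" for m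
      proof (cases "m = n")
        case True then show ?thesis using h2 ends c n by (simp add: ob_def)
      next
        case False then show ?thesis using h1[of "Suc m"] imz(4)[of m] that by simp
      qed
      have sq: "h (Suc m) \<cdot> e m = (fs ! m) \<cdot> h m" if m: "m \<le> n" for m
      proof -
        consider "m = 0" | "m = 1" | "1 < m" "m < n - 1" | "m = n - 1" "m \<noteq> 1" "m \<noteq> 0" | "m = n" "m \<noteq> n - 1" using m n by linarith
        then show ?thesis
        proof cases
          case 1
          have "fs ! 0 \<cdot> idt E Y = fs ! 0" using fa[of 0] ends by simp
          then show ?thesis using 1 by (simp add: h_def e_def)
        next
          case 2
          \<comment> \<open>This square commutes because \<open>fs ! 1\<close> kills
            \<open>fs ! 0\<close>. The argument is uniform in \<open>h 2\<close>, which is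
            \<open>\<psi>\<close> for \<open>n = 3\<close> and a zero map for larger
            \<open>n\<close>.\<close>
          have "h (Suc 1) \<cdot> hzero E (ob 1) (ob 2) = hzero E (ob 1) (tgt E (fs ! 1))"
            using h3[of 1] ob[of 1] n cmp_zero[of "h (Suc 1)" "ob 1" "ob 2"] by (simp add: numeral_2_eq_2)
          also have "\<dots> = fs ! 1 \<cdot> fs ! 0" using imz(1)[of 0] ends n by (simp add: ob_def)
          finally show ?thesis using 2 n h_def[of "Suc 0"] by (simp add: e_def numeral_2_eq_2)
        next
          case 3
          have "h (Suc m) \<cdot> e m = hzero E (ob m) (tgt E (fs ! m))"
            using 3 h3[of m] ob[of m] cmp_zero[of "h (Suc m)" "ob m" "ob (Suc m)"] by (simp add: e_def)
          also have "\<dots> = fs ! m \<cdot> h m" using 3 Zo fa[of m] by (simp add: h_def ob_def)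
          finally show ?thesis .
        next
          case 4
          then show ?thesis using n eq(2) by (simp add: e_def h_def)
        next
          case 5
          then show ?thesis using n eq(1) c by (simp add: e_def h_def)
        qed
      qed
      show "extension_morphism E n (tgt E \<pi>) Y ?es fs"
        unfolding extension_morphism_def
      proof (intro conjI es fs exI[of _ h] allI impI)
        show "h 0 = idt E Y" by (simp add: h_def)
        show "h (Suc n) = idt E (tgt E \<pi>)" by (fact h2)
        fix m assume m: "m \<le> n"
        show "h m \<in> Hom E (src E (?es ! m)) (src E (fs ! m))" using h1[OF m] e[OF m] unfolding nth[OF m] by simp
        show "h (Suc m) \<in> Hom E (tgt E (?es ! m)) (tgt E (fs ! m))" using h3[OF m] e[OF m] unfolding nth[OF m] by simp
        show "h (Suc m) \<cdot> (?es ! m) = (fs ! m) \<cdot> h m" using sq[OF m] unfolding nth[OF m] .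
      qed
    qed
  qed
qed

section \<open>Subcategories\<close>

text \<open>The factorization of \<open>h\<close> through \<open>f\<close> is assembled from its
  components as the sum of the \<open>i k \<cdot> u k\<close>.\<close>

lemma direct_sum_coinduced:
  assumes "direct_sum E Xs S i p"
    and "\<And>k. k < length Xs \<Longrightarrow> u k \<in> Hom E W (Xs ! k)"
    and "f \<in> Hom E V W" "h \<in> Hom E V S" "W \<in> obj E"
    and "\<And>k. k < length Xs \<Longrightarrow> u k \<cdot> f = p k \<cdot> h"
  obtains v where "v \<in> Hom E W S" "v \<cdot> f = h"
proof -
  have d: "S \<in> obj E" "set Xs \<subseteq> obj E"
    "\<And>k. k < length Xs \<Longrightarrow> i k \<in> Hom E (Xs ! k) S \<and> p k \<in> Hom E S (Xs ! k)"
    "(\<Otimes>\<^bsub>hom_group E S S\<^esub>k\<in>{..<length Xs}. i k \<cdot> p k) = idt E S"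
    using assms(1) unfolding direct_sum_def by auto
  interpret GS: comm_group "hom_group E S S" using hom_comm_group d by simp
  interpret GW: comm_group "hom_group E W S" using hom_comm_group d assms(5) by simp
  have "(\<Otimes>\<^bsub>hom_group E W S\<^esub>k\<in>A. i k \<cdot> u k) \<cdot> f = (\<Otimes>\<^bsub>hom_group E S S\<^esub>k\<in>A. i k \<cdot> p k) \<cdot> h \<and>
      (\<Otimes>\<^bsub>hom_group E W S\<^esub>k\<in>A. i k \<cdot> u k) \<in> Hom E W S \<and>
      (\<Otimes>\<^bsub>hom_group E S S\<^esub>k\<in>A. i k \<cdot> p k) \<in> Hom E S S"
    if "A \<subseteq> {..<length Xs}" for A
    using finite_subset[OF that finite_lessThan] that
  proof (induction A rule: finite_induct)
    case empty
    then show ?case using d assms(3-5) by simp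
  next
    case (insert k A)
    have k: "(\<lambda>k. i k \<cdot> u k) \<in> insert k A \<rightarrow> carrier (hom_group E W S)"
      "(\<lambda>k. i k \<cdot> p k) \<in> insert k A \<rightarrow> carrier (hom_group E S S)"
      using insert.prems d(3) assms(2) by (auto simp: Pi_def subset_iff)
    have "(i k \<cdot> u k) \<cdot> f = (i k \<cdot> p k) \<cdot> h"
      using insert.prems d(3)[of k] assms(2)[of k] assms(3,4) assms(6)[of k] by auto
    moreover have "i k \<cdot> u k \<in> Hom E W S" "i k \<cdot> p k \<in> Hom E S S" using k by auto
    moreover have "(\<Otimes>\<^bsub>hom_group E W S\<^esub>k\<in>insert k A. i k \<cdot> u k) =
        i k \<cdot> u k \<boxplus> (\<Otimes>\<^bsub>hom_group E W S\<^esub>k\<in>A. i k \<cdot> u k)"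
      "(\<Otimes>\<^bsub>hom_group E S S\<^esub>k\<in>insert k A. i k \<cdot> p k) =
        i k \<cdot> p k \<boxplus> (\<Otimes>\<^bsub>hom_group E S S\<^esub>k\<in>A. i k \<cdot> p k)"
      using GW.finprod_insert[of A k "\<lambda>k. i k \<cdot> u k"] GS.finprod_insert[of A k "\<lambda>k. i k \<cdot> p k"]
        insert.hyps k by (simp_all add: Pi_def)
    ultimately show ?case using insert.IH insert.prems assms(3,4) by (simp del: assoc_cmp)
  qed
  from this[of "{..<length Xs}"] show ?thesis using that d(4) assms(4) by auto
qed

lemma exact_sequence_conf:
  assumes "conf f g" shows "exact_sequence E [f, g]"
  using assms inflation_admissible deflation_admissible conf_inflation conf_deflation im_eq_ker_conf
    conf_eqs[OF assms]
  unfolding exact_sequence_def by (auto simp: less_Suc_eq)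

lemma exact_sequence_pairE:
  assumes "exact_sequence E [f, g]" "deflation E g"
  obtains i d where "deflation E d" "conf i g" "tgt E d = src E i" "f = i \<cdot> d"
proof -
  have "im_eq_ker E f g" using assms(1) unfolding exact_sequence_def by auto
  then show ?thesis using im_eq_ker_deflationE[OF _ assms(2)] that by blast
qed

lemma conflation_on_iff:
  "conflation_on E X Y Z i p \<longleftrightarrow> conf i p \<and> src E i = X \<and> tgt E i = Y \<and> tgt E p = Z"
  unfolding conflation_on_def using conf_eqs[of i p] by auto

lemma Fac_iff: "X \<in> Fac E \<T> \<longleftrightarrow> (\<exists>d. deflation E d \<and> src E d \<in> \<T> \<and> tgt E d = X)"
proof
  assume "X \<in> Fac E \<T>"
  then show "\<exists>d. deflation E d \<and> src E d \<in> \<T> \<and> tgt E d = X" unfolding Fac_def by auto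
next
  assume "\<exists>d. deflation E d \<and> src E d \<in> \<T> \<and> tgt E d = X"
  then obtain d where d: "deflation E d" "src E d \<in> \<T>" "tgt E d = X" by blast
  then have "d \<in> Hom E (src E d) X" "X \<in> obj E" using deflation_arr by auto
  then show "X \<in> Fac E \<T>" using d unfolding Fac_def by blast
qed

lemma Fac_obj: "Fac E \<T> \<subseteq> obj E"
  unfolding Fac_def by blast

lemma subset_Fac: "\<T> \<subseteq> obj E \<Longrightarrow> \<T> \<subseteq> Fac E \<T>"
  unfolding Fac_iff subset_iff using idt_deflation by (metis src_idt tgt_idt)

lemma Fac_mono: "\<T> \<subseteq> \<T>' \<Longrightarrow> Fac E \<T> \<subseteq> Fac E \<T>'"
  unfolding Fac_def by blast

lemma Fac_Fac: "Fac E (Fac E \<T>) \<subseteq> Fac E \<T>"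
proof
  fix X assume "X \<in> Fac E (Fac E \<T>)"
  then obtain d e where "deflation E d" "tgt E d = X" "deflation E e" "tgt E e = src E d" "src E e \<in> \<T>"
    unfolding Fac_iff by metis
  then show "X \<in> Fac E \<T>" unfolding Fac_iff
    using deflation_cmp deflation_arr by (intro exI[of _ "d \<cdot> e"]) simp
qed

lemma subcategory_Fac: "subcategory E (Fac E \<T>)"
  unfolding subcategory_def
proof (intro conjI allI impI)
  fix f assume "is_iso E f \<and> src E f \<in> Fac E \<T>"
  then have "tgt E f \<in> Fac E (Fac E \<T>)" unfolding Fac_iff[of _ "Fac E \<T>"] using iso_deflation by blast
  then show "tgt E f \<in> Fac E \<T>" using Fac_Fac by blast
qed (rule Fac_obj)

lemma left_perp1_iff:
  assumes "\<D> \<subseteq> obj E"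
  shows "Y \<in> left_perp1 E \<D> \<longleftrightarrow> Y \<in> obj E \<and> (\<forall>X \<in> \<D>. ext_split Y X)"
  using assms Ext_zero_1_iff unfolding left_perp1_def by (auto simp: subset_iff)

lemma left_perp1_retract:
  assumes "\<D> \<subseteq> obj E" "S \<in> left_perp1 E \<D>" "f \<in> Hom E X S" "g \<in> Hom E S X" "g \<cdot> f = idt E X"
  shows "X \<in> left_perp1 E \<D>"
  using assms ext_split_retract[of S _ f g X] unfolding left_perp1_iff[OF assms(1)] by auto

lemma subcategory_left_perp1:
  assumes "\<D> \<subseteq> obj E" shows "subcategory E (left_perp1 E \<D>)"
  unfolding subcategory_def
proof (intro conjI allI impI)
  show "left_perp1 E \<D> \<subseteq> obj E" unfolding left_perp1_def by blast
  fix f assume f: "is_iso E f \<and> src E f \<in> left_perp1 E \<D>"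
  then obtain g where "g \<in> Hom E (tgt E f) (src E f)" "f \<cdot> g = idt E (tgt E f)" "f \<in> Hom E (src E f) (tgt E f)"
    unfolding is_iso_def by auto
  then show "tgt E f \<in> left_perp1 E \<D>" using left_perp1_retract[OF assms, of "src E f" g "tgt E f" f] f by blast
qed

lemma summand_retract:
  assumes "direct_summand E X S"
  obtains f g where "f \<in> Hom E X S" "g \<in> Hom E S X" "g \<cdot> f = idt E X"
  using assms by (elim direct_summandE) (auto simp: biprod_def)

lemma summand_closed_left_perp1:
  assumes "\<D> \<subseteq> obj E" shows "summand_closed E (left_perp1 E \<D>)"
  unfolding summand_closed_def using left_perp1_retract[OF assms] summand_retract by metis

lemma summand_closed_Fac: assumes "Fac E \<D> \<subseteq> \<D>" shows "summand_closed E \<D>"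
  unfolding summand_closed_def
proof (intro ballI allI impI)
  fix S X assume S: "S \<in> \<D>" "direct_summand E X S"
  from S(2) obtain B i p j q where b: "biprod X B S i p j q" by (rule direct_summandE)
  have "deflation E p" "src E p = S" "tgt E p = X" using biprod_deflation(2)[OF b] biprod_eqs[OF b] by auto
  then have "X \<in> Fac E \<D>" unfolding Fac_iff using S(1) by blast
  then show "X \<in> \<D>" using assms by blast
qed

lemma left_perp1_extension:
  assumes "\<D> \<subseteq> obj E" "conf i p" "src E i \<in> left_perp1 E \<D>" "tgt E p \<in> left_perp1 E \<D>"
  shows "tgt E i \<in> left_perp1 E \<D>"
  using assms ext_split_extension[OF assms(2)] conf_eqs[OF assms(2)]
  unfolding left_perp1_iff[OF assms(1)] by auto

lemma left_perp1_projective: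
  assumes "\<D> \<subseteq> obj E" "P \<in> projectives E" shows "P \<in> left_perp1 E \<D>"
  using assms ext_split_projective[OF assms(2)] projective_obj[OF assms(2)]
  unfolding left_perp1_iff[OF assms(1)] by auto

lemma left_perp1_sum:
  assumes "\<D> \<subseteq> obj E" "direct_sum E Xs S i p" "set Xs \<subseteq> left_perp1 E \<D>"
  shows "S \<in> left_perp1 E \<D>"
proof -
  have "S \<in> obj E" using assms(2) unfolding direct_sum_def by blast
  then show ?thesis
    using ext_split_direct_sum[OF assms(2)] assms unfolding left_perp1_iff[OF assms(1)]
    by (auto simp: subset_iff left_perp1_iff[OF assms(1)])
qed

lemma direct_summand_refl:
  assumes "S \<in> obj E" shows "direct_summand E S S"
proof -
  obtain Z where Z: "zero_obj Z" using ex_zero_obj .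
  have "biprod S Z S (idt E S) (idt E S) (hzero E Z S) (hzero E S Z)"
    using assms Z zero_obj_obj[OF Z] unfolding biprod_def zero_obj_def by simp
  then show ?thesis by (rule biprod_summand)
qed

lemma additively_closed_sum:
  assumes "additively_closed E \<T>" "A \<in> \<T>" "B \<in> \<T>" "biprod A B S i p j q"
  shows "S \<in> \<T>"
  using assms biprod_direct_sum[OF assms(4)] direct_summand_refl[of S] biprod_eqs(3)[OF assms(4)]
  unfolding additively_closed_def by (metis empty_set empty_subsetI insert_subset list.simps(15))

text \<open>A map from \<open>src E i\<close> to an object of \<open>\<D>\<close> extends along
  \<open>i\<close>, since the obstruction is an extension of the cokernel by that object.\<close>

lemma left_approximationI_conf:
  assumes "conf i p" "tgt E i \<in> \<D>" "\<And>D. D \<in> \<D> \<Longrightarrow> ext_split (tgt E p) D"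
  shows "left_approximation E \<D> i"
  unfolding left_approximation_def
proof (intro conjI ballI)
  show "i \<in> arr E" using conf_eqs[OF assms(1)] by simp
  fix D g assume D: "D \<in> \<D>" "g \<in> Hom E (src E i) D"
  then obtain h where "h \<in> arr E" "tgt E h = D" "src E h = tgt E i" "h \<cdot> i = g"
    using ext_extend[OF assms(3)[OF D(1)] assms(1) refl, of g] by auto
  then show "\<exists>h\<in>Hom E (tgt E i) D. g = h \<cdot> i" by auto
qed (fact assms)

end

section \<open>Coresolutions obtained from approximations of projectives\<close>

context wic_exact_category
begin

lemma ex_projective_conf:
  assumes "X \<in> obj E"
  obtains k \<pi> where "conf k \<pi>" "tgt E \<pi> = X" "tgt E k \<in> projectives E"
proof -
  obtain P d where d: "P \<in> projectives E" "d \<in> Hom E P X" "deflation E d"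
    using enough_projectives assms unfolding enough_projectives_def by blast
  then obtain k where "conf k d" unfolding deflation_def by blast
  then show ?thesis using that[of k d] d conf_eqs[of k d] by auto
qed

text \<open>A morphism \<open>P \<rightarrow> K \<rightarrow> D\<close> factors through the approximation of \<open>P\<close>, hence \<open>P \<twoheadrightarrow> K\<close> factors
  through its image \<open>I\<close>; push \<open>I \<rightarrowtail> D\<^sub>0\<close> out along \<open>I \<twoheadrightarrow> K\<close>.\<close>

lemma approximation_coresolution:
  assumes app: "left_approximation E \<D> f" and ex: "exact_sequence E [f, g]" "deflation E g"
    and p: "deflation E p" "src E p = src E f" and m: "monic m" "src E m = tgt E p" "tgt E m \<in> \<D>"
  obtains i q where "conf i q" "src E i = tgt E p" "tgt E i \<in> Fac E \<D>" "tgt E q = tgt E g"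
proof -
  obtain j d where d: "deflation E d" "conf j g" "tgt E d = src E j" "f = j \<cdot> d"
    using exact_sequence_pairE[OF ex] .
  obtain l where l: "conf l d" using d(1) unfolding deflation_def by blast
  have ma: "m \<in> arr E" using m unfolding monic_def by simp
  note c = conf_eqs[OF d(2)] conf_eqs[OF l] deflation_arr[OF p(1)] ma
  have "m \<cdot> p \<in> Hom E (src E f) (tgt E m)" using c m p by simp
  then obtain h where h: "h \<in> arr E" "src E h = tgt E f" "tgt E h = tgt E m" "m \<cdot> p = h \<cdot> f"
    using app m(3) unfolding left_approximation_def by fastforce
  have sp: "src E p = tgt E l" using p d c by simp
  have "m \<cdot> (p \<cdot> l) = (h \<cdot> f) \<cdot> l" using h(4)[symmetric] c m(2) sp by simp
  also have "\<dots> = hzero E (src E (p \<cdot> l)) (tgt E m)" using h(1-3) c d(3,4) sp by simp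
  finally have "p \<cdot> l = hzero E (src E l) (tgt E p)"
    using monic_zeroD[OF m(1), of "p \<cdot> l"] c sp m(2) by simp
  then obtain v where v: "v \<in> arr E" "tgt E v = tgt E p" "src E v = tgt E d" "v \<cdot> d = p"
    using conf_colift[OF l, of p] c sp by auto
  \<comment> \<open>Weak idempotent completeness enters here: \<open>v\<close> is the second factor
    of the deflation \<open>p\<close>.\<close>
  have vd: "deflation E v" by (rule deflation_cancel[of v d]) (use v p c in auto)
  obtain v' i q where po: "is_pushout E j v v' i" and q: "conf i q" "tgt E q = tgt E g"
    using ex_pushout_conf[OF d(2) v(1)] v d by metis
  note pe = pushout_eqs[OF po]
  have "deflation E v'" using pushout_deflation[OF po conf_inflation[OF d(2)] vd] .
  moreover have "src E v' \<in> \<D>" using app pe d c unfolding left_approximation_def by simp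
  ultimately have "tgt E i \<in> Fac E \<D>" unfolding Fac_iff using pe by metis
  then show ?thesis using that q pe v by simp
qed

subsection \<open>From support tau-tilting subcategories to tau-cotorsion pairs\<close>

lemma support_tau_tiltingD:
  assumes "support_tau_tilting E \<T>"
  shows "\<T> \<subseteq> obj E" "\<And>T X. T \<in> \<T> \<Longrightarrow> X \<in> Fac E \<T> \<Longrightarrow> ext_split T X"
    "\<T> \<subseteq> left_perp1 E (Fac E \<T>)" "additively_closed E \<T>"
proof -
  show s: "\<T> \<subseteq> obj E" and "additively_closed E \<T>"
    using assms unfolding support_tau_tilting_def subcategory_def by auto
  show t: "ext_split T X" if "T \<in> \<T>" "X \<in> Fac E \<T>" for T X
    using assms that s Fac_obj Ext_zero_1_iff[of T X] unfolding support_tau_tilting_def by auto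
  show "\<T> \<subseteq> left_perp1 E (Fac E \<T>)" using s t left_perp1_iff[OF Fac_obj] by auto
qed

text \<open>A map from a projective to a factor object of \<open>\<T>\<close> lifts to an object of
  \<open>\<T>\<close>, where the approximation already applies.\<close>

lemma left_approximation_Fac:
  assumes "left_approximation E \<T> f" "\<T> \<subseteq> obj E" "src E f \<in> projectives E"
  shows "left_approximation E (Fac E \<T>) f"
  unfolding left_approximation_def
proof (intro conjI ballI)
  show f: "f \<in> arr E" "tgt E f \<in> Fac E \<T>"
    using assms subset_Fac unfolding left_approximation_def by auto
  fix X g assume X: "X \<in> Fac E \<T>" "g \<in> Hom E (src E f) X"
  then obtain d where d: "deflation E d" "src E d \<in> \<T>" "tgt E d = X" unfolding Fac_iff by blast
  then obtain u where u: "u \<in> arr E" "src E u = src E f" "tgt E u = src E d" "d \<cdot> u = g"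
    using assms(3) X unfolding projective_iff by (metis Hom_iff)
  then obtain h where "h \<in> Hom E (tgt E f) (src E d)" "u = h \<cdot> f"
    using assms(1) d(2) unfolding left_approximation_def by force
  then show "\<exists>h\<in>Hom E (tgt E f) X. g = h \<cdot> f"
    using u d deflation_arr[OF d(1)] f by (intro bexI[of _ "d \<cdot> h"]) auto
qed

text \<open>A horseshoe argument. Pulling the conflation back along a deflation \<open>e\<close>
  from \<open>\<T>\<close> to the end term \<open>Z\<close> makes it split, because
  \<open>Ext^1(T, X) = 0\<close> for the source \<open>T\<close> of \<open>e\<close>. Its middle
  term is then the sum of \<open>X\<close> and \<open>T\<close>, which is covered by a sum of two
  objects of \<open>\<T>\<close> and itself covers \<open>Y\<close>.\<close>

lemma torsion_class_Fac:
  assumes "support_tau_tilting E \<T>" shows "torsion_class E (Fac E \<T>)"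
  unfolding torsion_class_def
proof (intro conjI subcategory_Fac Fac_Fac)
  note T = support_tau_tiltingD[OF assms]
  show "extension_closed E (Fac E \<T>)"
    unfolding extension_closed_def conflation_on_iff
  proof (intro allI impI)
    fix X Y Z i p assume "(conf i p \<and> src E i = X \<and> tgt E i = Y \<and> tgt E p = Z) \<and> X \<in> Fac E \<T> \<and> Z \<in> Fac E \<T>"
    then have i: "conf i p" "src E i = X" "tgt E i = Y" "tgt E p = Z" and X: "X \<in> Fac E \<T>" "Z \<in> Fac E \<T>" by auto
    obtain d where d: "deflation E d" "src E d \<in> \<T>" "tgt E d = X" using X unfolding Fac_iff by blast
    obtain e where e: "deflation E e" "src E e \<in> \<T>" "tgt E e = Z" using X unfolding Fac_iff by blast
    note a = deflation_arr[OF d(1)] deflation_arr[OF e(1)] conf_eqs[OF i(1)]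
    obtain u j q where pb: "is_pullback E p e u q" and q: "conf j q" "src E j = src E i"
      using ex_pullback_conf[OF i(1), of e] a i e by metis
    note pe = pullback_eqs[OF pb] and cq = conf_eqs[OF q(1)]
    have u: "deflation E u" using pullback_deflation[OF pullback_swap[OF pb] e(1)] .
    obtain r s where b: "biprod X (src E e) (tgt E j) j r s q"
      using ext_splitD[OF T(2)[OF e(2) X(1)] q(1)] q(2) i pe by metis
    obtain S i1 p1 j1 q1 where S: "biprod (src E d) (src E e) S i1 p1 j1 q1"
      using ex_biprod[OF src_obj[OF a(1)] src_obj[OF a(2)]] .
    have "S \<in> \<T>" by (rule additively_closed_sum[OF T(4) d(2) e(2) S])
    define w where "w = j \<cdot> (d \<cdot> p1) \<boxplus> s \<cdot> q1"
    have w: "deflation E w" unfolding w_def using biprod_map_deflation[OF b S d(1) refl d(3)] .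
    have w': "src E w = S" "tgt E w = src E u" unfolding w_def
      using biprod_eqs[OF b] biprod_eqs[OF S] a d pe cq by auto
    have "deflation E (u \<cdot> w)" using deflation_cmp[OF w u w'(2)] .
    moreover have "src E (u \<cdot> w) = S" "tgt E (u \<cdot> w) = Y"
      using w' deflation_arr[OF w] pe a i by auto
    ultimately show "Y \<in> Fac E \<T>" unfolding Fac_iff using \<open>S \<in> \<T>\<close> by blast
  qed
qed

lemma tau_cotorsion_pair_Fac:
  assumes "support_tau_tilting E \<T>" shows "tau_cotorsion_pair E (left_perp1 E (Fac E \<T>)) (Fac E \<T>)"
  unfolding tau_cotorsion_pair_def
proof (intro conjI subcategory_Fac subcategory_left_perp1 Fac_obj refl ballI)
  note T = support_tau_tiltingD[OF assms]
  fix P assume P: "P \<in> projectives E"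
  then obtain T0 T1 f g where f: "T0 \<in> \<T>" "T1 \<in> \<T>" "f \<in> Hom E P T0" "g \<in> Hom E T0 T1"
    "exact_sequence E [f, g]" "deflation E g" "left_approximation E \<T> f"
    using assms unfolding support_tau_tilting_def by blast
  then have "left_approximation E (Fac E \<T>) f" using left_approximation_Fac T(1) P by simp
  then show "\<exists>D\<in>left_perp1 E (Fac E \<T>) \<inter> Fac E \<T>. \<exists>C\<in>left_perp1 E (Fac E \<T>). \<exists>f\<in>Hom E P D. \<exists>g\<in>Hom E D C.
     exact_sequence E [f, g] \<and> deflation E g \<and> left_approximation E (Fac E \<T>) f"
    using f T(3) subset_Fac[OF T(1)] by blast
qed

lemma support_tau_tilting_recover:
  assumes "support_tau_tilting E \<T>" shows "left_perp1 E (Fac E \<T>) \<inter> Fac E \<T> = \<T>"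
proof
  note T = support_tau_tiltingD[OF assms]
  show "\<T> \<subseteq> left_perp1 E (Fac E \<T>) \<inter> Fac E \<T>" using T(3) subset_Fac[OF T(1)] by blast
  show "left_perp1 E (Fac E \<T>) \<inter> Fac E \<T> \<subseteq> \<T>"
  proof
    fix X assume "X \<in> left_perp1 E (Fac E \<T>) \<inter> Fac E \<T>"
    then have X: "\<And>Y. Y \<in> Fac E \<T> \<Longrightarrow> ext_split X Y" "X \<in> Fac E \<T>"
      using left_perp1_iff[OF Fac_obj] by auto
    then obtain d where d: "deflation E d" "src E d \<in> \<T>" "tgt E d = X" unfolding Fac_iff by blast
    obtain k where k: "conf k d" using d unfolding deflation_def by blast
    note ck = conf_eqs[OF k]
    obtain l p where p: "conf l p" "tgt E p = src E k" "tgt E l \<in> projectives E"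
      using ex_projective_conf[OF src_obj[OF ck(1)]] .
    obtain T0 T1 f g where f: "T0 \<in> \<T>" "T1 \<in> \<T>" "f \<in> Hom E (tgt E l) T0" "g \<in> Hom E T0 T1"
      "exact_sequence E [f, g]" "deflation E g" "left_approximation E \<T> f"
      using assms p(3) unfolding support_tau_tilting_def by blast
    obtain m q where m: "conf m q" "src E m = src E k" "tgt E m \<in> Fac E \<T>" "tgt E q = T1"
    proof (rule approximation_coresolution[OF f(7,5,6) conf_deflation[OF p(1)] _ conf_monic[OF k]])
      fix i q assume "conf i q" "src E i = tgt E p" "tgt E i \<in> Fac E \<T>" "tgt E q = tgt E g"
      then show thesis using that f p by simp
    qed (use p f conf_eqs[OF p(1)] ck d in auto)
    note cm = conf_eqs[OF m(1)]
    obtain m' k' d' where po: "is_pushout E k m m' k'" and k': "conf k' d'" "tgt E d' = tgt E d"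
      using ex_pushout_conf[OF k cm(1) m(2)] by metis
    obtain q' where q': "conf m' q'" "tgt E q' = T1"
      using pushout_conf[OF pushout_swap[OF po] m(1)] m(4) by metis
    note pe = pushout_eqs[OF po]
    \<comment> \<open>One conflation through the pushout splits by the assumption on
      \<open>X\<close>, its left term being in \<open>Fac \<T>\<close>. The other splits because
      both its ends lie in \<open>\<T>\<close>.\<close>
    obtain r s where b: "biprod (tgt E m) X (tgt E k') k' r s d'"
      using ext_splitD[OF X(1)[OF m(3)] k'(1)] k'(2) pe d by metis
    have "ext_split T1 (tgt E k)" using T(2)[OF f(2)] subset_Fac[OF T(1)] d ck by auto
    then obtain r' s' where b': "biprod (tgt E k) T1 (tgt E m') m' r' s' q'"
      using ext_splitD[OF _ q'(1)] q'(2) pe by metis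
    have "direct_summand E X (tgt E m')" using biprod_summand[OF biprod_swap[OF b]] pe by simp
    moreover have "set [tgt E k, T1] \<subseteq> \<T>" using d ck f by simp
    ultimately show "X \<in> \<T>"
      using T(4) biprod_direct_sum[OF b'] unfolding additively_closed_def by blast
  qed
qed

subsection \<open>From tau-cotorsion pairs to support tau-tilting subcategories\<close>

lemma tau_cotorsion_pairD:
  assumes "tau_cotorsion_pair E \<C> \<D>"
  shows "\<D> \<subseteq> obj E" "\<C> \<subseteq> obj E" "\<C> = left_perp1 E \<D>" "\<And>C D. C \<in> \<C> \<Longrightarrow> D \<in> \<D> \<Longrightarrow> ext_split C D"
proof -
  show D: "\<D> \<subseteq> obj E" "\<C> \<subseteq> obj E" and C: "\<C> = left_perp1 E \<D>"
    using assms unfolding tau_cotorsion_pair_def subcategory_def by auto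
  show "\<And>C D. C \<in> \<C> \<Longrightarrow> D \<in> \<D> \<Longrightarrow> ext_split C D" unfolding C left_perp1_iff[OF D(1)] by blast
qed

lemma tau_cotorsion_pair_Fac_eq:
  assumes "tau_cotorsion_pair E \<C> \<D>" "Fac E \<D> \<subseteq> \<D>"
  shows "Fac E (\<C> \<inter> \<D>) = \<D>"
proof
  note C = tau_cotorsion_pairD[OF assms(1)]
  show "Fac E (\<C> \<inter> \<D>) \<subseteq> \<D>" using Fac_mono[of "\<C> \<inter> \<D>" \<D>] assms(2) by blast
  show "\<D> \<subseteq> Fac E (\<C> \<inter> \<D>)"
  proof
    fix X assume X: "X \<in> \<D>"
    then obtain l p where p: "conf l p" "tgt E p = X" "tgt E l \<in> projectives E"
      using ex_projective_conf C by blast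
    note cp = conf_eqs[OF p(1)]
    obtain D f where f: "D \<in> \<C> \<inter> \<D>" "f \<in> Hom E (tgt E l) D" "left_approximation E \<D> f"
      using assms(1) p(3) unfolding tau_cotorsion_pair_def by blast
    moreover have "p \<in> Hom E (tgt E l) X" using p cp by simp
    ultimately obtain h where h: "h \<in> Hom E D X" "p = h \<cdot> f"
      using X unfolding left_approximation_def by (metis Hom_iff)
    have "deflation E h" using deflation_cancel[of h f] conf_deflation[OF p(1)] h f by simp
    then show "X \<in> Fac E (\<C> \<inter> \<D>)" unfolding Fac_iff using h f by auto
  qed
qed

text \<open>Given a deflation from a projective to the sum, each component factors through the
  approximation of that projective. The components assemble to a map from a single object of
  \<open>\<D>\<close>, which is a deflation by cancellation, so the sum is a factor object of
  \<open>\<D>\<close>. This includes the empty sum.\<close>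

lemma tau_cotorsion_pair_sum_closed:
  assumes "tau_cotorsion_pair E \<C> \<D>" "Fac E \<D> \<subseteq> \<D>"
  shows "sum_closed E \<D>"
  unfolding sum_closed_def
proof (intro allI impI)
  note C = tau_cotorsion_pairD[OF assms(1)]
  fix Xs S i p assume S: "set Xs \<subseteq> \<D> \<and> direct_sum E Xs S i p"
  then have So: "S \<in> obj E" unfolding direct_sum_def by blast
  obtain l q where q: "conf l q" "tgt E q = S" "tgt E l \<in> projectives E"
    using ex_projective_conf[OF So] .
  note cq = conf_eqs[OF q(1)]
  obtain D f where f: "D \<in> \<C> \<inter> \<D>" "f \<in> Hom E (tgt E l) D" "left_approximation E \<D> f"
    using assms(1) q(3) unfolding tau_cotorsion_pair_def by blast
  have "\<exists>u. u \<in> Hom E D (Xs ! k) \<and> u \<cdot> f = p k \<cdot> q" if "k < length Xs" for k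
  proof -
    have "p k \<in> Hom E S (Xs ! k)" "Xs ! k \<in> \<D>" using S that unfolding direct_sum_def by auto
    moreover from this have "p k \<cdot> q \<in> Hom E (tgt E l) (Xs ! k)" using q cq by simp
    ultimately show ?thesis using f(2,3) unfolding left_approximation_def by (metis Hom_iff)
  qed
  then obtain u where u: "\<And>k. k < length Xs \<Longrightarrow> u k \<in> Hom E D (Xs ! k)"
    "\<And>k. k < length Xs \<Longrightarrow> u k \<cdot> f = p k \<cdot> q" by metis
  have "q \<in> Hom E (tgt E l) S" "D \<in> obj E" using cq q f by auto
  then obtain v where v: "v \<in> Hom E D S" "v \<cdot> f = q"
    using direct_sum_coinduced[of Xs S i p u D f "tgt E l" q] S u f by metis
  have "deflation E v" using deflation_cancel[of v f] v f conf_deflation[OF q(1)] by simp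
  then have "S \<in> Fac E \<D>" unfolding Fac_iff using v f by auto
  then show "S \<in> \<D>" using assms(2) by blast
qed

lemma tau_cotorsion_pair_additive:
  assumes "tau_cotorsion_pair E \<C> \<D>" "Fac E \<D> \<subseteq> \<D>"
  shows "subcategory E (\<C> \<inter> \<D>)" "sum_closed E (\<C> \<inter> \<D>)" "summand_closed E (\<C> \<inter> \<D>)"
proof -
  note C = tau_cotorsion_pairD[OF assms(1)]
  show "subcategory E (\<C> \<inter> \<D>)"
    using assms unfolding tau_cotorsion_pair_def subcategory_def by blast
  show "sum_closed E (\<C> \<inter> \<D>)"
    using tau_cotorsion_pair_sum_closed[OF assms] left_perp1_sum[OF C(1)] C(3)
    unfolding sum_closed_def by blast
  show "summand_closed E (\<C> \<inter> \<D>)"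
    using summand_closed_Fac[OF assms(2)] summand_closed_left_perp1[OF C(1)] C(3)
    unfolding summand_closed_def by blast
qed

lemma additively_closedI:
  "\<lbrakk>sum_closed E \<T>; summand_closed E \<T>\<rbrakk> \<Longrightarrow> additively_closed E \<T>"
  unfolding additively_closed_def sum_closed_def summand_closed_def by blast

text \<open>Rewriting \<open>Fac (\<C> \<inter> \<D>)\<close> to \<open>\<D>\<close> reduces the
  \<open>Ext\<close> condition to orthogonality of the pair. The end term of an approximation
  sequence lies in \<open>\<D>\<close> as a factor of an object of \<open>\<D>\<close>.\<close>

lemma support_tau_tilting_Int:
  assumes "tau_cotorsion_pair E \<C> \<D>" "Fac E \<D> \<subseteq> \<D>"
  shows "support_tau_tilting E (\<C> \<inter> \<D>)"
  unfolding support_tau_tilting_def tau_cotorsion_pair_Fac_eq[OF assms]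
proof (intro conjI ballI)
  note C = tau_cotorsion_pairD[OF assms(1)]
  show "subcategory E (\<C> \<inter> \<D>)" "additively_closed E (\<C> \<inter> \<D>)"
    using tau_cotorsion_pair_additive[OF assms] additively_closedI by blast+
  show "Ext_zero E 1 T X" if "T \<in> \<C> \<inter> \<D>" "X \<in> \<D>" for T X
    using that C Ext_zero_1_iff[of T X] by auto
  fix P assume "P \<in> projectives E"
  then obtain D C' f g where f: "D \<in> \<C> \<inter> \<D>" "C' \<in> \<C>" "f \<in> Hom E P D" "g \<in> Hom E D C'"
    "exact_sequence E [f, g]" "deflation E g" "left_approximation E \<D> f"
    using assms unfolding tau_cotorsion_pair_def by blast
  have "C' \<in> Fac E \<D>" unfolding Fac_iff using f by auto
  then have "C' \<in> \<C> \<inter> \<D>" using f assms(2) by blast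
  moreover have "left_approximation E (\<C> \<inter> \<D>) f"
    using f unfolding left_approximation_def by auto
  ultimately show "\<exists>T0\<in>\<C> \<inter> \<D>. \<exists>T1\<in>\<C> \<inter> \<D>. \<exists>f\<in>Hom E P T0. \<exists>g\<in>Hom E T0 T1.
    exact_sequence E [f, g] \<and> deflation E g \<and> left_approximation E (\<C> \<inter> \<D>) f"
    using f by blast
qed

subsection \<open>Tilting subcategories and cotorsion pairs\<close>

text \<open>For a conflation \<open>K >-> T' ->> X\<close> the reason is the exact piece
  \<open>Ext^1(T, T') -> Ext^1(T, X) -> Ext^2(T, K)\<close>. By hand: an extension of
  \<open>T\<close> by \<open>X\<close> is spliced with this conflation, and the lifts provided by
  \<open>Ext^2(T, K) = 0\<close> are turned into a section.\<close>

lemma tilting_support_tau_tilting: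
  assumes "tilting E \<T>" shows "support_tau_tilting E \<T>"
proof -
  have T: "\<T> \<subseteq> obj E" "\<And>T T'. T \<in> \<T> \<Longrightarrow> T' \<in> \<T> \<Longrightarrow> Ext_zero E 1 T T'"
    "\<And>T X. T \<in> \<T> \<Longrightarrow> X \<in> obj E \<Longrightarrow> Ext_zero E 2 T X"
    using assms unfolding tilting_def subcategory_def by auto
  have sp: "ext_split T T'" if "T \<in> \<T>" "T' \<in> \<T>" for T T'
    using T(2)[OF that] Ext_zero_1_iff[of T T'] T(1) that by auto
  show ?thesis
    unfolding support_tau_tilting_def
  proof (intro conjI ballI)
    show "subcategory E \<T>" "additively_closed E \<T>"
      using assms additively_closedI unfolding tilting_def by auto
    show "Ext_zero E 1 T X" if TX: "T \<in> \<T>" "X \<in> Fac E \<T>" for T X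
    proof -
      have ob: "T \<in> obj E" "X \<in> obj E" using TX T(1) Fac_obj by auto
      obtain d where d: "deflation E d" "src E d \<in> \<T>" "tgt E d = X" using TX unfolding Fac_iff by blast
      obtain f where f: "conf f d" using d unfolding deflation_def by blast
      obtain k \<pi> where k: "conf k \<pi>" "tgt E \<pi> = T" "tgt E k \<in> projectives E"
        using ex_projective_conf[OF ob(1)] .
      note c = conf_eqs[OF f] conf_eqs[OF k(1)]
      have "ext_split T X"
      proof (rule ext_splitI[OF ob])
        fix j h assume j: "conf j h" "src E j = X" "tgt E h = T"
        note cj = conf_eqs[OF j(1)]
        obtain \<phi> \<psi> where "\<phi> \<in> Hom E (tgt E k) (src E h)" "\<psi> \<in> Hom E (src E k) (src E d)"
          and eq: "h \<cdot> \<phi> = \<pi>" "(j \<cdot> d) \<cdot> \<psi> = \<phi> \<cdot> k"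
          using Ext_zero_2_lift[OF T(3)[OF TX(1) src_obj[OF c(1)]] k f j(1) _ refl j(3)] d(3) j(2) by metis
        then have phi: "\<phi> \<in> arr E" "src E \<phi> = tgt E k" "tgt E \<phi> = tgt E j"
          and psi: "\<psi> \<in> arr E" "src E \<psi> = src E k" "tgt E \<psi> = tgt E f" using c cj by simp_all
        \<comment> \<open>The map \<open>\<psi>\<close> lives on the syzygy only;
          \<open>Ext^1\<close> between objects of \<open>\<T>\<close> extends it to the projective.
          Subtracting the image of this extension from \<open>\<phi>\<close> leaves a map that kills
          \<open>k\<close> and descends to \<open>T\<close>, still over \<open>\<pi>\<close> because
          \<open>h \<cdot> j\<close> is zero.\<close>
        obtain e where e: "e \<in> arr E" "tgt E e = tgt E f" "src E e = tgt E k" "e \<cdot> k = \<psi>"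
          using ext_extend[OF sp[OF TX(1) d(2)] k(1,2) psi(1)] psi c by metis
        have "((j \<cdot> d) \<cdot> e) \<cdot> k = (j \<cdot> d) \<cdot> \<psi>" using e psi c cj j d by simp
        also note eq(2)
        finally have "((j \<cdot> d) \<cdot> e) \<cdot> k = \<phi> \<cdot> k" .
        then have "(\<phi> \<boxminus> (j \<cdot> d) \<cdot> e) \<cdot> k = hzero E (src E k) (tgt E j)"
          using e(1-3) phi c cj j d by simp
        then obtain s where s: "s \<in> arr E" "tgt E s = tgt E j" "src E s = tgt E \<pi>" "s \<cdot> \<pi> = \<phi> \<boxminus> (j \<cdot> d) \<cdot> e"
          using conf_colift[OF k(1), of "\<phi> \<boxminus> (j \<cdot> d) \<cdot> e"] e phi c cj j d by auto
        have "h \<cdot> s = idt E T"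
          by (rule epicD[OF conf_epic[OF k(1)]])
            (use s e phi c cj j d k eq(1) cmp_reduce[OF cj(4), of "d \<cdot> e"] in auto)
        then show "\<exists>s. s \<in> arr E \<and> src E s = T \<and> tgt E s = tgt E j \<and> h \<cdot> s = idt E T"
          using s k by auto
      qed
      then show ?thesis using Ext_zero_1_iff[OF ob] by blast
    qed
    fix P assume "P \<in> projectives E"
    then obtain T0 T1 i p where *: "T0 \<in> \<T>" "T1 \<in> \<T>" "conflation_on E P T0 T1 i p"
      using assms unfolding tilting_def by blast
    then have i: "conf i p" "src E i = P" "tgt E i = T0" "tgt E p = T1" "i \<in> Hom E P T0" "p \<in> Hom E T0 T1"
      using conf_eqs unfolding conflation_on_iff by auto
    have "left_approximation E \<T> i"
      using left_approximationI_conf[OF i(1), of \<T>] i * sp by auto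
    then show "\<exists>T0\<in>\<T>. \<exists>T1\<in>\<T>. \<exists>f\<in>Hom E P T0. \<exists>g\<in>Hom E T0 T1.
      exact_sequence E [f, g] \<and> deflation E g \<and> left_approximation E \<T> f"
      using * i(5,6) exact_sequence_conf[OF i(1)] conf_deflation[OF i(1)] by blast
  qed
qed

text \<open>For \<open>X\<close> orthogonal to \<open>\<D>\<close>, the conflation
  \<open>D >-> C ->> X\<close> splits, so \<open>X\<close> is a summand of \<open>C\<close>.\<close>

lemma cotorsion_pair_left_perp1:
  assumes "cotorsion_pair E \<C> \<D>" shows "\<C> = left_perp1 E \<D>" "\<D> \<subseteq> obj E"
proof -
  have C: "\<C> \<subseteq> obj E" and D: "\<D> \<subseteq> obj E" "summand_closed E \<C>"
    and e: "\<And>C D. C \<in> \<C> \<Longrightarrow> D \<in> \<D> \<Longrightarrow> Ext_zero E 1 C D"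
    using assms unfolding cotorsion_pair_def subcategory_def by auto
  show "\<D> \<subseteq> obj E" by fact
  show "\<C> = left_perp1 E \<D>"
  proof
    show "\<C> \<subseteq> left_perp1 E \<D>" using e C unfolding left_perp1_def by auto
    show "left_perp1 E \<D> \<subseteq> \<C>"
    proof
      fix X assume "X \<in> left_perp1 E \<D>"
      then have X: "X \<in> obj E" "\<And>Y. Y \<in> \<D> \<Longrightarrow> ext_split X Y" using left_perp1_iff[OF D(1)] by auto
      then obtain D' C' i p where *: "D' \<in> \<D>" "C' \<in> \<C>" "conflation_on E D' C' X i p"
        using assms unfolding cotorsion_pair_def by blast
      then have i: "conf i p" "src E i = D'" "tgt E i = C'" "tgt E p = X" unfolding conflation_on_iff by auto
      obtain r s where "biprod D' X (tgt E i) i r s p" using ext_splitD[OF X(2)[OF *(1)] i(1,2,4)] .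
      then have "direct_summand E X C'" using biprod_swap biprod_summand i by blast
      then show "X \<in> \<C>" using D(2) * unfolding summand_closed_def by blast
    qed
  qed
qed

text \<open>In \<open>P >-> D' ->> C'\<close> both ends lie in \<open>\<C>\<close>, which is closed
  under extensions as a left orthogonal, so \<open>D'\<close> lies in \<open>\<C>\<close>
  too.\<close>

lemma cotorsion_pair_approximation:
  assumes "cotorsion_pair E \<C> \<D>" "P \<in> projectives E"
  obtains i p where "conf i p" "src E i = P" "tgt E i \<in> \<C> \<inter> \<D>" "tgt E p \<in> \<C>"
proof -
  note C = cotorsion_pair_left_perp1[OF assms(1)]
  obtain D' C' i p where *: "D' \<in> \<D>" "C' \<in> \<C>" "conflation_on E P D' C' i p"
    using assms projective_obj[OF assms(2)] unfolding cotorsion_pair_def by blast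
  then have i: "conf i p" "src E i = P" "tgt E i = D'" "tgt E p = C'" unfolding conflation_on_iff by auto
  have "tgt E i \<in> left_perp1 E \<D>"
    by (rule left_perp1_extension[OF C(2) i(1)]) (use left_perp1_projective[OF C(2) assms(2)] i * C in auto)
  then show ?thesis using that[OF i(1)] i * C by auto
qed

lemma cotorsion_pair_tau_cotorsion_pair:
  assumes "cotorsion_pair E \<C> \<D>" shows "tau_cotorsion_pair E \<C> \<D>"
  unfolding tau_cotorsion_pair_def
proof (intro conjI ballI)
  note C = cotorsion_pair_left_perp1[OF assms]
  show "subcategory E \<C>" "subcategory E \<D>" "\<C> = left_perp1 E \<D>"
    using assms C unfolding cotorsion_pair_def by auto
  fix P assume "P \<in> projectives E"
  then obtain i p where i: "conf i p" "src E i = P" "tgt E i \<in> \<C> \<inter> \<D>" "tgt E p \<in> \<C>"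
    using cotorsion_pair_approximation[OF assms] by metis
  have "ext_split (tgt E p) D" if "D \<in> \<D>" for D
    using i(4) that C left_perp1_iff[OF C(2)] by auto
  then have "left_approximation E \<D> i" using left_approximationI_conf[OF i(1)] i(3) by blast
  moreover have "i \<in> Hom E P (tgt E i)" "p \<in> Hom E (tgt E i) (tgt E p)" using conf_eqs[OF i(1)] i by auto
  ultimately show "\<exists>D\<in>\<C> \<inter> \<D>. \<exists>C\<in>\<C>. \<exists>f\<in>Hom E P D. \<exists>g\<in>Hom E D C.
    exact_sequence E [f, g] \<and> deflation E g \<and> left_approximation E \<D> f"
    using i exact_sequence_conf[OF i(1)] conf_deflation[OF i(1)] by blast
qed

text \<open>Conflations starting at \<open>X\<close> come from pushing
  \<open>P >-> T0 ->> T1\<close> out along \<open>P ->> X\<close>, which makes the new middle term a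
  factor of \<open>T0\<close>. Conflations ending at \<open>X\<close> then follow by Salce's
  argument applied to a syzygy.\<close>

lemma cotorsion_pair_Fac:
  assumes "tilting E \<T>" shows "cotorsion_pair E (left_perp1 E (Fac E \<T>)) (Fac E \<T>)"
proof -
  note st = tilting_support_tau_tilting[OF assms]
  note T = support_tau_tiltingD[OF st]
  have right: "\<exists>i p. conf i p \<and> src E i = X \<and> tgt E i \<in> Fac E \<T> \<and> tgt E p \<in> \<T>" if X: "X \<in> obj E" for X
  proof -
    obtain l p where p: "conf l p" "tgt E p = X" "tgt E l \<in> projectives E"
      using ex_projective_conf[OF X] .
    note cp = conf_eqs[OF p(1)]
    obtain T0 T1 i q where *: "T0 \<in> \<T>" "T1 \<in> \<T>" "conflation_on E (tgt E l) T0 T1 i q"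
      using assms p(3) unfolding tilting_def by blast
    then have i: "conf i q" "src E i = tgt E l" "tgt E i = T0" "tgt E q = T1" unfolding conflation_on_iff by auto
    obtain p' i' q' where po: "is_pushout E i p p' i'" and q': "conf i' q'" "tgt E q' = tgt E q"
      using ex_pushout_conf[OF i(1), of p] cp i(2) by metis
    note pe = pushout_eqs[OF po]
    have "deflation E p'" using pushout_deflation[OF po conf_inflation[OF i(1)] conf_deflation[OF p(1)]] .
    moreover have "src E p' \<in> \<T>" "tgt E p' = tgt E i'" using pe i * by auto
    ultimately have "tgt E i' \<in> Fac E \<T>" unfolding Fac_iff by blast
    then show ?thesis using q' pe p i * by metis
  qed
  show ?thesis
    unfolding cotorsion_pair_def conflation_on_iff
  proof (intro conjI ballI subcategory_Fac subcategory_left_perp1 summand_closed_left_perp1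
      summand_closed_Fac Fac_obj Fac_Fac)
    fix C D assume "C \<in> left_perp1 E (Fac E \<T>)" "D \<in> Fac E \<T>"
    then show "Ext_zero E 1 C D" unfolding left_perp1_def by blast
  next
    fix X assume X: "X \<in> obj E"
    show "\<exists>D'\<in>Fac E \<T>. \<exists>C'\<in>left_perp1 E (Fac E \<T>). \<exists>i p. conf i p \<and> src E i = X \<and> tgt E i = D' \<and> tgt E p = C'"
      using right[OF X] T(3) by blast
    obtain k p where p: "conf k p" "tgt E p = X" "tgt E k \<in> projectives E"
      using ex_projective_conf[OF X] .
    note cp = conf_eqs[OF p(1)]
    obtain j q where j: "conf j q" "src E j = src E k" "tgt E j \<in> Fac E \<T>" "tgt E q \<in> \<T>"
      using right[OF src_obj[OF cp(1)]] by blast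
    obtain j' k' p' where po: "is_pushout E k j j' k'" and p': "conf k' p'" "tgt E p' = tgt E p"
      using ex_pushout_conf[OF p(1) conf_eqs(1)[OF j(1)] j(2)] by metis
    obtain q' where q': "conf j' q'" "tgt E q' = tgt E q"
      using pushout_conf[OF pushout_swap[OF po] j(1)] by metis
    note pe = pushout_eqs[OF po]
    \<comment> \<open>The pushout is an extension of an object of \<open>\<T>\<close> by the
      projective, both in the left orthogonal. Read the other way, it is an extension of
      \<open>X\<close> by an object of \<open>Fac \<T>\<close>.\<close>
    have "tgt E j' \<in> left_perp1 E (Fac E \<T>)"
      by (rule left_perp1_extension[OF Fac_obj q'(1)])
        (use left_perp1_projective[OF Fac_obj p(3)] pe q'(2) j(4) T(3) in auto)
    then show "\<exists>D\<in>Fac E \<T>. \<exists>C\<in>left_perp1 E (Fac E \<T>). \<exists>i p. conf i p \<and> src E i = D \<and> tgt E i = C \<and> tgt E p = X"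
      using p' p j(3) pe by metis
  qed
qed

text \<open>A deflation \<open>A \<twoheadrightarrow> Z\<close> embeds into \<open>D \<twoheadrightarrow> W\<close> with the same kernel and \<open>D\<close>, hence also \<open>W\<close>,
  in the torsion class, so that maps from a syzygy of \<open>X\<close> to \<open>W\<close> extend to the projective.\<close>

lemma cotorsion_pair_syzygy_projective:
  assumes "cotorsion_pair E \<C> \<D>" "Fac E \<D> \<subseteq> \<D>" "conf k \<pi>" "tgt E k \<in> projectives E" "tgt E \<pi> \<in> \<C>"
  shows "src E k \<in> projectives E"
  unfolding projective_iff
proof (intro conjI allI impI)
  note C = cotorsion_pair_left_perp1[OF assms(1)] and ck = conf_eqs[OF assms(3)]
  show "src E k \<in> obj E" using ck by simp
  fix d u assume d: "deflation E d" and u: "u \<in> arr E" "src E u = src E k" "tgt E u = tgt E d"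
  obtain f where f: "conf f d" using d unfolding deflation_def by blast
  note cf = conf_eqs[OF f]
  obtain D' C' a e where *: "D' \<in> \<D>" "C' \<in> \<C>" "conflation_on E (src E d) D' C' a e"
    using assms(1) src_obj[OF cf(2)] unfolding cotorsion_pair_def by blast
  then have a: "conf a e" "src E a = tgt E f" "tgt E a = D'" using cf unfolding conflation_on_iff by auto
  note ca = conf_eqs[OF a(1)]
  have "inflation E (a \<cdot> f)" using inflation_cmp[OF conf_inflation[OF f] conf_inflation[OF a(1)]] a by simp
  then obtain d' where d': "conf (a \<cdot> f) d'" unfolding inflation_def by blast
  note cd = conf_eqs[OF d']
  have "src E d' = D'" using cd a ca cf by simp
  then have "tgt E d' \<in> Fac E \<D>" unfolding Fac_iff using conf_deflation[OF d'] * by metis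
  \<comment> \<open>The cokernel of \<open>a \<cdot> f\<close> is a factor of an object of
    \<open>\<D>\<close>, hence orthogonal to \<open>\<C>\<close>. The induced map \<open>c\<close>
    on cokernels turns the problem of lifting \<open>u\<close> into one over this cokernel.\<close>
  then have W: "ext_split (tgt E \<pi>) (tgt E d')" using assms(2,5) C left_perp1_iff[OF C(2)] by blast
  have "(d' \<cdot> a) \<cdot> f = hzero E (src E f) (tgt E d')" using cd a ca cf by simp
  then obtain c where c: "c \<in> arr E" "tgt E c = tgt E d'" "src E c = tgt E d" "c \<cdot> d = d' \<cdot> a"
    using conf_colift[OF f, of "d' \<cdot> a"] cd a ca cf by auto
  have cu: "c \<cdot> u \<in> arr E" "tgt E (c \<cdot> u) = tgt E d'" "src E (c \<cdot> u) = src E k" using c u by simp_all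
  obtain g where g: "g \<in> arr E" "tgt E g = tgt E d'" "src E g = tgt E k" "g \<cdot> k = c \<cdot> u"
    using ext_extend[OF W assms(3) refl cu] .
  obtain v where v: "v \<in> arr E" "src E v = tgt E k" "tgt E v = src E d'" "d' \<cdot> v = g"
    using assms(4) conf_deflation[OF d'] g unfolding projective_iff by metis
  have eq: "c \<cdot> u = d' \<cdot> (v \<cdot> k)" using cmp_reduce[OF v(4), of k] v(1-3) g ck cd by simp
  \<comment> \<open>The composite \<open>v \<cdot> k\<close> lifts \<open>c \<cdot> u\<close> along
    \<open>d'\<close>; the weak pullback property converts it into a lift of \<open>u\<close> along
    \<open>d\<close>.\<close>
  obtain w where "w \<in> arr E" "src E w = src E u" "tgt E w = tgt E f" "d \<cdot> w = u"
  proof (rule same_kernel_lift[OF f d' ca(1) c(1) a(2) _ c(3,2) refl c(4)[symmetric] u(1) _ _ u(3) _ eq])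
  qed (use v ck u a ca cf cd in auto)
  then show "\<exists>w. w \<in> arr E \<and> src E w = src E k \<and> tgt E w = src E d \<and> d \<cdot> w = u"
    using u cf by auto
qed

text \<open>All higher \<open>Ext\<close> groups vanish at once because objects of
  \<open>\<C>\<close> have projective syzygies. The end term of \<open>P >-> D ->> C\<close> lies in
  \<open>\<D>\<close> by factor closure.\<close>

lemma tilting_Int:
  assumes "cotorsion_pair E \<C> \<D>" "Fac E \<D> \<subseteq> \<D>" shows "tilting E (\<C> \<inter> \<D>)"
proof -
  note tc = cotorsion_pair_tau_cotorsion_pair[OF assms(1)]
  note C = tau_cotorsion_pairD[OF tc]
  have higher: "Ext_zero E n X Y" if X: "n \<ge> 2" "X \<in> \<C>" "Y \<in> obj E" for n X Y
  proof -
    obtain k \<pi> where k: "conf k \<pi>" "tgt E \<pi> = X" "tgt E k \<in> projectives E"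
      using ex_projective_conf[of X] X(2) C(2) by blast
    then have "src E k \<in> projectives E"
      using cotorsion_pair_syzygy_projective[OF assms k(1,3)] k(2) X(2) by simp
    then show ?thesis using Ext_zero_projective_syzygy[OF X(1) k(1,3)] k(2) X(3) by simp
  qed
  show ?thesis
    unfolding tilting_def
  proof (intro conjI allI impI ballI)
    show "subcategory E (\<C> \<inter> \<D>)" "sum_closed E (\<C> \<inter> \<D>)" "summand_closed E (\<C> \<inter> \<D>)"
      using tau_cotorsion_pair_additive[OF tc assms(2)] by auto
    show "Ext_zero E n T T'" if "1 \<le> n" "T \<in> \<C> \<inter> \<D>" "T' \<in> \<C> \<inter> \<D>" for n T T'
    proof (cases "n = 1")
      case True
      then show ?thesis using Ext_zero_1_iff[of T T'] C that by auto
    next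
      case False
      then show ?thesis using higher[of n T T'] C that by auto
    qed
    show "Ext_zero E 2 T X" if "T \<in> \<C> \<inter> \<D>" "X \<in> obj E" for T X
      using higher[of 2 T X] that by auto
    fix P assume "P \<in> projectives E"
    then obtain i p where i: "conf i p" "src E i = P" "tgt E i \<in> \<C> \<inter> \<D>" "tgt E p \<in> \<C>"
      using cotorsion_pair_approximation[OF assms(1)] by metis
    have "tgt E p \<in> Fac E \<D>" unfolding Fac_iff using conf_deflation[OF i(1)] conf_eqs[OF i(1)] i(3) by (metis IntD2)
    then show "\<exists>T0\<in>\<C> \<inter> \<D>. \<exists>T1\<in>\<C> \<inter> \<D>. \<exists>i p. conflation_on E P T0 T1 i p"
      using i assms(2) unfolding conflation_on_iff by blast
  qed
qed

end

section \<open>Assembly of the bijections\<close>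

lemma mutually_inverse_bijectionsI:
  assumes "\<And>a. a \<in> A \<Longrightarrow> F a \<in> B" "\<And>b. b \<in> B \<Longrightarrow> G b \<in> A"
    "\<And>a. a \<in> A \<Longrightarrow> G (F a) = a" "\<And>b. b \<in> B \<Longrightarrow> F (G b) = b"
  shows "mutually_inverse_bijections F G A B"
  unfolding mutually_inverse_bijections_def
  using assms by (intro conjI ballI bij_betw_byWitness[of A G F B] bij_betw_byWitness[of B F G A]) auto

theorem theorem1p2:
  fixes E :: "('o, 'm, 'z) exact_data_scheme"
  assumes "exact_category E"
    and "enough_projectives E"
    and "weakly_idempotent_complete E"
  defines "\<Phi> \<equiv> (\<lambda>\<T>. (left_perp1 E (Fac E \<T>), Fac E \<T>))"
    and "\<Psi> \<equiv> (\<lambda>(\<C>, \<D>). \<C> \<inter> \<D>)"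
  shows "mutually_inverse_bijections \<Phi> \<Psi>
           {\<T>. support_tau_tilting E \<T>}
           {(\<C>, \<D>). tau_cotorsion_pair E \<C> \<D> \<and> torsion_class E \<D>} \<and>
         {\<T>. tilting E \<T>} \<subseteq> {\<T>. support_tau_tilting E \<T>} \<and>
         {(\<C>, \<D>). cotorsion_pair E \<C> \<D> \<and> torsion_class E \<D>}
           \<subseteq> {(\<C>, \<D>). tau_cotorsion_pair E \<C> \<D> \<and> torsion_class E \<D>} \<and>
         mutually_inverse_bijections \<Phi> \<Psi>
           {\<T>. tilting E \<T>}
           {(\<C>, \<D>). cotorsion_pair E \<C> \<D> \<and> torsion_class E \<D>}"
proof -
  interpret exact_category E by fact
  interpret wic_exact_category E by unfold_locales fact+
  \<comment> \<open>Both inverse laws are proved on the larger collections; the tilting half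
    inherits them through the two inclusions.\<close>
  have \<Phi>\<Psi>: "\<Phi> (\<Psi> (\<C>, \<D>)) = (\<C>, \<D>)"
    if "tau_cotorsion_pair E \<C> \<D>" "torsion_class E \<D>" for \<C> \<D>
    using that tau_cotorsion_pair_Fac_eq[of \<C> \<D>] tau_cotorsion_pairD(3)[OF that(1)]
    unfolding \<Phi>_def \<Psi>_def torsion_class_def by simp
  have \<Psi>\<Phi>: "\<Psi> (\<Phi> \<T>) = \<T>" if "support_tau_tilting E \<T>" for \<T>
    using support_tau_tilting_recover[OF that] unfolding \<Phi>_def \<Psi>_def by simp
  show ?thesis
  proof (intro conjI mutually_inverse_bijectionsI)
    fix \<T> assume "\<T> \<in> {\<T>. support_tau_tilting E \<T>}"
    then show "\<Phi> \<T> \<in> {(\<C>, \<D>). tau_cotorsion_pair E \<C> \<D> \<and> torsion_class E \<D>}" "\<Psi> (\<Phi> \<T>) = \<T>"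
      using tau_cotorsion_pair_Fac torsion_class_Fac \<Psi>\<Phi> unfolding \<Phi>_def by auto
  next
    fix p assume "p \<in> {(\<C>, \<D>). tau_cotorsion_pair E \<C> \<D> \<and> torsion_class E \<D>}"
    then show "\<Psi> p \<in> {\<T>. support_tau_tilting E \<T>}" "\<Phi> (\<Psi> p) = p"
      using support_tau_tilting_Int \<Phi>\<Psi> unfolding \<Psi>_def torsion_class_def by auto
  next
    show "{\<T>. tilting E \<T>} \<subseteq> {\<T>. support_tau_tilting E \<T>}" using tilting_support_tau_tilting by blast
    show "{(\<C>, \<D>). cotorsion_pair E \<C> \<D> \<and> torsion_class E \<D>}
      \<subseteq> {(\<C>, \<D>). tau_cotorsion_pair E \<C> \<D> \<and> torsion_class E \<D>}"
      using cotorsion_pair_tau_cotorsion_pair by blast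
  next
    fix \<T> assume "\<T> \<in> {\<T>. tilting E \<T>}"
    then show "\<Phi> \<T> \<in> {(\<C>, \<D>). cotorsion_pair E \<C> \<D> \<and> torsion_class E \<D>}" "\<Psi> (\<Phi> \<T>) = \<T>"
      using cotorsion_pair_Fac torsion_class_Fac \<Psi>\<Phi> tilting_support_tau_tilting unfolding \<Phi>_def by auto
  next
    fix p assume "p \<in> {(\<C>, \<D>). cotorsion_pair E \<C> \<D> \<and> torsion_class E \<D>}"
    then show "\<Psi> p \<in> {\<T>. tilting E \<T>}" "\<Phi> (\<Psi> p) = p"
      using tilting_Int \<Phi>\<Psi> cotorsion_pair_tau_cotorsion_pair unfolding \<Psi>_def torsion_class_def by auto
  qed
qed

end
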